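(* Let $y\in\mathbb{R}$, let $X=(X_t)_{t\ge0}$ be the process (depending on $y$) constructed in the context, and let $\Gamma:=\Gamma^y:=\int_0^\infty\mathbf{1}_{\{X_s<0\}}\,\mathrm{d}s$ be the total time $X$ spends below $0$. Then $$\mathbb{P}(\Gamma\le u)=\begin{cases}\dfrac{\int_0^u\frac{1}{\sqrt t}e^{-\frac{y^2}{2t}}\,\mathrm{d}t}{\int_0^1\frac{1}{\sqrt t}e^{-\frac{y^2}{2t}}\,\mathrm{d}t}, & u\in[0,1],\ y\le 0,\\[4mm] \dfrac{\sqrt{2\pi}\,y+2\sqrt{u}}{\sqrt{2\pi}\,y+2}, & u\in[0,1],\ y\ge 0.\end{cases}$$
   Context: For $t>0$ and $u\ge 0$ let $q^y(t,u):=\mathbb{P}\left(\int_0^t \mathbf{1}_{\{b'_s<0\}}\,\mathrm{d}s\le u\right)$, where $(b'_s)_{s\in[0,t]}$ is a Brownian bridge of length $t$ with $b'_0=y$ and $b'_t=0$. Construction of $X$ for fixed $y\in\mathbb{R}$: 1. Let $g=g^y$ be a non-negative random variable whose distribution function is, for $x\ge 0$, $$\mathbb{P}(g\le x)=\begin{cases}\mathbf{1}_{\{x\le 1\}}\frac{\sqrt{x}}{2}+\mathbf{1}_{\{x>1\}}\left(1-\frac{1}{2\sqrt{x}}\right), & y=0,\\[2mm] \dfrac{\int_0^x q^y(t,1)\frac{1}{\sqrt t}e^{-\frac{y^2}{2t}}\,\mathrm{d}t}{2\int_0^1\frac{1}{\sqrt t}e^{-\frac{y^2}{2t}}\,\mathrm{d}t},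 & y<0,\\[4mm] \dfrac{2\sqrt{2\pi}\,y+\int_0^x q^y(t,1)\frac{1}{\sqrt t}e^{-\frac{y^2}{2t}}\,\mathrm{d}t}{2\sqrt{2\pi}\,y+4}, & y>0.\end{cases}$$ 2. Let $b=(b_t)_{t\in[0,1]}$ be a process whose conditional law given $\{g=x\}$, for $x\ge 0$, is that of a standard Brownian bridge on $[0,1]$ (from $0$ to $0$) conditioned on the event $\int_0^x\mathbf{1}_{\{\sqrt{x}\,b_{s/x}+y-\frac{s}{x}y<0\}}\,\mathrm{d}s\le 1$ (for $x=0$ this condition is vacuous). 3. Let $Z=(Z_t)_{t\ge0}$ be a three-dimensional Bessel process starting in $0$, independent of $(g,b)$. 4. For $y>0$, let $Y=(Y_t)_{t\ge0}$ be a three-dimensional Bessel process starting in $y$, independent of $(g,b,Z)$. 5. Define, for $t\ge0$, $$X_t:=\mathbf{1}_{\{g>0,\,t<g\}}\left(\sqrt{g}\,b_{t/g}+y-\tfrac{t}{g}y\right)+\mathbf{1}_{\{g>0,\,t\ge g\}}Z_{t-g}+\mathbf{1}_{\{g=0,\,y>0\}}Y_t.$$ *)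

theory Defs
  imports "HOL-Probability.Probability"
begin

text \<open>Continuous real functions on the index set \<open>I\<close>, with the sigma-algebra generated by
  the evaluations at the points of \<open>I\<close>.\<close>

definition path_space :: "real set \<Rightarrow> (real \<Rightarrow> real) measure" where
  "path_space I = restrict_space (Pi\<^sub>M I (\<lambda>_. borel)) {w. continuous_on I w}"

definition sample_path :: "real set \<Rightarrow> (real \<Rightarrow> 'a \<Rightarrow> real) \<Rightarrow> 'a \<Rightarrow> real \<Rightarrow> real" where
  "sample_path I W \<omega> = (\<lambda>t\<in>I. W t \<omega>)"

definition continuous_process ::
    "'a measure \<Rightarrow> real set \<Rightarrow> (real \<Rightarrow> 'a \<Rightarrow> real) \<Rightarrow> bool" where
  "continuous_process M I W \<longleftrightarrow>
     (\<forall>t\<in>I. W t \<in> borel_measurable M) \<and>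
     (\<forall>\<omega>\<in>space M. continuous_on I (\<lambda>t. W t \<omega>))"

definition path_law ::
    "'a measure \<Rightarrow> real set \<Rightarrow> (real \<Rightarrow> 'a \<Rightarrow> real) \<Rightarrow> (real \<Rightarrow> real) measure" where
  "path_law M I W = distr M (path_space I) (sample_path I W)"

definition brownian_motion :: "'a measure \<Rightarrow> (real \<Rightarrow> 'a \<Rightarrow> real) \<Rightarrow> bool" where
  "brownian_motion M B \<longleftrightarrow>
     prob_space M \<and> continuous_process M {0..} B \<and>
     (AE \<omega> in M. B 0 \<omega> = 0) \<and>
     (\<forall>s t. 0 \<le> s \<and> s < t \<longrightarrow>
        distributed M lborel (\<lambda>\<omega>. B t \<omega> - B s \<omega>)
          (\<lambda>x. ennreal (normal_density 0 (sqrt (t - s)) x))) \<and>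
     (\<forall>(\<tau> :: nat \<Rightarrow> real) n. mono \<tau> \<and> 0 \<le> \<tau> 0 \<longrightarrow>
        prob_space.indep_vars M (\<lambda>_. borel)
          (\<lambda>i \<omega>. B (\<tau> (Suc i)) \<omega> - B (\<tau> i) \<omega>) {..<n})"

text \<open>Wiener measure is the only measure on the path space with the defining property below.\<close>

definition wiener :: "(real \<Rightarrow> real) measure" where
  "wiener = (THE P. sets P = sets (path_space {0..}) \<and> brownian_motion P (\<lambda>t w. w t))"

text \<open>The law of the Brownian bridge of length \<open>T\<close> from \<open>a\<close> to \<open>c\<close>: a Brownian motion \<open>w\<close> is
  tied down at time \<open>T\<close> by subtracting \<open>(s/T) w\<^sub>T\<close>, and the line from \<open>a\<close> to \<open>c\<close> is added.\<close>

definition bridge_law :: "real \<Rightarrow> real \<Rightarrow> real \<Rightarrow> (real \<Rightarrow> real) measure" where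
  "bridge_law T a c =
     path_law wiener {0..T} (\<lambda>s w. w s - s / T * w T + a + s / T * (c - a))"

definition brownian_motion3 ::
    "'a measure \<Rightarrow> real ^ 3 \<Rightarrow> (real \<Rightarrow> 'a \<Rightarrow> real ^ 3) \<Rightarrow> bool" where
  "brownian_motion3 M v R \<longleftrightarrow>
     prob_space M \<and>
     (\<forall>i. brownian_motion M (\<lambda>t \<omega>. R t \<omega> $ i - v $ i)) \<and>
     prob_space.indep_vars M (\<lambda>_. path_space {0..}) (\<lambda>i. sample_path {0..} (\<lambda>t \<omega>. R t \<omega> $ i)) UNIV"

text \<open>A three-dimensional Bessel process has the law of the norm of a three-dimensional Brownian
  motion. The latter may live on another probability space; since only its law matters, taking
  that space on the type of \<open>\<real>\<^sup>3\<close>-valued paths is no restriction.\<close>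

definition bessel3 :: "'a measure \<Rightarrow> real \<Rightarrow> (real \<Rightarrow> 'a \<Rightarrow> real) \<Rightarrow> bool" where
  "bessel3 M x Z \<longleftrightarrow>
     continuous_process M {0..} Z \<and>
     (\<exists>(N :: (real \<Rightarrow> real ^ 3) measure) v R.
        norm v = x \<and> brownian_motion3 N v R \<and>
        path_law M {0..} Z = path_law N {0..} (\<lambda>t \<omega>. norm (R t \<omega>)))"

definition time_below :: "real \<Rightarrow> (real \<Rightarrow> real) \<Rightarrow> real" where
  "time_below t w = (LBINT s:{0..t}. of_bool (w s < 0))"

definition bridge_q :: "real \<Rightarrow> real \<Rightarrow> real \<Rightarrow> real" where
  "bridge_q y t u =
     measure (bridge_law t y 0) {w \<in> space (bridge_law t y 0). time_below t w \<le> u}"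

definition weight :: "real \<Rightarrow> real \<Rightarrow> real" where
  "weight y t = 1 / sqrt t * exp (- (y\<^sup>2 / (2 * t)))"

definition g_cdf :: "real \<Rightarrow> real \<Rightarrow> real" where
  "g_cdf y x =
     (if y = 0 then
        of_bool (x \<le> 1) * (sqrt x / 2) + of_bool (x > 1) * (1 - 1 / (2 * sqrt x))
      else if y < 0 then
        (LBINT t:{0..x}. bridge_q y t 1 * weight y t) / (2 * (LBINT t:{0..1}. weight y t))
      else
        (2 * sqrt (2 * pi) * y + (LBINT t:{0..x}. bridge_q y t 1 * weight y t)) /
        (2 * sqrt (2 * pi) * y + 4))"

text \<open>For a bridge \<open>w\<close> from 0 to 0 on the unit interval, this is a path of length \<open>x\<close> from
  \<open>y\<close> to 0.\<close>

definition stretch :: "real \<Rightarrow> real \<Rightarrow> (real \<Rightarrow> real) \<Rightarrow> real \<Rightarrow> real" where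
  "stretch y x w s = sqrt x * w (s / x) + y - s / x * y"

text \<open>Conditioning on an event \<open>A\<close> is \<^const>\<open>uniform_measure\<close>: it maps \<open>B\<close> to
  \<open>P (A \<inter> B) / P A\<close>. For \<open>x = 0\<close> the event is the whole space.\<close>

definition conditioned_bridge_law :: "real \<Rightarrow> real \<Rightarrow> (real \<Rightarrow> real) measure" where
  "conditioned_bridge_law y x =
     uniform_measure (bridge_law 1 0 0)
       {w \<in> space (bridge_law 1 0 0). time_below x (stretch y x w) \<le> 1}"

text \<open>Unlike the library's \<^const>\<open>prob_space.indep_var\<close>, this allows the two random
  variables to take values in different types.\<close>

definition indep_rv ::
    "'a measure \<Rightarrow> 'b measure \<Rightarrow> ('a \<Rightarrow> 'b) \<Rightarrow> 'c measure \<Rightarrow> ('a \<Rightarrow> 'c) \<Rightarrow> bool" where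
  "indep_rv M S U T V \<longleftrightarrow>
     U \<in> measurable M S \<and> V \<in> measurable M T \<and>
     prob_space.indep_set M {U -` A \<inter> space M | A. A \<in> sets S}
       {V -` A \<inter> space M | A. A \<in> sets T}"

text \<open>\<open>K x\<close> is the conditional law of the path of \<open>W\<close> on \<open>I\<close> given \<open>g = x\<close>.\<close>

definition has_conditional_law ::
    "'a measure \<Rightarrow> real set \<Rightarrow> (real \<Rightarrow> 'a \<Rightarrow> real) \<Rightarrow> ('a \<Rightarrow> real) \<Rightarrow>
     (real \<Rightarrow> (real \<Rightarrow> real) measure) \<Rightarrow> bool" where
  "has_conditional_law M I W g K \<longleftrightarrow>
     (\<forall>A\<in>sets borel. \<forall>B\<in>sets (path_space I).
        emeasure M {\<omega>\<in>space M. g \<omega> \<in> A \<and> sample_path I W \<omega> \<in> B} =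
        (\<integral>\<^sup>+x\<in>A. emeasure (K x) B \<partial>distr M borel g))"

definition X_process ::
    "real \<Rightarrow> ('a \<Rightarrow> real) \<Rightarrow> (real \<Rightarrow> 'a \<Rightarrow> real) \<Rightarrow> (real \<Rightarrow> 'a \<Rightarrow> real) \<Rightarrow>
     (real \<Rightarrow> 'a \<Rightarrow> real) \<Rightarrow> real \<Rightarrow> 'a \<Rightarrow> real" where
  "X_process y g b Z Y t \<omega> =
     of_bool (g \<omega> > 0 \<and> t < g \<omega>) * stretch y (g \<omega>) (\<lambda>r. b r \<omega>) t +
     of_bool (g \<omega> > 0 \<and> t \<ge> g \<omega>) * Z (t - g \<omega>) \<omega> +
     of_bool (g \<omega> = 0 \<and> y > 0) * Y t \<omega>"

definition total_time_below :: "(real \<Rightarrow> 'a \<Rightarrow> real) \<Rightarrow> 'a \<Rightarrow> ennreal" where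
  "total_time_below X \<omega> = (\<integral>\<^sup>+s\<in>{0..}. of_bool (X s \<omega> < 0) \<partial>lborel)"

end

theory Submission imports Defs "HOL-Real_Asymp.Real_Asymp"
begin

text \<open>
  Almost surely the process spends time below 0 only before \<open>g\<close>, so by the choice of the law of \<open>g\<close> everything
  reduces to the integral of \<open>P(A\<^sub>t \<le> u)\<close> against \<open>t\<^sup>-\<^sup>1\<^sup>/\<^sup>2 exp (- y\<^sup>2 / (2 t)) dt\<close>, where \<open>A\<^sub>t\<close> is the time
  below 0 of a Brownian bridge of length \<open>t\<close> from \<open>y\<close> to 0. Up to a constant, this is the mass of
  \<open>[0, u]\<close> under the law of the time below 0 for the Green measure of Brownian paths from \<open>y\<close> to 0.
  Its Laplace transform is the Green function of \<open>1/2 \<Delta> - \<alpha> 1{x < 0}\<close>, computed by Kac's method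
  after adding a killing rate \<open>m\<^sup>2/2 = a\<^sup>2/2 - \<alpha>\<close> that tends to 0 in the end:
  writing the total killing as a constant rate \<open>a\<^sup>2/2\<close> minus \<open>\<alpha> 1{x \<ge> 0}\<close> makes all terms of the Duhamel equation
  non-negative and the equation a contraction, so it suffices to exhibit one bounded solution.

  The Markov property of the bridge used for this equation, like its scaling property, is an identity
  between covariances, because the characteristic functions of its finite-dimensional distributions
  determine the law of a continuous process.

  For \<open>y = 0\<close> the law of \<open>g\<close> is given in closed form, and one also needs that \<open>A\<^sub>t\<close> is uniform on
  \<open>[0, t]\<close>. This follows from the same resolvent by inverting the Laplace transform in both variables.
\<close>

section \<open>Characteristic functions and finite-dimensional distributions\<close>

text \<open>Since \<open>weight y t\<close> is sqrt(2 pi) times the transition density from y to 0,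
  a bridge of length t weighted by it is a free Brownian path from y that is at 0 at time t. The
  density of g on the positive half-line carries the factor P(A_t \<le> 1), and conditioning b
  divides by exactly this probability; for u \<le> 1 the two cancel and P(A_t \<le> u) remains. The
  answer can be predicted: a clock that runs only while Brownian motion is negative turns it into a
  motion reflected at 0 and started from min(y, 0). Its transition density to 0 is twice the free
  one, hence the factor 2 and the argument \<open>min y 0\<close> throughout. The atom of g at 0,
  where X is the Bessel process Y throughout, contributes the summand sqrt(2 pi) y for y > 0. The
  proof replaces this picture by Laplace transforms in the occupation variable. The heat kernel has
  an infinite time integral, so the measures compared are infinite; hence the killing rate m, and a
  uniqueness theorem for transforms that does not presuppose finite measures.\<close>

lemma weighted_Levy_uniqueness:
  fixes X Y :: "'a \<Rightarrow> real" and X' Y' :: "'b \<Rightarrow> real"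
  assumes "prob_space M" "prob_space M'"
    and [measurable]: "X \<in> borel_measurable M" "Y \<in> borel_measurable M"
      "X' \<in> borel_measurable M'" "Y' \<in> borel_measurable M'" "A \<in> sets borel"
    and Y: "\<And>x. 0 \<le> Y x" "\<And>x. Y x \<le> B" and Y': "\<And>x. 0 \<le> Y' x" "\<And>x. Y' x \<le> B"
    and eq: "\<And>\<theta>. (CLINT x|M. Y x * iexp (\<theta> * X x)) = (CLINT x|M'. Y' x * iexp (\<theta> * X' x))"
  shows "(LINT x|M. Y x * indicator A (X x)) = (LINT x|M'. Y' x * indicator A (X' x))"
proof -
  interpret M: prob_space M by fact
  interpret M': prob_space M' by fact
  have int: "integrable M Y" "integrable M' Y'"
    by (auto intro!: M.integrable_const_bound[where B=B] M'.integrable_const_bound[where B=B]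
        simp: Y Y')
  define c where "c = (LINT x|M. Y x)"
  \<comment> \<open>At \<theta> = 0 the hypothesis compares the total masses, so one constant c
    normalises both weighted measures to probability measures.\<close>
  have c': "c = (LINT x|M'. Y' x)"
    using eq[of 0] by (simp add: c_def)
  have c0: "0 \<le> c" by (simp add: c_def Y)
  show ?thesis
  proof (cases "c = 0")
    \<comment> \<open>There is nothing to normalise: the non-negative weights vanish almost
      everywhere and both sides are 0.\<close>
    case True
    have "AE x in M. Y x = 0"
      using integral_nonneg_eq_0_iff_AE[OF int(1)] True Y c_def by auto
    then have 1: "(LINT x|M. Y x * indicator A (X x)) = (LINT x|M. 0)"
      by (intro integral_cong_AE) auto
    have "AE x in M'. Y' x = 0"
      using integral_nonneg_eq_0_iff_AE[OF int(2)] True Y' c' by auto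
    then have 2: "(LINT x|M'. Y' x * indicator A (X' x)) = (LINT x|M'. 0)"
      by (intro integral_cong_AE) auto
    show ?thesis unfolding 1 2 by simp
  next
    case False
    with c0 have c: "0 < c" by simp
    define N where "N = distr (density M (\<lambda>x. ennreal (Y x / c))) borel X"
    define N' where "N' = distr (density M' (\<lambda>x. ennreal (Y' x / c))) borel X'"
    have prob: "prob_space (density M (\<lambda>x. ennreal (Y x / c)))"
      "prob_space (density M' (\<lambda>x. ennreal (Y' x / c)))"
      using c int c' c_def Y Y'
      by (auto intro!: prob_spaceI simp: emeasure_density nn_integral_eq_integral cong: nn_integral_cong)
    have rd: "real_distribution N" "real_distribution N'"
      unfolding N_def N'_def
      by (auto intro!: real_distribution.intro prob_space.prob_space_distr prob
          simp: real_distribution_axioms_def)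
    have chN: "char N \<theta> = (1 / c) * (CLINT x|M. Y x * iexp (\<theta> * X x))" for \<theta>
      using c by (simp add: N_def char_def integral_distr integral_density Y scaleR_conv_of_real
          flip: integral_mult_right_zero)
    have chN': "char N' \<theta> = (1 / c) * (CLINT x|M'. Y' x * iexp (\<theta> * X' x))" for \<theta>
      using c by (simp add: N'_def char_def integral_distr integral_density Y' scaleR_conv_of_real
          flip: integral_mult_right_zero)
    have "N = N'"
      by (intro Levy_uniqueness rd ext) (simp only: chN chN' eq)
    then have "measure N A = measure N' A" by simp
    moreover have "measure N A = (LINT x|M. Y x / c * indicator A (X x))"
      using c integral_distr[of X "density M (\<lambda>x. ennreal (Y x / c))" borel "indicator A :: real \<Rightarrow> real"]
      by (simp add: N_def integral_density Y space_distr)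
    moreover have "measure N' A = (LINT x|M'. Y' x / c * indicator A (X' x))"
      using c integral_distr[of X' "density M' (\<lambda>x. ennreal (Y' x / c))" borel "indicator A :: real \<Rightarrow> real"]
      by (simp add: N'_def integral_density Y')
    ultimately show ?thesis using c by simp
  qed
qed

lemma iexp_add: "iexp (a + b) = iexp a * iexp b"
  by (simp add: distrib_left exp_add)

text \<open>The one-dimensional theorem needs non-negative weights, which \<open>D (1 + cos \<Phi>)\<close> and \<open>D (1 + sin \<Phi>)\<close> are.\<close>

lemma weighted_Levy_uniqueness_iexp:
  fixes X D \<Phi> :: "'a \<Rightarrow> real" and X' D' \<Phi>' :: "'b \<Rightarrow> real"
  assumes pr: "prob_space M" "prob_space M'"
    and [measurable]: "X \<in> borel_measurable M" "D \<in> borel_measurable M" "\<Phi> \<in> borel_measurable M"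
      "X' \<in> borel_measurable M'" "D' \<in> borel_measurable M'" "\<Phi>' \<in> borel_measurable M'" "A \<in> sets borel"
    and D: "\<And>x. 0 \<le> D x" "\<And>x. D x \<le> 1" and D': "\<And>x. 0 \<le> D' x" "\<And>x. D' x \<le> 1"
    and eq: "\<And>\<theta> \<sigma>. (CLINT x|M. D x * iexp (\<theta> * X x + \<sigma> * \<Phi> x))
      = (CLINT x|M'. D' x * iexp (\<theta> * X' x + \<sigma> * \<Phi>' x))"
  shows "(CLINT x|M. (D x * indicator A (X x)) * iexp (\<Phi> x))
      = (CLINT x|M'. (D' x * indicator A (X' x)) * iexp (\<Phi>' x))"
proof -
  interpret M: prob_space M by fact
  interpret M': prob_space M' by fact
  have int: "integrable M (\<lambda>x. D x * iexp (f x))" if [measurable]: "f \<in> borel_measurable M" for f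
    by (rule M.integrable_const_bound[where B=1]) (auto simp: norm_mult D)
  have int': "integrable M' (\<lambda>x. D' x * iexp (f x))" if [measurable]: "f \<in> borel_measurable M'" for f
    by (rule M'.integrable_const_bound[where B=1]) (auto simp: norm_mult D')
  have i1: "integrable M (\<lambda>x. D x * indicator A (X x) * f x)"
    if [measurable]: "f \<in> borel_measurable M" and "\<And>x. \<bar>f x\<bar> \<le> 1" for f :: "'a \<Rightarrow> real"
    using that by (intro M.integrable_const_bound[where B=1])
      (auto simp: abs_mult D indicator_def intro!: mult_le_one)
  have i1': "integrable M' (\<lambda>x. D' x * indicator A (X' x) * f x)"
    if [measurable]: "f \<in> borel_measurable M'" and "\<And>x. \<bar>f x\<bar> \<le> 1" for f :: "'b \<Rightarrow> real"
    using that by (intro M'.integrable_const_bound[where B=1])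
      (auto simp: abs_mult D' indicator_def intro!: mult_le_one)
  have lin: "(CLINT x|M. D x * iexp (f x) + a * (D x * iexp (g x)) + b * (D x * iexp (h x)))
    = (CLINT x|M. D x * iexp (f x)) + a * (CLINT x|M. D x * iexp (g x)) + b * (CLINT x|M. D x * iexp (h x))"
    if "f \<in> borel_measurable M" "g \<in> borel_measurable M" "h \<in> borel_measurable M" for f g h a b
    using that by (simp add: int)
  have lin': "(CLINT x|M'. D' x * iexp (f x) + a * (D' x * iexp (g x)) + b * (D' x * iexp (h x)))
    = (CLINT x|M'. D' x * iexp (f x)) + a * (CLINT x|M'. D' x * iexp (g x)) + b * (CLINT x|M'. D' x * iexp (h x))"
    if "f \<in> borel_measurable M'" "g \<in> borel_measurable M'" "h \<in> borel_measurable M'" for f g h a b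
    using that by (simp add: int')
  have bnd: "0 \<le> d * (1 + c) \<and> d * (1 + c) \<le> 2" if "0 \<le> d" "d \<le> 1" "- 1 \<le> c" "c \<le> 1" for c d :: real
    using that mult_mono[of d 1 "1 + c" 2] by auto
  \<comment> \<open>cos and sin are expanded into exponentials, so that \<Phi> occurs only with the
    factors 0, 1 and -1; \<open>eq\<close> covers these as values of \<sigma>.\<close>
  have cos: "complex_of_real (d * (1 + cos p)) * iexp (\<theta> * x)
     = d * iexp (\<theta> * x + 0 * p) + (1/2) * (d * iexp (\<theta> * x + 1 * p)) + (1/2) * (d * iexp (\<theta> * x + (-1) * p))"
    for d p \<theta> x
    by (simp add: cos_of_real[symmetric] cos_exp_eq exp_add exp_diff exp_minus field_simps)
  have sin: "complex_of_real (d * (1 + sin p)) * iexp (\<theta> * x)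
     = d * iexp (\<theta> * x + 0 * p) + (- \<i>/2) * (d * iexp (\<theta> * x + 1 * p)) + (\<i>/2) * (d * iexp (\<theta> * x + (-1) * p))"
    for d p \<theta> x
    by (simp add: sin_of_real[symmetric] sin_exp_eq exp_add exp_diff exp_minus field_simps)
  \<comment> \<open>The case \<sigma> = 0; it is subtracted below from the versions with 1 + cos and
    1 + sin.\<close>
  have b0: "(LINT x|M. D x * indicator A (X x)) = (LINT x|M'. D' x * indicator A (X' x))"
    using eq[of _ 0] by (intro weighted_Levy_uniqueness[where B=1] pr) (auto simp: D D')
  have "(LINT x|M. (D x * (1 + cos (\<Phi> x))) * indicator A (X x))
     = (LINT x|M'. (D' x * (1 + cos (\<Phi>' x))) * indicator A (X' x))"
  proof (rule weighted_Levy_uniqueness[where B=2])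
    show "D x * (1 + cos (\<Phi> x)) \<le> 2" "0 \<le> D x * (1 + cos (\<Phi> x))" for x
      using bnd[OF D, of "cos (\<Phi> x)" x] by auto
    show "D' x * (1 + cos (\<Phi>' x)) \<le> 2" "0 \<le> D' x * (1 + cos (\<Phi>' x))" for x
      using bnd[OF D', of "cos (\<Phi>' x)" x] by auto
    show "(CLINT x|M. complex_of_real (D x * (1 + cos (\<Phi> x))) * iexp (\<theta> * X x))
      = (CLINT x|M'. complex_of_real (D' x * (1 + cos (\<Phi>' x))) * iexp (\<theta> * X' x))" for \<theta>
      unfolding cos by (subst lin, measurable, subst lin', measurable, simp only: eq)
  qed (use pr in auto)
  then have b1: "(LINT x|M. D x * indicator A (X x) * cos (\<Phi> x)) = (LINT x|M'. D' x * indicator A (X' x) * cos (\<Phi>' x))"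
    using b0 i1[of "\<lambda>_. 1"] i1[of "\<lambda>x. cos (\<Phi> x)"] i1'[of "\<lambda>_. 1"] i1'[of "\<lambda>x. cos (\<Phi>' x)"]
    by (simp add: algebra_simps)
  have "(LINT x|M. (D x * (1 + sin (\<Phi> x))) * indicator A (X x))
     = (LINT x|M'. (D' x * (1 + sin (\<Phi>' x))) * indicator A (X' x))"
  proof (rule weighted_Levy_uniqueness[where B=2])
    show "D x * (1 + sin (\<Phi> x)) \<le> 2" "0 \<le> D x * (1 + sin (\<Phi> x))" for x
      using bnd[OF D, of "sin (\<Phi> x)" x] by auto
    show "D' x * (1 + sin (\<Phi>' x)) \<le> 2" "0 \<le> D' x * (1 + sin (\<Phi>' x))" for x
      using bnd[OF D', of "sin (\<Phi>' x)" x] by auto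
    show "(CLINT x|M. complex_of_real (D x * (1 + sin (\<Phi> x))) * iexp (\<theta> * X x))
      = (CLINT x|M'. complex_of_real (D' x * (1 + sin (\<Phi>' x))) * iexp (\<theta> * X' x))" for \<theta>
      unfolding sin by (subst lin, measurable, subst lin', measurable, simp only: eq)
  qed (use pr in auto)
  then have b2: "(LINT x|M. D x * indicator A (X x) * sin (\<Phi> x)) = (LINT x|M'. D' x * indicator A (X' x) * sin (\<Phi>' x))"
    using b0 i1[of "\<lambda>_. 1"] i1[of "\<lambda>x. sin (\<Phi> x)"] i1'[of "\<lambda>_. 1"] i1'[of "\<lambda>x. sin (\<Phi>' x)"]
    by (simp add: algebra_simps)
  have dec: "complex_of_real (d * indicator A x) * iexp p
      = complex_of_real (d * indicator A x * cos p) + \<i> * complex_of_real (d * indicator A x * sin p)" for d x p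
    by (simp add: exp_Euler cos_of_real sin_of_real distrib_left)
  show ?thesis
    unfolding dec
    by (subst (1 2) Bochner_Integration.integral_add)
       (auto intro!: integrable_mult_right integrable_of_real i1 i1' simp del: of_real_mult simp: b1 b2)
qed

text \<open>Indicators are introduced one coordinate at a time. In the induction on K the
  exponential has arbitrary frequencies on an arbitrary L, so adding j to K trades an exponential in
  coordinate j for the indicator of \<open>A j\<close>. In the end L is empty.\<close>

lemma char_determines_fdd:
  fixes X :: "'i \<Rightarrow> 'a \<Rightarrow> real" and X' :: "'i \<Rightarrow> 'b \<Rightarrow> real"
  assumes pr: "prob_space M" "prob_space M'"
    and m[measurable]: "\<And>i. i \<in> I \<Longrightarrow> X i \<in> borel_measurable M" "\<And>i. i \<in> I \<Longrightarrow> X' i \<in> borel_measurable M'"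
    and eq: "\<And>L c. finite L \<Longrightarrow> L \<subseteq> I \<Longrightarrow>
      (CLINT x|M. iexp (\<Sum>i\<in>L. c i * X i x)) = (CLINT x|M'. iexp (\<Sum>i\<in>L. c i * X' i x))"
    and K: "finite K" "K \<subseteq> I" and A[measurable]: "\<And>i. A i \<in> sets borel"
  shows "measure M {x\<in>space M. \<forall>i\<in>K. X i x \<in> A i} = measure M' {x\<in>space M'. \<forall>i\<in>K. X' i x \<in> A i}"
proof -
  have "(CLINT x|M. (\<Prod>i\<in>K. indicator (A i) (X i x) :: real) * iexp (\<Sum>i\<in>L. c i * X i x))
      = (CLINT x|M'. (\<Prod>i\<in>K. indicator (A i) (X' i x) :: real) * iexp (\<Sum>i\<in>L. c i * X' i x))"
    if "finite L" "L \<subseteq> I" for L and c :: "'i \<Rightarrow> real"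
    using K that
  proof (induction K arbitrary: L c)
    case empty
    then show ?case using eq by simp
  next
    case (insert j K)
    have [measurable]: "j \<in> I" using insert.prems by simp
    have mm: "(\<lambda>x. \<Prod>i\<in>K. indicator (A i) (X i x) :: real) \<in> borel_measurable M"
      "(\<lambda>x. \<Prod>i\<in>K. indicator (A i) (X' i x) :: real) \<in> borel_measurable M'"
      "(\<lambda>x. \<Sum>i\<in>L. c i * X i x) \<in> borel_measurable M"
      "(\<lambda>x. \<Sum>i\<in>L. c i * X' i x) \<in> borel_measurable M'"
      using insert.prems
      by (auto intro!: borel_measurable_prod borel_measurable_sum borel_measurable_times
          borel_measurable_indicator' m)
    have "(CLINT x|M. complex_of_real ((\<Prod>i\<in>K. indicator (A i) (X i x)) * indicator (A j) (X j x)) * iexp (\<Sum>i\<in>L. c i * X i x))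
      = (CLINT x|M'. complex_of_real ((\<Prod>i\<in>K. indicator (A i) (X' i x)) * indicator (A j) (X' j x)) * iexp (\<Sum>i\<in>L. c i * X' i x))"
    proof (rule weighted_Levy_uniqueness_iexp)
      fix \<theta> \<sigma> :: real
      \<comment> \<open>j may already belong to L; its coefficient then collects \<theta> and
        \<sigma> times the old one.\<close>
      define c' where "c' = (\<lambda>i. (if i = j then \<theta> else 0) + (if i \<in> L then \<sigma> * c i else 0))"
      have c': "\<theta> * Z j + \<sigma> * (\<Sum>i\<in>L. c i * Z i) = (\<Sum>i\<in>insert j L. c' i * Z i)" for Z :: "'i \<Rightarrow> real"
      proof -
        have "(\<Sum>i\<in>insert j L. c' i * Z i) = (\<Sum>i\<in>insert j L. (if i = j then \<theta> else 0) * Z i)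
            + (\<Sum>i\<in>insert j L. (if i \<in> L then \<sigma> * c i else 0) * Z i)"
          by (simp add: c'_def distrib_right sum.distrib)
        also have "(\<Sum>i\<in>insert j L. (if i = j then \<theta> else 0) * Z i) = \<theta> * Z j"
          using insert.prems by (subst sum.remove[of _ j]) (auto intro!: sum.neutral)
        also have "(\<Sum>i\<in>insert j L. (if i \<in> L then \<sigma> * c i else 0) * Z i) = (\<Sum>i\<in>L. \<sigma> * c i * Z i)"
          using insert.prems by (intro sum.mono_neutral_cong_right) auto
        finally show ?thesis by (simp add: sum_distrib_left mult.assoc)
      qed
      have "(CLINT x|M. (\<Prod>i\<in>K. indicator (A i) (X i x) :: real) * iexp (\<Sum>i\<in>insert j L. c' i * X i x))
        = (CLINT x|M'. (\<Prod>i\<in>K. indicator (A i) (X' i x) :: real) * iexp (\<Sum>i\<in>insert j L. c' i * X' i x))"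
        by (rule insert.IH) (use insert.prems in auto)
      then show "(CLINT x|M. (\<Prod>i\<in>K. indicator (A i) (X i x) :: real) * iexp (\<theta> * X j x + \<sigma> * (\<Sum>i\<in>L. c i * X i x)))
        = (CLINT x|M'. (\<Prod>i\<in>K. indicator (A i) (X' i x) :: real) * iexp (\<theta> * X' j x + \<sigma> * (\<Sum>i\<in>L. c i * X' i x)))"
        unfolding c'[of "\<lambda>i. X i _"] c'[of "\<lambda>i. X' i _"] .
    qed (use pr mm in \<open>auto intro!: prod_nonneg prod_le_1\<close>)
    then show ?case using insert.hyps by (simp add: mult.commute)
  qed
  from this[of "{}"]
  have "(LINT x|M. (\<Prod>i\<in>K. indicator (A i) (X i x) :: real)) = (LINT x|M'. (\<Prod>i\<in>K. indicator (A i) (X' i x) :: real))"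
    by (simp flip: of_real_prod)
  moreover have "(\<lambda>x. \<Prod>i\<in>K. indicator (A i) (Z i x) :: real) = indicator {x. \<forall>i\<in>K. Z i x \<in> A i}"
    for Z :: "'i \<Rightarrow> 'c \<Rightarrow> real"
    using K by (auto simp: indicator_def prod_zero_iff)
  note this[of X] this[of X']
  ultimately show ?thesis
    by (simp add: Int_def conj_commute)
qed

section \<open>Path space and Gaussian processes\<close>

lemma space_path_space: "space (path_space I) = {w \<in> extensional I. continuous_on I w}"
  by (auto simp: path_space_def space_restrict_space space_PiM PiE_def)

lemma measurable_path_space_eval [measurable (raw)]:
  "t \<in> I \<Longrightarrow> (\<lambda>w. w t) \<in> borel_measurable (path_space I)"
  unfolding path_space_def by (intro measurable_restrict_space1) auto

lemma measurable_into_path_space: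
  assumes "\<And>x. x \<in> space M \<Longrightarrow> f x \<in> space (path_space I)"
    and "\<And>t. t \<in> I \<Longrightarrow> (\<lambda>x. f x t) \<in> borel_measurable M"
  shows "f \<in> M \<rightarrow>\<^sub>M path_space I"
proof -
  have "(\<lambda>x t. f x t) \<in> M \<rightarrow>\<^sub>M PiM I (\<lambda>_. borel)"
    using assms by (intro measurable_PiM_single') (auto simp: space_path_space PiE_UNIV_domain PiE_iff)
  then show ?thesis
    using assms(1) unfolding path_space_def
    by (intro measurable_restrict_space2) (auto simp: space_path_space space_restrict_space)
qed

lemma measurable_sample_path:
  "continuous_process M I W \<Longrightarrow> sample_path I W \<in> M \<rightarrow>\<^sub>M path_space I"
  by (rule measurable_into_path_space)
    (auto simp: continuous_process_def sample_path_def space_path_space cong: continuous_on_cong)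

lemma floor_approx_tendsto:
  fixes s :: real
  shows "(\<lambda>n. real_of_int \<lfloor>real (Suc n) * s\<rfloor> / real (Suc n)) \<longlonglongrightarrow> s"
proof (rule tendsto_sandwich)
  have "s - 1 / real (Suc n) \<le> real_of_int \<lfloor>real (Suc n) * s\<rfloor> / real (Suc n) \<and> real_of_int \<lfloor>real (Suc n) * s\<rfloor> / real (Suc n) \<le> s" for n
  proof -
    define N where "N = real (Suc n)"
    have N: "0 < N" by (simp add: N_def)
    have "N * s - 1 \<le> real_of_int \<lfloor>N * s\<rfloor>" "real_of_int \<lfloor>N * s\<rfloor> \<le> N * s" by linarith+
    moreover have "s - 1 / N = (N * s - 1) / N" "s = (N * s) / N" using N by (simp_all add: field_simps)
    ultimately show ?thesis using N unfolding N_def[symmetric]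
      by (metis divide_right_mono less_imp_le)
  qed
  then show "\<forall>\<^sub>F n in sequentially. s - 1 / real (Suc n) \<le> real_of_int \<lfloor>real (Suc n) * s\<rfloor> / real (Suc n)" "\<forall>\<^sub>F n in sequentially. real_of_int \<lfloor>real (Suc n) * s\<rfloor> / real (Suc n) \<le> s"
    by auto
  show "(\<lambda>n. s - 1 / real (Suc n)) \<longlonglongrightarrow> s"
    using tendsto_diff[OF tendsto_const LIMSEQ_inverse_real_of_nat, of s] by (simp add: inverse_eq_divide)
qed simp

text \<open>Time is rounded down to the multiples of 1/(n+1). The rounded time takes countably many
  values, each giving a measurable evaluation, and continuity of the path gives the limit. The map
  \<open>r\<close> clamps the whole line into \<open>I\<close>, where alone the paths are
  controlled.\<close>

lemma measurable_path_space_eval_pair: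
  fixes r :: "real \<Rightarrow> real"
  assumes r: "continuous_on UNIV r" and I: "range r \<subseteq> I"
  shows "(\<lambda>(s, w). w (r s)) \<in> borel_measurable (borel \<Otimes>\<^sub>M path_space I)"
proof (rule borel_measurable_LIMSEQ_real
    [where u="\<lambda>n (s, w). w (r (real_of_int \<lfloor>real (Suc n) * s\<rfloor> / real (Suc n)))"])
  let ?q = "\<lambda>n s :: real. real_of_int \<lfloor>real (Suc n) * s\<rfloor> / real (Suc n)"
  fix n :: nat
  have "(\<lambda>x. (\<lambda>i x. snd x (r (real_of_int i / real (Suc n)))) \<lfloor>real (Suc n) * fst x\<rfloor> x)
      \<in> borel_measurable (borel \<Otimes>\<^sub>M path_space I)"
  proof (rule measurable_compose_countable[where f="\<lambda>i x. snd x (r (real_of_int i / real (Suc n)))"])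
    fix i :: int
    have "r (real_of_int i / real (Suc n)) \<in> I" using I by auto
    then show "(\<lambda>x. snd x (r (real_of_int i / real (Suc n)))) \<in> borel_measurable (borel \<Otimes>\<^sub>M path_space I)"
      by (intro measurable_compose[OF measurable_snd measurable_path_space_eval])
  qed measurable
  then show "(\<lambda>(s, w). w (r (?q n s))) \<in> borel_measurable (borel \<Otimes>\<^sub>M path_space I)"
    by (simp add: case_prod_beta)
next
  fix x :: "real \<times> (real \<Rightarrow> real)" assume x: "x \<in> space (borel \<Otimes>\<^sub>M path_space I)"
  define s w where "s = fst x" and "w = snd x"
  then have [simp]: "x = (s, w)" by simp
  have "continuous_on I w" using x by (simp add: space_pair_measure space_path_space)
  then have cont: "isCont (\<lambda>s. w (r s)) s"
    using continuous_on_compose2[OF _ r I, of w] by (simp add: continuous_on_eq_continuous_at)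
  note floor_approx_tendsto[of s]
  from isCont_tendsto_compose[OF cont this]
  show "(\<lambda>n. case x of (s, w) \<Rightarrow> w (r (real_of_int \<lfloor>real (Suc n) * s\<rfloor> / real (Suc n))))
    \<longlonglongrightarrow> (case x of (s, w) \<Rightarrow> w (r s))" by simp
qed

text \<open>The sigma-algebra of the path space is the trace of the product sigma-algebra, and there
  finite measures are determined by cylinder sets.\<close>

lemma path_law_eqI:
  assumes pr: "prob_space M" "prob_space M'"
    and W: "continuous_process M I W" "continuous_process M' I W'"
    and fdd: "\<And>J A. finite J \<Longrightarrow> J \<subseteq> I \<Longrightarrow> (\<And>t. A t \<in> sets borel) \<Longrightarrow>
      measure M {x\<in>space M. \<forall>t\<in>J. W t x \<in> A t} = measure M' {x\<in>space M'. \<forall>t\<in>J. W' t x \<in> A t}"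
  shows "path_law M I W = path_law M' I W'"
proof (rule measure_eqI)
  interpret M: prob_space M by fact
  interpret M': prob_space M' by fact
  note m [measurable] = measurable_sample_path[OF W(1)] measurable_sample_path[OF W(2)]
  have incl [measurable]: "(\<lambda>w. w) \<in> path_space I \<rightarrow>\<^sub>M PiM I (\<lambda>_. borel)"
    unfolding path_space_def by (intro measurable_restrict_space1) auto
  have m' [measurable]: "sample_path I W \<in> M \<rightarrow>\<^sub>M PiM I (\<lambda>_. borel)" "sample_path I W' \<in> M' \<rightarrow>\<^sub>M PiM I (\<lambda>_. borel)"
    using measurable_compose[OF m(1) incl] measurable_compose[OF m(2) incl] by simp_all
  have eq: "distr M (PiM I (\<lambda>_. borel)) (sample_path I W) = distr M' (PiM I (\<lambda>_. borel)) (sample_path I W')"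
  proof (rule measure_eqI_PiM_infinite)
    fix A :: "real \<Rightarrow> real set" and J assume J: "finite J" "J \<subseteq> I" "\<And>i. i \<in> J \<Longrightarrow> A i \<in> sets borel"
    \<comment> \<open>\<open>fdd\<close> asks for a Borel set at every time, whereas the cylinder
      provides them only on J.\<close>
    define A' where "A' t = (if t \<in> J then A t else UNIV)" for t
    have [measurable]: "A' t \<in> sets borel" for t using J by (auto simp: A'_def)
    have A': "\<And>t. t \<in> J \<Longrightarrow> A t = A' t" by (simp add: A'_def)
    have S: "prod_emb I (\<lambda>_. borel) J (Pi\<^sub>E J A) \<in> sets (PiM I (\<lambda>_. borel))"
      using J by (intro sets_PiM_I) auto
    have "emeasure M (sample_path I W -` prod_emb I (\<lambda>_. borel) J (Pi\<^sub>E J A) \<inter> space M)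
       = emeasure M {x\<in>space M. \<forall>t\<in>J. W t x \<in> A' t}"
      using J(2) by (intro arg_cong2[where f=emeasure]) (auto simp: prod_emb_def sample_path_def A' PiE_iff subset_iff)
    also have "\<dots> = emeasure M' {x\<in>space M'. \<forall>t\<in>J. W' t x \<in> A' t}"
      using fdd[of J A'] J by (simp add: M.emeasure_eq_measure M'.emeasure_eq_measure)
    also have "\<dots> = emeasure M' (sample_path I W' -` prod_emb I (\<lambda>_. borel) J (Pi\<^sub>E J A) \<inter> space M')"
      using J(2) by (intro arg_cong2[where f=emeasure]) (auto simp: prod_emb_def sample_path_def A' PiE_iff subset_iff)
    finally show "emeasure (distr M (PiM I (\<lambda>_. borel)) (sample_path I W)) (prod_emb I (\<lambda>_. borel) J (Pi\<^sub>E J A))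
      = emeasure (distr M' (PiM I (\<lambda>_. borel)) (sample_path I W')) (prod_emb I (\<lambda>_. borel) J (Pi\<^sub>E J A))"
      using S by (simp add: emeasure_distr m')
  qed (auto intro!: prob_space.finite_measure M.prob_space_distr)
  \<comment> \<open>B is the trace of a product-measurable set \<open>B'\<close>. Sample paths are
    continuous, so the two sets have the same preimage.\<close>
  fix B assume "B \<in> sets (path_law M I W)"
  then obtain B' where B': "B' \<in> sets (PiM I (\<lambda>_. borel))" "B = {w. continuous_on I w} \<inter> B'"
    by (auto simp: path_law_def path_space_def sets_restrict_space)
  have B: "B \<in> sets (path_space I)" using \<open>B \<in> _\<close> by (simp add: path_law_def)
  have "sample_path I W -` B \<inter> space M = sample_path I W -` B' \<inter> space M"
    using measurable_space[OF m(1)] by (auto simp: B' space_path_space)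
  moreover have "sample_path I W' -` B \<inter> space M' = sample_path I W' -` B' \<inter> space M'"
    using measurable_space[OF m(2)] by (auto simp: B' space_path_space)
  moreover have "emeasure M (sample_path I W -` B' \<inter> space M) = emeasure M' (sample_path I W' -` B' \<inter> space M')"
    using arg_cong[OF eq, of "\<lambda>N. emeasure N B'"] B' by (simp add: emeasure_distr m')
  ultimately show "emeasure (path_law M I W) B = emeasure (path_law M' I W') B"
    using B by (simp add: path_law_def emeasure_distr m)
qed (simp add: path_law_def)

section \<open>Gaussian processes described by mean and covariance\<close>

text \<open>Gaussian means that every finite linear combination has a Gaussian characteristic
  function. This includes degenerate variances, such as those at the ends of a bridge, where no
  density exists.\<close>

definition gauss_process ::
    "'a measure \<Rightarrow> real set \<Rightarrow> (real \<Rightarrow> 'a \<Rightarrow> real) \<Rightarrow> (real \<Rightarrow> real) \<Rightarrow> (real \<Rightarrow> real \<Rightarrow> real) \<Rightarrow> bool" where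
  "gauss_process M I X m C \<longleftrightarrow> prob_space M \<and> continuous_process M I X \<and>
     (\<forall>L c. finite L \<longrightarrow> L \<subseteq> I \<longrightarrow>
       (CLINT x|M. iexp (\<Sum>t\<in>L. c t * X t x)) =
       iexp (\<Sum>t\<in>L. c t * m t) * complex_of_real (exp (- (\<Sum>s\<in>L. \<Sum>t\<in>L. c s * c t * C s t) / 2)))"

lemma gauss_process_char:
  "gauss_process M I X m C \<Longrightarrow> finite L \<Longrightarrow> L \<subseteq> I \<Longrightarrow>
    (CLINT x|M. iexp (\<Sum>t\<in>L. c t * X t x)) =
       iexp (\<Sum>t\<in>L. c t * m t) * complex_of_real (exp (- (\<Sum>s\<in>L. \<Sum>t\<in>L. c s * c t * C s t) / 2))"
  unfolding gauss_process_def by blast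

text \<open>The identities in law between processes below, including scaling and the Markov
  property, are all reduced to comparing means and covariances in this way.\<close>

lemma gauss_process_path_law_eq:
  assumes X: "gauss_process M I X m C" and X': "gauss_process M' I X' m' C'"
    and m: "\<And>t. t \<in> I \<Longrightarrow> m t = m' t" and C: "\<And>s t. s \<in> I \<Longrightarrow> t \<in> I \<Longrightarrow> C s t = C' s t"
  shows "path_law M I X = path_law M' I X'"
proof (rule path_law_eqI)
  fix J and A :: "real \<Rightarrow> real set" assume J: "finite J" "J \<subseteq> I" "\<And>t. A t \<in> sets borel"
  show "measure M {x\<in>space M. \<forall>t\<in>J. X t x \<in> A t} = measure M' {x\<in>space M'. \<forall>t\<in>J. X' t x \<in> A t}"
  proof (rule char_determines_fdd[where I=I])
    fix L and c :: "real \<Rightarrow> real" assume L: "finite L" "L \<subseteq> I"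
    have "(\<Sum>t\<in>L. c t * m t) = (\<Sum>t\<in>L. c t * m' t)"
      "(\<Sum>s\<in>L. \<Sum>t\<in>L. c s * c t * C s t) = (\<Sum>s\<in>L. \<Sum>t\<in>L. c s * c t * C' s t)"
      using L by (auto intro!: sum.cong simp: m C subset_iff)
    then show "(CLINT x|M. iexp (\<Sum>i\<in>L. c i * X i x)) = (CLINT x|M'. iexp (\<Sum>i\<in>L. c i * X' i x))"
      unfolding gauss_process_char[OF X L] gauss_process_char[OF X' L] by simp
  qed (use X X' J in \<open>auto simp: gauss_process_def continuous_process_def\<close>)
qed (use X X' in \<open>auto simp: gauss_process_def\<close>)

text \<open>The definition sums over sets of times. Here a time may occur repeatedly in the family,
  and the coefficients of equal times are added first.\<close>

lemma gauss_process_family: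
  assumes X: "gauss_process M I X m C" and K: "finite K" "\<tau> ` K \<subseteq> I"
  shows "(CLINT x|M. iexp (\<Sum>k\<in>K. c k * X (\<tau> k) x)) =
       iexp (\<Sum>k\<in>K. c k * m (\<tau> k)) * complex_of_real (exp (- (\<Sum>j\<in>K. \<Sum>k\<in>K. c j * c k * C (\<tau> j) (\<tau> k)) / 2))"
proof -
  define d where "d t = (\<Sum>k\<in>{k\<in>K. \<tau> k = t}. c k)" for t
  have d: "(\<Sum>t\<in>\<tau> ` K. d t * f t) = (\<Sum>k\<in>K. c k * f (\<tau> k))" for f :: "real \<Rightarrow> real"
    unfolding d_def sum_distrib_right
    by (subst sum.image_gen[OF K(1), of "\<lambda>k. c k * f (\<tau> k)" \<tau>]) (auto intro!: sum.cong)
  have 1: "(CLINT x|M. iexp (\<Sum>t\<in>\<tau> ` K. d t * X t x)) =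
       iexp (\<Sum>t\<in>\<tau> ` K. d t * m t) * complex_of_real (exp (- (\<Sum>s\<in>\<tau> ` K. \<Sum>t\<in>\<tau> ` K. d s * d t * C s t) / 2))"
    using X K unfolding gauss_process_def by blast
  have "(\<Sum>s\<in>\<tau> ` K. \<Sum>t\<in>\<tau> ` K. d s * d t * C s t) = (\<Sum>s\<in>\<tau> ` K. d s * (\<Sum>t\<in>\<tau> ` K. d t * C s t))"
    by (simp add: sum_distrib_left mult.assoc)
  also have "\<dots> = (\<Sum>j\<in>K. c j * (\<Sum>k\<in>K. c k * C (\<tau> j) (\<tau> k)))"
    unfolding d ..
  also have "\<dots> = (\<Sum>j\<in>K. \<Sum>k\<in>K. c j * c k * C (\<tau> j) (\<tau> k))"
    by (simp add: sum_distrib_left mult.assoc)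
  finally have 2: "(\<Sum>s\<in>\<tau> ` K. \<Sum>t\<in>\<tau> ` K. d s * d t * C s t) = (\<Sum>j\<in>K. \<Sum>k\<in>K. c j * c k * C (\<tau> j) (\<tau> k))" .
  show ?thesis
    using 1 unfolding d 2 .
qed

text \<open>One closure property for scaling, for time shifts and for pinning by a multiple of the
  value at a fixed time \<tau>. A linear combination of the new process is one of the old process at
  the times \<open>\<sigma> r\<close> and \<tau>, plus a constant.\<close>

lemma gauss_process_linear:
  assumes X: "gauss_process M I X m C"
    and \<sigma>: "\<And>r. r \<in> I' \<Longrightarrow> \<sigma> r \<in> I" and \<tau>: "\<tau> \<in> I"
    and cont: "continuous_on I' \<sigma>" "continuous_on I' b" "continuous_on I' n"
    and m': "\<And>r. r \<in> I' \<Longrightarrow> m' r = a * m (\<sigma> r) + b r * m \<tau> + n r"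
    and C': "\<And>r s. r \<in> I' \<Longrightarrow> s \<in> I' \<Longrightarrow>
      C' r s = a\<^sup>2 * C (\<sigma> r) (\<sigma> s) + a * b s * C (\<sigma> r) \<tau> + a * b r * C \<tau> (\<sigma> s) + b r * b s * C \<tau> \<tau>"
  shows "gauss_process M I' (\<lambda>r x. a * X (\<sigma> r) x + b r * X \<tau> x + n r) m' C'"
  unfolding gauss_process_def
proof (intro conjI allI impI)
  show "prob_space M" using X by (simp add: gauss_process_def)
  have cX: "continuous_on I (\<lambda>t. X t x)" if "x \<in> space M" for x
    using X that by (auto simp: gauss_process_def continuous_process_def)
  have [measurable]: "X t \<in> borel_measurable M" if "t \<in> I" for t
    using X that by (auto simp: gauss_process_def continuous_process_def)
  have "(\<lambda>x. a * X (\<sigma> r) x + b r * X \<tau> x + n r) \<in> borel_measurable M" if "r \<in> I'" for r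
    using \<sigma>[OF that] \<tau> by simp
  then show "continuous_process M I' (\<lambda>r x. a * X (\<sigma> r) x + b r * X \<tau> x + n r)"
    using \<sigma> unfolding continuous_process_def
    by (intro conjI ballI continuous_intros cont continuous_on_compose2[OF cX cont(1)]) auto
  fix L and c :: "real \<Rightarrow> real" assume L: "finite L" "L \<subseteq> I'"
  define \<beta> where "\<beta> = (\<Sum>r\<in>L. c r * b r)"
  \<comment> \<open>\<open>None\<close> stands for the fixed time \<tau> and \<open>Some r\<close>
    for \<open>\<sigma> r\<close>; coinciding times are harmless by
    \<open>gauss_process_family\<close>.\<close>
  define c' where "c' k = (case k of None \<Rightarrow> \<beta> | Some r \<Rightarrow> a * c r)" for k
  define \<tau>' where "\<tau>' k = (case k of None \<Rightarrow> \<tau> | Some r \<Rightarrow> \<sigma> r)" for k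
  let ?K = "insert None (Some ` L)"
  have K: "finite ?K" "\<tau>' ` ?K \<subseteq> I" using L \<sigma> \<tau> by (auto simp: \<tau>'_def)
  have lin: "(\<Sum>k\<in>?K. c' k * f (\<tau>' k)) = \<beta> * f \<tau> + a * (\<Sum>r\<in>L. c r * f (\<sigma> r))" for f :: "real \<Rightarrow> real"
    using L by (simp add: sum.reindex c'_def \<tau>'_def sum_distrib_left mult.assoc)
  have lin': "(\<Sum>r\<in>L. c r * (a * f (\<sigma> r) + b r * f \<tau> + n r))
      = (\<Sum>k\<in>?K. c' k * f (\<tau>' k)) + (\<Sum>r\<in>L. c r * n r)" for f :: "real \<Rightarrow> real"
    unfolding lin \<beta>_def by (simp add: sum_distrib_left sum_distrib_right sum.distrib algebra_simps)
  have "(\<Sum>j\<in>?K. \<Sum>k\<in>?K. c' j * c' k * C (\<tau>' j) (\<tau>' k)) = (\<Sum>j\<in>?K. c' j * (\<Sum>k\<in>?K. c' k * C (\<tau>' j) (\<tau>' k)))"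
    by (simp only: sum_distrib_left mult.assoc)
  also have "\<dots> = \<beta> * (\<beta> * C \<tau> \<tau> + a * (\<Sum>s\<in>L. c s * C \<tau> (\<sigma> s)))
      + a * (\<Sum>r\<in>L. c r * (\<beta> * C (\<sigma> r) \<tau> + a * (\<Sum>s\<in>L. c s * C (\<sigma> r) (\<sigma> s))))"
    unfolding lin by (subst lin) simp
  also have "\<dots> = (\<Sum>r\<in>L. \<Sum>s\<in>L. c r * c s * (b r * b s * C \<tau> \<tau>))
     + (\<Sum>r\<in>L. \<Sum>s\<in>L. c r * c s * (a * b r * C \<tau> (\<sigma> s)))
     + (\<Sum>r\<in>L. \<Sum>s\<in>L. c r * c s * (a * b s * C (\<sigma> r) \<tau>))
     + (\<Sum>r\<in>L. \<Sum>s\<in>L. c r * c s * (a\<^sup>2 * C (\<sigma> r) (\<sigma> s)))"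
  proof -
    have "\<beta> * (\<beta> * C \<tau> \<tau>) = (\<Sum>r\<in>L. \<Sum>s\<in>L. c r * c s * (b r * b s * C \<tau> \<tau>))"
      unfolding \<beta>_def by (simp add: sum_distrib_left sum_distrib_right mult_ac)
    moreover have "\<beta> * (a * (\<Sum>s\<in>L. c s * C \<tau> (\<sigma> s))) = (\<Sum>r\<in>L. \<Sum>s\<in>L. c r * c s * (a * b r * C \<tau> (\<sigma> s)))"
      unfolding \<beta>_def sum_distrib_left[of a] sum_product by (simp add: mult_ac)
    moreover have "a * (\<Sum>r\<in>L. c r * (\<beta> * C (\<sigma> r) \<tau>)) = (\<Sum>r\<in>L. \<Sum>s\<in>L. c r * c s * (a * b s * C (\<sigma> r) \<tau>))"
      unfolding \<beta>_def by (simp add: sum_distrib_left sum_distrib_right mult_ac)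
    moreover have "a * (\<Sum>r\<in>L. c r * (a * (\<Sum>s\<in>L. c s * C (\<sigma> r) (\<sigma> s)))) = (\<Sum>r\<in>L. \<Sum>s\<in>L. c r * c s * (a\<^sup>2 * C (\<sigma> r) (\<sigma> s)))"
      by (simp add: sum_distrib_left power2_eq_square mult_ac)
    ultimately show ?thesis
      by (simp only: distrib_left sum.distrib add_ac)
  qed
  also have "\<dots> = (\<Sum>r\<in>L. \<Sum>s\<in>L. c r * c s * C' r s)"
    using L by (auto simp: subset_iff C' sum.distrib[symmetric] algebra_simps intro!: sum.cong)
  finally have var: "(\<Sum>j\<in>?K. \<Sum>k\<in>?K. c' j * c' k * C (\<tau>' j) (\<tau>' k)) = (\<Sum>r\<in>L. \<Sum>s\<in>L. c r * c s * C' r s)" .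
  have mean: "(\<Sum>r\<in>L. c r * m' r) = (\<Sum>k\<in>?K. c' k * m (\<tau>' k)) + (\<Sum>r\<in>L. c r * n r)"
    unfolding lin'[symmetric] using L by (intro sum.cong) (auto simp: m')
  have "(CLINT x|M. iexp (\<Sum>t\<in>L. c t * (a * X (\<sigma> t) x + b t * X \<tau> x + n t)))
     = (CLINT x|M. iexp (\<Sum>k\<in>?K. c' k * X (\<tau>' k) x) * iexp (\<Sum>r\<in>L. c r * n r))"
    by (simp only: lin'[of "\<lambda>t. X t x" for x] iexp_add)
  also have "\<dots> = (CLINT x|M. iexp (\<Sum>k\<in>?K. c' k * X (\<tau>' k) x)) * iexp (\<Sum>r\<in>L. c r * n r)"
    by (rule integral_mult_left_zero)
  also have "\<dots> = iexp (\<Sum>t\<in>L. c t * m' t) * complex_of_real (exp (- (\<Sum>s\<in>L. \<Sum>t\<in>L. c s * c t * C' s t) / 2))"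
    unfolding gauss_process_family[OF X K] var mean iexp_add by (simp only: mult_ac)
  finally show "(CLINT x|M. iexp (\<Sum>t\<in>L. c t * (a * X (\<sigma> t) x + b t * X \<tau> x + n t)))
    = iexp (\<Sum>t\<in>L. c t * m' t) * complex_of_real (exp (- (\<Sum>s\<in>L. \<Sum>t\<in>L. c s * c t * C' s t) / 2))" .
qed

section \<open>Brownian motion as a Gaussian process, and the Wiener measure\<close>

lemma normal_density_char:
  assumes X: "distributed M lborel X (\<lambda>x. ennreal (normal_density 0 \<sigma> x))" and "0 < \<sigma>" "prob_space M"
  shows "(CLINT x|M. iexp (c * X x)) = complex_of_real (exp (- (c\<^sup>2 * \<sigma>\<^sup>2) / 2))"
proof -
  interpret prob_space M by fact
  have [measurable]: "X \<in> borel_measurable M" using distributed_measurable[OF X] by simp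
  have "distributed M lborel (\<lambda>x. (X x - 0) / \<sigma>) (\<lambda>x. ennreal (std_normal_density x))"
    using X normal_standard_normal_convert[OF \<open>0 < \<sigma>\<close>, of X 0] by simp
  then have "distr M lborel (\<lambda>x. X x / \<sigma>) = std_normal_distribution"
    by (simp add: distributed_def)
  then have eq: "distr M borel (\<lambda>x. X x / \<sigma>) = std_normal_distribution"
    by (metis distr_cong sets_lborel)
  have "(CLINT x|M. iexp (c * X x)) = (CLINT x|M. iexp ((c * \<sigma>) * (X x / \<sigma>)))"
    using \<open>0 < \<sigma>\<close> by simp
  also have "\<dots> = char (distr M borel (\<lambda>x. X x / \<sigma>)) (c * \<sigma>)"
    unfolding char_def by (subst integral_distr) auto
  also have "\<dots> = complex_of_real (exp (- (c\<^sup>2 * \<sigma>\<^sup>2) / 2))"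
    unfolding eq char_std_normal_distribution by (simp add: power_mult_distrib)
  finally show ?thesis .
qed

lemma brownian_motion_increments_char:
  assumes B: "brownian_motion M B" and \<tau>: "mono \<tau>" "0 \<le> \<tau> 0"
  shows "(CLINT x|M. iexp (\<Sum>i<n. c i * (B (\<tau> (Suc i)) x - B (\<tau> i) x))) =
    complex_of_real (exp (- (\<Sum>i<n. (c i)\<^sup>2 * (\<tau> (Suc i) - \<tau> i)) / 2))"
proof -
  interpret prob_space M using B by (simp add: brownian_motion_def)
  have \<tau>0: "0 \<le> \<tau> i" for i using \<tau> by (meson le0 monoD order_trans)
  have [measurable]: "B (\<tau> i) \<in> borel_measurable M" for i
    using B \<tau>0[of i] by (auto simp: brownian_motion_def continuous_process_def)
  let ?D = "\<lambda>i x. c i * (B (\<tau> (Suc i)) x - B (\<tau> i) x)"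
  have "indep_vars (\<lambda>_. borel) (\<lambda>i x. B (\<tau> (Suc i)) x - B (\<tau> i) x) {..<n}"
    using B \<tau> by (auto simp: brownian_motion_def)
  then have ind: "indep_vars (\<lambda>_. borel) ?D {..<n}"
    by (rule indep_vars_compose2[where Y="\<lambda>i x. c i * x"]) simp
  have one: "(CLINT x|M. iexp (?D i x)) = complex_of_real (exp (- ((c i)\<^sup>2 * (\<tau> (Suc i) - \<tau> i)) / 2))" for i
  \<comment> \<open>The definition of Brownian motion gives a density only to increments over
    intervals of positive length.\<close>
  proof (cases "\<tau> (Suc i) = \<tau> i")
    case True
    then show ?thesis by (simp add: prob_space)
  next
    case False
    then have "\<tau> i < \<tau> (Suc i)" using monoD[OF \<tau>(1), of i "Suc i"] by simp
    then show ?thesis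
      using B \<tau>0[of i] normal_density_char[of M "\<lambda>x. B (\<tau> (Suc i)) x - B (\<tau> i) x" "sqrt (\<tau> (Suc i) - \<tau> i)" "c i"]
      by (auto simp: brownian_motion_def)
  qed
  have "(CLINT x|M. iexp (\<Sum>i<n. ?D i x)) = char (distr M borel (\<lambda>x. \<Sum>i<n. ?D i x)) 1"
    unfolding char_def by (subst integral_distr) auto
  also have "\<dots> = (\<Prod>i<n. char (distr M borel (?D i)) 1)"
    using ind by (rule char_distr_sum)
  also have "\<dots> = (\<Prod>i<n. CLINT x|M. iexp (?D i x))"
    unfolding char_def by (subst integral_distr) auto
  also have "\<dots> = complex_of_real (exp (- (\<Sum>i<n. (c i)\<^sup>2 * (\<tau> (Suc i) - \<tau> i)) / 2))"
    unfolding one by (simp flip: of_real_prod exp_sum add: sum_negf sum_divide_distrib)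
  finally show ?thesis .
qed

text \<open>Summation by parts turns a combination of values into a combination of independent
  increments over the sorted times. The same identity, applied to \<open>min s\<close> in place of
  the path, yields the covariance.\<close>

lemma brownian_motion_gauss_process:
  assumes B: "brownian_motion M B"
  shows "gauss_process M {0..} B (\<lambda>_. 0) min"
  unfolding gauss_process_def
proof (intro conjI allI impI)
  interpret prob_space M using B by (simp add: brownian_motion_def)
  show "prob_space M" by unfold_locales
  show "continuous_process M {0..} B" using B by (simp add: brownian_motion_def)
  have B0: "AE x in M. B 0 x = 0" using B by (simp add: brownian_motion_def)
  fix L :: "real set" and c :: "real \<Rightarrow> real" assume L: "finite L" "L \<subseteq> {0..}"
  have [measurable]: "t \<in> L \<Longrightarrow> B t \<in> borel_measurable M" for t
    using B L by (auto simp: brownian_motion_def continuous_process_def subset_iff)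
  have [measurable]: "B 0 \<in> borel_measurable M"
    using B by (auto simp: brownian_motion_def continuous_process_def)
  define n where "n = card L"
  define e where "e = (!) (sorted_list_of_set L)"
  \<comment> \<open>\<tau> is 0, then runs through L in increasing order, then stays constant, so
    that it is monotone on all natural numbers.\<close>
  define \<tau> where "\<tau> i = (if i = 0 then 0 else if i \<le> n then e (i - 1) else Max (insert 0 L))" for i
  have bij: "bij_betw e {..<n} L"
    using L(1) bij_betw_nth[of "sorted_list_of_set L" "{..<n}" L] by (simp add: e_def n_def)
  have eL: "e i \<in> L" if "i < n" for i using bij that by (auto simp: bij_betw_def)
  have emono: "e i \<le> e j" if "i \<le> j" "j < n" for i j
    using that unfolding e_def n_def by (intro sorted_nth_mono) auto
  have \<tau>0: "\<tau> 0 = 0" by (simp add: \<tau>_def)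
  have \<tau>S: "\<tau> (Suc i) = e i" if "i < n" for i using that by (auto simp: \<tau>_def)
  have mono: "mono \<tau>"
  proof (rule monoI)
    fix i j :: nat assume "i \<le> j"
    have "e (i - 1) \<le> Max (insert 0 L)" if "0 < i" "i \<le> n"
      using eL[of "i - 1"] that L(1) by (intro Max_ge) auto
    moreover have "0 \<le> Max (insert 0 L)" using L(1) by (intro Max_ge) auto
    moreover have "0 \<le> e (j - 1)" if "0 < j" "j \<le> n" using eL[of "j - 1"] that L(2) by (auto simp: subset_iff)
    moreover have "e (i - 1) \<le> e (j - 1)" if "j \<le> n" "0 < i" using \<open>i \<le> j\<close> that by (intro emono) auto
    ultimately show "\<tau> i \<le> \<tau> j" using \<open>i \<le> j\<close> by (auto simp: \<tau>_def)
  qed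
  \<comment> \<open>The increment ending at the point \<open>e i\<close> enters the value at this
    and at every later point, so it receives the sum of their coefficients.\<close>
  define a where "a i = (\<Sum>j<n. if i \<le> j then c (e j) else 0)" for i
  have abel: "(\<Sum>t\<in>L. c t * f t) = (\<Sum>i<n. a i * (f (\<tau> (Suc i)) - f (\<tau> i)))" if "f 0 = 0" for f :: "real \<Rightarrow> real"
  proof -
    have "(\<Sum>i<n. a i * (f (\<tau> (Suc i)) - f (\<tau> i)))
      = (\<Sum>i<n. \<Sum>j<n. if i \<le> j then c (e j) * (f (\<tau> (Suc i)) - f (\<tau> i)) else 0)"
      unfolding a_def sum_distrib_right by (intro sum.cong) auto
    also have "\<dots> = (\<Sum>j<n. \<Sum>i<n. if i \<le> j then c (e j) * (f (\<tau> (Suc i)) - f (\<tau> i)) else 0)"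
      by (rule sum.swap)
    also have "\<dots> = (\<Sum>j<n. c (e j) * (\<Sum>i<Suc j. f (\<tau> (Suc i)) - f (\<tau> i)))"
      unfolding sum_distrib_left
      by (intro sum.cong refl sum.mono_neutral_cong_right) auto
    also have "\<dots> = (\<Sum>j<n. c (e j) * f (e j))"
    proof (intro sum.cong refl)
      fix j assume "j \<in> {..<n}"
      then show "c (e j) * (\<Sum>i<Suc j. f (\<tau> (Suc i)) - f (\<tau> i)) = c (e j) * f (e j)"
        unfolding sum_lessThan_telescope[of "\<lambda>i. f (\<tau> i)"] using that by (simp add: \<tau>S \<tau>0)
    qed
    also have "\<dots> = (\<Sum>t\<in>L. c t * f t)"
      by (rule sum.reindex_bij_betw[OF bij])
    finally show ?thesis ..
  qed
  have var: "(\<Sum>i<n. (a i)\<^sup>2 * (\<tau> (Suc i) - \<tau> i)) = (\<Sum>s\<in>L. \<Sum>t\<in>L. c s * c t * min s t)"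
  proof -
    \<comment> \<open>\<open>abel\<close> for the function \<open>min (e j)\<close>: its increments
      beyond \<open>e j\<close> vanish, and the earlier ones are those of \<tau>.\<close>
    have inner: "(\<Sum>t\<in>L. c t * min (e j) t) = (\<Sum>i<Suc j. a i * (\<tau> (Suc i) - \<tau> i))" if "j < n" for j
    proof -
      have "(\<Sum>t\<in>L. c t * min (e j) t) = (\<Sum>i<n. a i * (min (e j) (\<tau> (Suc i)) - min (e j) (\<tau> i)))"
        using eL[OF that] L(2) by (intro abel) auto
      also have "\<dots> = (\<Sum>i<Suc j. a i * (\<tau> (Suc i) - \<tau> i))"
      proof (rule sum.mono_neutral_cong_right)
        show "\<forall>i\<in>{..<n} - {..<Suc j}. a i * (min (e j) (\<tau> (Suc i)) - min (e j) (\<tau> i)) = 0"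
        proof
          fix i assume i: "i \<in> {..<n} - {..<Suc j}"
          then have "e j \<le> \<tau> i" "e j \<le> \<tau> (Suc i)"
            using monoD[OF mono, of "Suc j" i] monoD[OF mono, of "Suc j" "Suc i"] that by (auto simp: \<tau>S)
          then show "a i * (min (e j) (\<tau> (Suc i)) - min (e j) (\<tau> i)) = 0" by simp
        qed
        fix i assume "i \<in> {..<Suc j}"
        then have "\<tau> i \<le> e j" "\<tau> (Suc i) \<le> e j"
          using monoD[OF mono, of i "Suc j"] monoD[OF mono, of "Suc i" "Suc j"] that by (auto simp: \<tau>S)
        then show "a i * (min (e j) (\<tau> (Suc i)) - min (e j) (\<tau> i)) = a i * (\<tau> (Suc i) - \<tau> i)" by simp
      qed (use that in auto)
      finally show ?thesis .
    qed
    have "(\<Sum>s\<in>L. \<Sum>t\<in>L. c s * c t * min s t) = (\<Sum>s\<in>L. c s * (\<Sum>t\<in>L. c t * min s t))"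
      by (simp add: sum_distrib_left mult.assoc)
    also have "\<dots> = (\<Sum>j<n. c (e j) * (\<Sum>t\<in>L. c t * min (e j) t))"
      by (rule sum.reindex_bij_betw[OF bij, symmetric])
    also have "\<dots> = (\<Sum>j<n. \<Sum>i<n. if i \<le> j then c (e j) * (a i * (\<tau> (Suc i) - \<tau> i)) else 0)"
    proof (intro sum.cong refl)
      fix j assume "j \<in> {..<n}"
      then have j: "j < n" by simp
      show "c (e j) * (\<Sum>t\<in>L. c t * min (e j) t) =
          (\<Sum>i<n. if i \<le> j then c (e j) * (a i * (\<tau> (Suc i) - \<tau> i)) else 0)"
        unfolding inner[OF j] sum_distrib_left using j by (intro sum.mono_neutral_cong_left) auto
    qed
    also have "\<dots> = (\<Sum>i<n. \<Sum>j<n. if i \<le> j then c (e j) * (a i * (\<tau> (Suc i) - \<tau> i)) else 0)"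
      by (rule sum.swap)
    also have "\<dots> = (\<Sum>i<n. a i * (a i * (\<tau> (Suc i) - \<tau> i)))"
      by (subst (3) a_def, unfold sum_distrib_right sum_distrib_left) (intro sum.cong, auto)
    finally show ?thesis by (simp add: power2_eq_square mult.assoc)
  qed
  have "(CLINT x|M. iexp (\<Sum>t\<in>L. c t * B t x))
     = (CLINT x|M. iexp (\<Sum>i<n. a i * (B (\<tau> (Suc i)) x - B (\<tau> i) x)))"
  proof (rule integral_cong_AE)
    have "(\<Sum>t\<in>L. c t * B t x) = (\<Sum>i<n. a i * (B (\<tau> (Suc i)) x - B (\<tau> i) x))" if "B 0 x = 0" for x
      using abel[of "\<lambda>t. B t x"] that by simp
    note lin = this
    from B0 show "AE x in M. iexp (\<Sum>t\<in>L. c t * B t x) = iexp (\<Sum>i<n. a i * (B (\<tau> (Suc i)) x - B (\<tau> i) x))"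
    proof eventually_elim
      case (elim x)
      show ?case unfolding lin[OF elim] ..
    qed
    have [measurable]: "B (\<tau> i) \<in> borel_measurable M" for i
      using B monoD[OF mono, of 0 i] \<tau>0 by (auto simp: brownian_motion_def continuous_process_def)
    show "(\<lambda>x. iexp (\<Sum>i<n. a i * (B (\<tau> (Suc i)) x - B (\<tau> i) x))) \<in> borel_measurable M" by measurable
  qed measurable
  also have "\<dots> = complex_of_real (exp (- (\<Sum>i<n. (a i)\<^sup>2 * (\<tau> (Suc i) - \<tau> i)) / 2))"
    by (rule brownian_motion_increments_char[OF B mono]) (simp add: \<tau>0)
  also have "\<dots> = iexp (\<Sum>t\<in>L. c t * 0) * complex_of_real (exp (- (\<Sum>s\<in>L. \<Sum>t\<in>L. c s * c t * min s t) / 2))"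
    unfolding var by simp
  finally show "(CLINT x|M. iexp (\<Sum>t\<in>L. c t * B t x)) = \<dots>" .
qed

text \<open>Independence says that the joint law is the product of the marginal laws, and these laws
  are the same under M and under its image.\<close>

lemma indep_vars_distr:
  assumes "prob_space M" and f[measurable]: "f \<in> M \<rightarrow>\<^sub>M N" and X[measurable]: "\<And>i. i \<in> I \<Longrightarrow> X i \<in> N \<rightarrow>\<^sub>M M' i"
    and ind: "prob_space.indep_vars M M' (\<lambda>i x. X i (f x)) I"
  shows "prob_space.indep_vars (distr M N f) M' X I"
proof -
  interpret M: prob_space M by fact
  interpret D: prob_space "distr M N f" by (rule M.prob_space_distr) simp
  show ?thesis
  proof (cases "I = {}")
    case True
    then show ?thesis by (simp add: D.indep_vars_def D.indep_sets_def)
  next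
    case False
    have "distr (distr M N f) (PiM I M') (\<lambda>x. \<lambda>i\<in>I. X i x) = distr M (PiM I M') (\<lambda>x. \<lambda>i\<in>I. X i (f x))"
      by (subst distr_distr) (auto simp: comp_def)
    also have "\<dots> = PiM I (\<lambda>i. distr M (M' i) (\<lambda>x. X i (f x)))"
      using ind False by (subst (asm) M.indep_vars_iff_distr_eq_PiM') auto
    also have "\<dots> = PiM I (\<lambda>i. distr (distr M N f) (M' i) (X i))"
      by (intro PiM_cong refl, subst distr_distr) (auto simp: comp_def)
    finally show ?thesis
      using False by (subst D.indep_vars_iff_distr_eq_PiM') auto
  qed
qed

lemma path_law_brownian_motion:
  assumes B: "brownian_motion M B"
  shows "brownian_motion (path_law M {0..} B) (\<lambda>t w. w t)"
proof -
  interpret prob_space M using B by (simp add: brownian_motion_def)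
  have [measurable]: "sample_path {0..} B \<in> M \<rightarrow>\<^sub>M path_space {0..}"
    using B by (intro measurable_sample_path) (simp add: brownian_motion_def)
  have sp: "sample_path {0..} B x t = B t x" if "0 \<le> t" for t x using that by (simp add: sample_path_def)
  let ?P = "distr M (path_space {0..}) (sample_path {0..} B)"
  have [measurable]: "t \<ge> 0 \<Longrightarrow> B t \<in> borel_measurable M" for t
    using B by (auto simp: brownian_motion_def continuous_process_def)
  have "prob_space.indep_vars ?P (\<lambda>_. borel) (\<lambda>i w. w (\<tau> (Suc i)) - w (\<tau> i)) {..<n}"
    if \<tau>: "mono \<tau>" "0 \<le> \<tau> 0" for \<tau> :: "nat \<Rightarrow> real" and n
  proof (rule indep_vars_distr)
    have \<tau>0: "0 \<le> \<tau> i" for i using \<tau> by (meson le0 monoD order_trans)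
    then show "\<And>i. (\<lambda>w. w (\<tau> (Suc i)) - w (\<tau> i)) \<in> borel_measurable (path_space {0..})"
      by (intro borel_measurable_diff measurable_path_space_eval) auto
    show "indep_vars (\<lambda>_. borel) (\<lambda>i x. sample_path {0..} B x (\<tau> (Suc i)) - sample_path {0..} B x (\<tau> i)) {..<n}"
      using B \<tau> \<tau>0 by (simp add: sp brownian_motion_def)
  qed (simp_all add: prob_space_axioms)
  moreover have "distributed ?P lborel (\<lambda>w. w t - w s) (\<lambda>x. ennreal (normal_density 0 (sqrt (t - s)) x))"
    if "0 \<le> s" "s < t" for s t
  proof -
    have "distributed M lborel (\<lambda>\<omega>. B t \<omega> - B s \<omega>) (\<lambda>x. ennreal (normal_density 0 (sqrt (t - s)) x))"
      using that B by (simp add: brownian_motion_def)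
    then show ?thesis
      using that by (auto simp: distributed_def distr_distr comp_def sp)
  qed
  moreover have "AE w in ?P. w 0 = 0"
  proof (subst AE_distr_iff)
    have [measurable]: "(\<lambda>w. w 0) \<in> borel_measurable (path_space {0..})"
      by (intro measurable_path_space_eval) auto
    show "{w \<in> space (path_space {0..}). w 0 = 0} \<in> sets (path_space {0..})" by measurable
  qed (use B in \<open>auto simp: sp brownian_motion_def\<close>)
  ultimately show ?thesis
    using B prob_space_axioms
    by (auto simp: brownian_motion_def path_law_def continuous_process_def sp space_path_space
        prob_space_distr)
qed

text \<open>The description \<open>wiener\<close> denotes: the path law of B is a candidate, and any
  candidate Q is the path law of its own coordinate process, which is Gaussian with the same
  covariance \<open>min\<close>.\<close>

lemma brownian_motion_wiener:
  assumes B: "brownian_motion M B"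
  shows "brownian_motion wiener (\<lambda>t w. w t)" and "sets wiener = sets (path_space {0..})"
proof -
  let ?P = "path_law M {0..} B"
  have ident: "path_law Q {0..} (\<lambda>t w. w t) = Q" if "sets Q = sets (path_space {0..})" for Q
  proof -
    have "distr Q (path_space {0..}) (sample_path {0..} (\<lambda>t w. w t)) = distr Q Q (\<lambda>w. w)"
      using sets_eq_imp_space_eq[OF that] that
      by (intro distr_cong) (auto simp: sample_path_def space_path_space extensional_restrict)
    then show ?thesis by (simp add: path_law_def distr_id)
  qed
  have W: "wiener = ?P"
    unfolding wiener_def
  proof (rule the_equality)
    show "sets ?P = sets (path_space {0..}) \<and> brownian_motion ?P (\<lambda>t w. w t)"
      using path_law_brownian_motion[OF B] by (simp add: path_law_def)
    fix Q assume Q: "sets Q = sets (path_space {0..}) \<and> brownian_motion Q (\<lambda>t w. w t)"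
    then have "path_law Q {0..} (\<lambda>t w. w t) = ?P"
      by (intro gauss_process_path_law_eq[OF brownian_motion_gauss_process brownian_motion_gauss_process[OF B]]) auto
    then show "Q = ?P" using Q ident by simp
  qed
  show "brownian_motion wiener (\<lambda>t w. w t)"
    unfolding W by (rule path_law_brownian_motion[OF B])
  show "sets wiener = sets (path_space {0..})"
    unfolding W path_law_def by simp
qed

section \<open>Brownian bridges\<close>

lemma borel_measurable_time_below:
  fixes f :: "'b \<Rightarrow> real \<Rightarrow> real"
  assumes [measurable]: "(\<lambda>(x, s). f x s) \<in> borel_measurable (N \<Otimes>\<^sub>M borel)" "h \<in> borel_measurable N"
  shows "(\<lambda>x. time_below (h x) (f x)) \<in> borel_measurable N"
  unfolding time_below_def set_lebesgue_integral_def
  by (rule lborel.borel_measurable_lebesgue_integral) (measurable; simp)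

lemma time_below_cong:
  "(\<And>s. 0 \<le> s \<Longrightarrow> s \<le> t \<Longrightarrow> f s = g s) \<Longrightarrow> time_below t f = time_below t g"
  unfolding time_below_def set_lebesgue_integral_def
  by (intro Bochner_Integration.integral_cong) (auto simp: indicator_def)

lemma measurable_time_below_path_space [measurable]:
  "time_below T \<in> borel_measurable (path_space {0..T})"
proof (cases "0 \<le> T")
  case True
  \<comment> \<open>Clamping the time to the interval extends the path to the whole line and does
    not change \<open>time_below T\<close>.\<close>
  have "(\<lambda>(s, w). w (max 0 (min T s))) \<in> borel_measurable (borel \<Otimes>\<^sub>M path_space {0..T})"
    using True by (intro measurable_path_space_eval_pair continuous_intros) auto
  from measurable_compose[OF measurable_pair_swap' this]
  have "(\<lambda>(w, s). w (max 0 (min T s))) \<in> borel_measurable (path_space {0..T} \<Otimes>\<^sub>M borel)"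
    by (simp add: case_prod_beta)
  then have "(\<lambda>w. time_below T (\<lambda>s. w (max 0 (min T s)))) \<in> borel_measurable (path_space {0..T})"
    by (intro borel_measurable_time_below) auto
  also have "(\<lambda>w. time_below T (\<lambda>s. w (max 0 (min T s)))) = time_below T"
    by (intro ext time_below_cong) (auto simp: max_def min_def)
  finally show ?thesis .
next
  case False
  then have "time_below T = (\<lambda>_. 0)"
    by (simp add: time_below_def set_lebesgue_integral_def fun_eq_iff)
  then show ?thesis by simp
qed

text \<open>The truncation \<open>max 0\<close> makes the path jointly measurable in all arguments.\<close>

definition bridge_path :: "real \<Rightarrow> real \<Rightarrow> (real \<Rightarrow> real) \<Rightarrow> real \<Rightarrow> real" where
  "bridge_path t y w s = w (max 0 s) - s / t * w (max 0 t) + y + s / t * (0 - y)"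

text \<open>The facts about \<open>wiener\<close> that hold as soon as some Brownian motion exists.
  All bridges are then built on this one probability space.\<close>

locale wiener_measure =
  assumes brownian: "brownian_motion wiener (\<lambda>t w. w t)"
    and sets_wiener [measurable_cong]: "sets wiener = sets (path_space {0..})"
begin

sublocale prob_space wiener
  using brownian by (simp add: brownian_motion_def)

lemma measurable_wiener_eval_pair:
  "(\<lambda>(s, w). w (max 0 s)) \<in> borel_measurable (borel \<Otimes>\<^sub>M wiener)"
proof -
  have "(\<lambda>(s, w). w (max 0 s)) \<in> borel_measurable (borel \<Otimes>\<^sub>M path_space {0..})"
    by (intro measurable_path_space_eval_pair continuous_intros) auto
  then show ?thesis
    by (subst measurable_cong_sets[OF sets_pair_measure_cong[OF refl sets_wiener] refl])
qed

lemma measurable_wiener_eval: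
  assumes "f \<in> borel_measurable N" "g \<in> N \<rightarrow>\<^sub>M wiener"
  shows "(\<lambda>x. g x (max 0 (f x))) \<in> borel_measurable N"
  using measurable_compose[OF measurable_Pair[OF assms] measurable_wiener_eval_pair] by simp

lemma measurable_bridge_path [measurable (raw)]:
  assumes [measurable]: "t \<in> borel_measurable N" "y \<in> borel_measurable N" "s \<in> borel_measurable N" "g \<in> N \<rightarrow>\<^sub>M wiener"
  shows "(\<lambda>x. bridge_path (t x) (y x) (g x) (s x)) \<in> borel_measurable N"
proof -
  note [measurable] = measurable_wiener_eval[OF assms(1,4)] measurable_wiener_eval[OF assms(3,4)]
  show ?thesis unfolding bridge_path_def by measurable
qed

lemma bridge_law_eq:
  assumes "0 \<le> t"
  shows "bridge_law t y 0 = path_law wiener {0..t} (\<lambda>s w. bridge_path t y w s)"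
proof -
  have "sample_path {0..t} (\<lambda>s w. w s - s / t * w t + y + s / t * (0 - y))
    = sample_path {0..t} (\<lambda>s w. bridge_path t y w s)"
    using assms by (auto simp: sample_path_def bridge_path_def fun_eq_iff restrict_def max_def)
  then show ?thesis by (simp add: bridge_law_def path_law_def)
qed

lemma gauss_wiener: "gauss_process wiener {0..} (\<lambda>t w. w (max 0 t)) (\<lambda>_. 0) min"
proof -
  have g: "gauss_process wiener {0..} (\<lambda>t w. w t) (\<lambda>_. 0) min"
    by (rule brownian_motion_gauss_process[OF brownian])
  have "gauss_process wiener {0..} (\<lambda>r w. 1 * w (max 0 r) + 0 * w 0 + 0) (\<lambda>_. 0) min"
    by (rule gauss_process_linear[OF g]) (auto intro!: continuous_intros)
  then show ?thesis by simp
qed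

lemma gauss_bridge_path:
  assumes t: "0 < t"
  shows "gauss_process wiener {0..t} (\<lambda>s w. bridge_path t y w s) (\<lambda>s. y - s / t * y) (\<lambda>r s. min r s - r * s / t)"
proof -
  have "gauss_process wiener {0..t} (\<lambda>r w. 1 * w (max 0 r) + (- r / t) * w (max 0 t) + (y + r / t * (0 - y)))
     (\<lambda>s. y - s / t * y) (\<lambda>r s. min r s - r * s / t)"
    using t by (intro gauss_process_linear[OF gauss_wiener, where \<sigma>="\<lambda>r. r"])
      (auto intro!: continuous_intros simp: min_def divide_simps)
  then show ?thesis by (simp add: bridge_path_def algebra_simps)
qed

lemma continuous_bridge_path:
  assumes "0 < t" "w \<in> space wiener"
  shows "continuous_on {0..t} (bridge_path t y w)"
proof -
  have "continuous_process wiener {0..t} (\<lambda>s w. bridge_path t y w s)"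
    using gauss_bridge_path[OF assms(1), of y] unfolding gauss_process_def by blast
  then show ?thesis using assms(2) by (simp add: continuous_process_def)
qed

text \<open>Brownian scaling: x times the covariance of the unit bridge at \<open>r / x\<close> and
  \<open>s / x\<close> is the covariance of the bridge of length x. It connects the process b with
  the bridges in \<open>bridge_q\<close>.\<close>

lemma stretch_bridge_law:
  assumes x: "0 < x"
  shows "path_law wiener {0..x} (\<lambda>s w. stretch y x (bridge_path 1 0 w) s) = bridge_law x y 0"
proof -
  have g: "gauss_process wiener {0..x} (\<lambda>r w. sqrt x * bridge_path 1 0 w (r / x) + 0 * bridge_path 1 0 w 0 + (y - r / x * y))
     (\<lambda>s. y - s / x * y) (\<lambda>r s. min r s - r * s / x)"
    using x by (intro gauss_process_linear[OF gauss_bridge_path[of 1 0], where \<sigma>="\<lambda>r. r / x"])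
      (auto intro!: continuous_intros simp: min_def divide_simps power2_eq_square)
  then have "gauss_process wiener {0..x} (\<lambda>s w. stretch y x (bridge_path 1 0 w) s)
     (\<lambda>s. y - s / x * y) (\<lambda>r s. min r s - r * s / x)"
    by (simp add: stretch_def algebra_simps)
  from gauss_process_path_law_eq[OF this gauss_bridge_path[OF x, of y]]
  show ?thesis using x by (simp add: bridge_law_eq)
qed

text \<open>The Markov property at time s: N is the law of the bridge at time s, and from there an
  independent bridge of length T runs on. The covariance of the shifted path splits into that of the
  bridge of length T and the variance s T / t of its starting point times (1 - r / T) (1 - r' /
  T).\<close>

lemma bridge_shift_law:
  fixes y s T :: real
  assumes s: "0 < s" and T: "0 < T"
  defines "t \<equiv> s + T"
  defines "N \<equiv> density lborel (\<lambda>x. ennreal (normal_density (y * T / t) (sqrt (s * T / t)) x))"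
  shows "path_law wiener {0..T} (\<lambda>r w. bridge_path t y w (s + r)) =
    path_law (N \<Otimes>\<^sub>M wiener) {0..T} (\<lambda>r (x, w). bridge_path T x w r)"
proof (rule gauss_process_path_law_eq)
  have t: "0 < t" using s T by (simp add: t_def)
  have "gauss_process wiener {0..T} (\<lambda>r w. 1 * bridge_path t y w (s + r) + 0 * bridge_path t y w 0 + 0)
    (\<lambda>r. y - (s + r) / t * y) (\<lambda>r r'. min (s + r) (s + r') - (s + r) * (s + r') / t)"
    using s T by (intro gauss_process_linear[OF gauss_bridge_path[OF t], where \<sigma>="\<lambda>r. s + r"])
      (auto intro!: continuous_intros simp: t_def)
  then show "gauss_process wiener {0..T} (\<lambda>r w. bridge_path t y w (s + r))
    (\<lambda>r. y - (s + r) / t * y) (\<lambda>r r'. min (s + r) (s + r') - (s + r) * (s + r') / t)" by simp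
  define \<mu> where "\<mu> = y * T / t"
  define \<sigma> where "\<sigma> = sqrt (s * T / t)"
  have \<sigma>: "0 < \<sigma>" "\<sigma>\<^sup>2 = s * T / t" using s T t by (simp_all add: \<sigma>_def)
  interpret N: prob_space N
    unfolding N_def \<mu>_def[symmetric] \<sigma>_def[symmetric] using \<sigma> by (intro prob_space_normal_density)
  interpret NW: pair_prob_space N wiener ..
  have sN [measurable_cong]: "sets N = sets borel" by (simp add: N_def)
  have "distributed N lborel (\<lambda>x. x) (\<lambda>x. ennreal (normal_density \<mu> \<sigma> x))"
    by (auto simp: distributed_def N_def \<mu>_def \<sigma>_def distr_id2)
  from N.normal_density_affine[OF this, of 1 "- \<mu>"] \<sigma>
  have "distributed N lborel (\<lambda>x. x - \<mu>) (\<lambda>x. ennreal (normal_density 0 \<sigma> x))" by simp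
  from normal_density_char[OF this \<sigma>(1)] N.prob_space_axioms
  have ch: "(CLINT x|N. iexp (c * (x - \<mu>))) = complex_of_real (exp (- (c\<^sup>2 * \<sigma>\<^sup>2) / 2))" for c by simp
  let ?X = "\<lambda>r (x, w). bridge_path T x w r"
  show "gauss_process (N \<Otimes>\<^sub>M wiener) {0..T} ?X (\<lambda>r. \<mu> - r / T * \<mu>)
    (\<lambda>r r'. min r r' - r * r' / T + \<sigma>\<^sup>2 * (1 - r / T) * (1 - r' / T))"
    unfolding gauss_process_def
  proof (intro conjI allI impI)
    show "prob_space (N \<Otimes>\<^sub>M wiener)" by unfold_locales
    show "continuous_process (N \<Otimes>\<^sub>M wiener) {0..T} ?X"
      unfolding continuous_process_def
    proof (intro conjI ballI)
      fix r show "?X r \<in> borel_measurable (N \<Otimes>\<^sub>M wiener)"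
        unfolding case_prod_beta by measurable
    next
      fix z assume "z \<in> space (N \<Otimes>\<^sub>M wiener)"
      then have "snd z \<in> space wiener" by (auto simp: space_pair_measure)
    from continuous_bridge_path[OF T this, of "fst z"]
    show "continuous_on {0..T} (\<lambda>r. ?X r z)" by (simp add: case_prod_beta)
    qed
    fix L :: "real set" and c :: "real \<Rightarrow> real" assume L: "finite L" "L \<subseteq> {0..T}"
    \<comment> \<open>\<theta> is the coefficient with which a shift of the starting point enters
      the linear combination. By \<open>dec\<close> the starting point splits off as a separate
      Gaussian factor.\<close>
    define \<theta> where "\<theta> = (\<Sum>r\<in>L. c r * (1 - r / T))"
    have dec: "(\<Sum>r\<in>L. c r * bridge_path T x w r) = (\<Sum>r\<in>L. c r * bridge_path T \<mu> w r) + \<theta> * (x - \<mu>)" for x w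
      unfolding \<theta>_def sum_distrib_right sum.distrib[symmetric] using T
      by (intro sum.cong) (auto simp: bridge_path_def field_simps)
    have "(CLINT z|N \<Otimes>\<^sub>M wiener. iexp (\<Sum>r\<in>L. c r * ?X r z))
      = (CLINT z|N \<Otimes>\<^sub>M wiener. (case z of (x, w) \<Rightarrow> iexp (\<Sum>r\<in>L. c r * bridge_path T x w r)))"
      by (simp add: case_prod_beta)
    also have "\<dots> = (CLINT x|N. CLINT w|wiener. iexp (\<Sum>r\<in>L. c r * bridge_path T x w r))"
    proof (rule NW.integral_fst[symmetric])
      show "complex_integrable (N \<Otimes>\<^sub>M wiener) (\<lambda>(x, w). iexp (\<Sum>r\<in>L. c r * bridge_path T x w r))"
      proof (rule NW.P.integrable_const_bound[where B=1])
        show "(\<lambda>(x, w). iexp (\<Sum>r\<in>L. c r * bridge_path T x w r)) \<in> borel_measurable (N \<Otimes>\<^sub>M wiener)"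
          unfolding case_prod_beta' by measurable
        show "AE z in N \<Otimes>\<^sub>M wiener. norm ((\<lambda>(x, w). iexp (\<Sum>r\<in>L. c r * bridge_path T x w r)) z) \<le> 1"
          by (intro AE_I2) (simp only: case_prod_beta' norm_exp_i_times order_refl)
      qed
    qed
    also have "\<dots> = (CLINT x|N. (CLINT w|wiener. iexp (\<Sum>r\<in>L. c r * bridge_path T \<mu> w r)) * iexp (\<theta> * (x - \<mu>)))"
      by (subst dec, unfold iexp_add, simp only: integral_mult_left_zero)
    also have "\<dots> = (CLINT w|wiener. iexp (\<Sum>r\<in>L. c r * bridge_path T \<mu> w r)) * complex_of_real (exp (- (\<theta>\<^sup>2 * \<sigma>\<^sup>2) / 2))"
      unfolding ch[symmetric] by (rule integral_mult_right_zero)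
    also have "\<dots> = iexp (\<Sum>r\<in>L. c r * (\<mu> - r / T * \<mu>)) *
       complex_of_real (exp (- (\<Sum>r\<in>L. \<Sum>r'\<in>L. c r * c r' * (min r r' - r * r' / T)) / 2) * exp (- (\<theta>\<^sup>2 * \<sigma>\<^sup>2) / 2))"
      unfolding gauss_process_char[OF gauss_bridge_path[OF T, of \<mu>] L] of_real_mult mult.assoc ..
    also have "exp (- (\<Sum>r\<in>L. \<Sum>r'\<in>L. c r * c r' * (min r r' - r * r' / T)) / 2) * exp (- (\<theta>\<^sup>2 * \<sigma>\<^sup>2) / 2)
      = exp (- (\<Sum>r\<in>L. \<Sum>r'\<in>L. c r * c r' * (min r r' - r * r' / T + \<sigma>\<^sup>2 * (1 - r / T) * (1 - r' / T))) / 2)"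
    proof -
      have "\<theta>\<^sup>2 * \<sigma>\<^sup>2 = (\<Sum>r\<in>L. \<Sum>r'\<in>L. c r * c r' * (\<sigma>\<^sup>2 * (1 - r / T) * (1 - r' / T)))"
        unfolding \<theta>_def power2_eq_square sum_distrib_right sum_distrib_left
        by (intro sum.cong refl) (simp only: mult_ac)
      then have "(\<Sum>r\<in>L. \<Sum>r'\<in>L. c r * c r' * (min r r' - r * r' / T + \<sigma>\<^sup>2 * (1 - r / T) * (1 - r' / T)))
        = (\<Sum>r\<in>L. \<Sum>r'\<in>L. c r * c r' * (min r r' - r * r' / T)) + \<theta>\<^sup>2 * \<sigma>\<^sup>2"
        by (simp only: distrib_left sum.distrib)
      then show ?thesis by (simp add: add_divide_distrib flip: exp_add)
    qed
    finally show "(CLINT z|N \<Otimes>\<^sub>M wiener. iexp (\<Sum>r\<in>L. c r * ?X r z)) = iexp (\<Sum>r\<in>L. c r * (\<mu> - r / T * \<mu>)) *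
       complex_of_real (exp (- (\<Sum>r\<in>L. \<Sum>r'\<in>L. c r * c r' * (min r r' - r * r' / T + \<sigma>\<^sup>2 * (1 - r / T) * (1 - r' / T))) / 2))" .
  qed
  show "y - (s + r) / t * y = \<mu> - r / T * \<mu>" for r
    using s T unfolding \<mu>_def t_def by (simp add: divide_simps) (simp add: algebra_simps)
  show "min (s + r) (s + r') - (s + r) * (s + r') / t = min r r' - r * r' / T + \<sigma>\<^sup>2 * (1 - r / T) * (1 - r' / T)" for r r'
    unfolding \<sigma>(2) t_def using s T by (simp add: min_def divide_simps) (simp add: algebra_simps)
qed

lemma bridge_shift_nn_integral:
  assumes s: "0 < s" and T: "0 < T" and F [measurable]: "F \<in> borel_measurable (path_space {0..T})"
  shows "(\<integral>\<^sup>+w. F (\<lambda>r\<in>{0..T}. bridge_path (s + T) y w (s + r)) \<partial>wiener) =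
    (\<integral>\<^sup>+x. ennreal (normal_density (y * T / (s + T)) (sqrt (s * T / (s + T))) x) *
      (\<integral>\<^sup>+w. F (\<lambda>r\<in>{0..T}. bridge_path T x w r) \<partial>wiener) \<partial>lborel)"
proof -
  let ?n = "\<lambda>x. ennreal (normal_density (y * T / (s + T)) (sqrt (s * T / (s + T))) x)"
  define N where "N = density lborel ?n"
  have t: "0 < s + T" using s T by simp
  interpret N: prob_space N
    unfolding N_def using s T t by (intro prob_space_normal_density) simp
  interpret NW: pair_prob_space N wiener ..
  have sN [measurable_cong]: "sets N = sets borel" by (simp add: N_def)
  have m1: "sample_path {0..T} (\<lambda>r w. bridge_path (s + T) y w (s + r)) \<in> wiener \<rightarrow>\<^sub>M path_space {0..T}"
  proof (intro measurable_sample_path, unfold continuous_process_def, intro conjI ballI)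
    fix r show "(\<lambda>w. bridge_path (s + T) y w (s + r)) \<in> borel_measurable wiener" by measurable
  next
    fix w assume "w \<in> space wiener"
    from continuous_bridge_path[OF t this]
    show "continuous_on {0..T} (\<lambda>r. bridge_path (s + T) y w (s + r))"
      by (rule continuous_on_compose2) (use s in \<open>auto intro!: continuous_intros\<close>)
  qed
  have m2: "sample_path {0..T} (\<lambda>r (x, w). bridge_path T x w r) \<in> N \<Otimes>\<^sub>M wiener \<rightarrow>\<^sub>M path_space {0..T}"
  proof (intro measurable_sample_path, unfold continuous_process_def, intro conjI ballI)
    fix r show "(\<lambda>(x, w). bridge_path T x w r) \<in> borel_measurable (N \<Otimes>\<^sub>M wiener)"
      unfolding case_prod_beta by measurable
  next
    fix z assume "z \<in> space (N \<Otimes>\<^sub>M wiener)"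
    then have "snd z \<in> space wiener" by (auto simp: space_pair_measure)
    from continuous_bridge_path[OF T this, of "fst z"]
    show "continuous_on {0..T} (\<lambda>r. (\<lambda>(x, w). bridge_path T x w r) z)" by (simp add: case_prod_beta)
  qed
  have m2': "(\<lambda>(x, w). F (\<lambda>r\<in>{0..T}. bridge_path T x w r)) \<in> borel_measurable (N \<Otimes>\<^sub>M wiener)"
    using measurable_compose[OF m2 F] by (simp add: sample_path_def case_prod_beta)
  have "(\<integral>\<^sup>+w. F (\<lambda>r\<in>{0..T}. bridge_path (s + T) y w (s + r)) \<partial>wiener)
    = (\<integral>\<^sup>+v. F v \<partial>path_law wiener {0..T} (\<lambda>r w. bridge_path (s + T) y w (s + r)))"
    unfolding path_law_def by (subst nn_integral_distr[OF m1]) (auto simp: sample_path_def)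
  also have "\<dots> = (\<integral>\<^sup>+v. F v \<partial>path_law (N \<Otimes>\<^sub>M wiener) {0..T} (\<lambda>r (x, w). bridge_path T x w r))"
    unfolding bridge_shift_law[OF s T] N_def ..
  also have "\<dots> = (\<integral>\<^sup>+z. (case z of (x, w) \<Rightarrow> F (\<lambda>r\<in>{0..T}. bridge_path T x w r)) \<partial>(N \<Otimes>\<^sub>M wiener))"
    unfolding path_law_def by (subst nn_integral_distr[OF m2]) (auto simp: sample_path_def case_prod_beta')
  also have "\<dots> = (\<integral>\<^sup>+x. (\<integral>\<^sup>+w. F (\<lambda>r\<in>{0..T}. bridge_path T x w r) \<partial>wiener) \<partial>N)"
    by (rule nn_integral_fst[OF m2', symmetric, unfolded prod.case])
  also have "\<dots> = (\<integral>\<^sup>+x. ?n x * (\<integral>\<^sup>+w. F (\<lambda>r\<in>{0..T}. bridge_path T x w r) \<partial>wiener) \<partial>lborel)"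
  proof -
    have "(\<lambda>x. \<integral>\<^sup>+w. F (\<lambda>r\<in>{0..T}. bridge_path T x w r) \<partial>wiener) \<in> borel_measurable N"
      using borel_measurable_nn_integral_fst[OF m2'] by (simp only: prod.case)
    then have "(\<lambda>x. \<integral>\<^sup>+w. F (\<lambda>r\<in>{0..T}. bridge_path T x w r) \<partial>wiener) \<in> borel_measurable lborel"
      by (subst (asm) measurable_cong_sets[OF sN refl]) simp
    then show ?thesis
      unfolding N_def by (intro nn_integral_density) auto
  qed
  finally show ?thesis .
qed

end

section \<open>Laplace transforms and the Green function\<close>

text \<open>Formally this integrates the derivative of exp (\<alpha> A(s)), but A has no derivative
  where the indicator jumps. The indicator is replaced by continuous functions, for which the
  fundamental theorem applies; dominated convergence removes the approximation.\<close>

lemma exp_occupation: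
  fixes f :: "real \<Rightarrow> real"
  assumes t: "0 \<le> t" and \<alpha>: "0 \<le> \<alpha>" and f: "continuous_on {0..t} f" and [measurable]: "f \<in> borel_measurable borel"
  defines "A \<equiv> \<lambda>s. LBINT r:{s..t}. of_bool (f r \<ge> 0) :: real"
  shows "exp (\<alpha> * A 0) - 1 = (LBINT s:{0..t}. \<alpha> * of_bool (f s \<ge> 0) * exp (\<alpha> * A s))"
proof -
  \<comment> \<open>Equal to 1 where f is non-negative and, for positive n, equal to 0 where f \<le>
    -1/n.\<close>
  define h where "h n s = max 0 (min 1 (1 + real n * f s))" for n s
  define An where "An n s = (LBINT r:{s..t}. h n r)" for n s
  have [measurable]: "h n \<in> borel_measurable borel" for n unfolding h_def by measurable
  have h01: "0 \<le> h n s" "h n s \<le> 1" for n s by (auto simp: h_def)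
  have hlim: "(\<lambda>n. h n s) \<longlonglongrightarrow> of_bool (f s \<ge> 0)" for s
  proof (cases "f s \<ge> 0")
    case True
    then have "h n s = 1" for n by (simp add: h_def min_def max_def)
    with True show ?thesis by simp
  next
    case False
    obtain N :: nat where N: "1 / (- f s) < real N" using reals_Archimedean2 by blast
    have "h n s = 0" if "N \<le> n" for n
    proof -
      have "1 / (- f s) < real n" using N that by linarith
      then have "1 + real n * f s < 0" using False by (simp add: field_simps)
      then show ?thesis by (simp add: h_def min_def max_def)
    qed
    then have "\<forall>\<^sub>F n in sequentially. h n s = 0" by (auto simp: eventually_sequentially)
    then show ?thesis using False by (simp add: tendsto_eventually)
  qed
  have hcont: "continuous_on {0..t} (h n)" for n
    unfolding h_def by (intro continuous_intros f)
  have Icc: "integrable lborel (indicator {s..t} :: real \<Rightarrow> real)" for s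
    by (rule integrable_real_indicator) (auto simp: emeasure_lborel_Icc_eq)
  have Alim: "(\<lambda>n. An n s) \<longlonglongrightarrow> A s" for s
    unfolding An_def A_def set_lebesgue_integral_def
  proof (rule integral_dominated_convergence[where w="indicator {s..t}"])
    show "AE x in lborel. (\<lambda>n. indicator {s..t} x *\<^sub>R h n x) \<longlonglongrightarrow> indicator {s..t} x *\<^sub>R of_bool (f x \<ge> 0)"
      by (intro AE_I2 tendsto_intros hlim)
    show "integrable lborel (indicator {s..t} :: real \<Rightarrow> real)" by (rule Icc)
  qed (auto simp: h01 indicator_def)
  have hint: "set_integrable lborel {s..t} (h n)" for n s
    unfolding set_integrable_def
  proof (rule Bochner_Integration.integrable_bound[OF Icc])
    show "AE x in lborel. norm (indicat_real {s..t} x *\<^sub>R h n x) \<le> norm (indicat_real {s..t} x)"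
      by (auto simp: h01 indicator_def)
  qed measurable
  have An_bound: "0 \<le> An n s" "An n s \<le> t" if "0 \<le> s" for n s
  proof -
    show "0 \<le> An n s" unfolding An_def set_lebesgue_integral_def
      by (intro integral_nonneg_AE) (auto simp: h01)
    have "An n s \<le> (LBINT r:{s..t}. 1)" unfolding An_def
      by (intro set_integral_mono hint) (simp_all add: h01 set_integrable_def Icc del: integrable_indicator_iff)
    also have "\<dots> \<le> t" using that t by (simp add: set_lebesgue_integral_def)
    finally show "An n s \<le> t" .
  qed
  have An_diff: "An n s = integral {0..t} (h n) - integral {0..s} (h n)" if "s \<in> {0..t}" for n s
  proof -
    have "An n s = integral {s..t} (h n)"
      unfolding An_def by (rule set_borel_integral_eq_integral(2)[OF hint])
    also have "\<dots> = integral {0..t} (h n) - integral {0..s} (h n)"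
      using Henstock_Kurzweil_Integration.integral_combine[of 0 s t "h n"] that
        integrable_continuous_interval[OF hcont] by auto
    finally show ?thesis .
  qed
  have FTC: "exp (\<alpha> * An n 0) - 1 = (LBINT s:{0..t}. \<alpha> * h n s * exp (\<alpha> * An n s))" for n
  proof -
    \<comment> \<open>This is exp (\<alpha> \<open>An n s\<close>) written with integrals from 0, so
      that s becomes an upper limit of integration and can be differentiated.\<close>
    define G where "G s = exp (\<alpha> * (integral {0..t} (h n) - integral {0..s} (h n)))" for s
    have "((\<lambda>s. - (\<alpha> * h n s * G s)) has_integral (G t - G 0)) {0..t}"
    proof (rule fundamental_theorem_of_calculus[OF t])
      fix s assume s: "s \<in> {0..t}"
      have "((\<lambda>u. integral {0..u} (h n)) has_real_derivative h n s) (at s within {0..t})"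
        using integral_has_vector_derivative[OF hcont s] by (simp add: has_real_derivative_iff_has_vector_derivative)
      then have "(G has_real_derivative - (\<alpha> * h n s * G s)) (at s within {0..t})"
        unfolding G_def by (auto intro!: derivative_eq_intros)
      then show "(G has_vector_derivative - (\<alpha> * h n s * G s)) (at s within {0..t})"
        by (simp add: has_real_derivative_iff_has_vector_derivative)
    qed
    from has_integral_neg[OF this]
    have hi: "((\<lambda>s. \<alpha> * h n s * G s) has_integral (G 0 - G t)) {0..t}" by simp
    have "continuous_on {0..t} (\<lambda>s. \<alpha> * h n s * G s)"
      unfolding G_def
      by (intro continuous_intros hcont indefinite_integral_continuous_1 integrable_continuous_interval)
    then have "set_integrable lborel {0..t} (\<lambda>s. \<alpha> * h n s * G s)"
      by (rule borel_integrable_atLeastAtMost')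
    then have "(LBINT s:{0..t}. \<alpha> * h n s * G s) = G 0 - G t"
      using set_borel_integral_eq_integral(2) integral_unique[OF hi] by metis
    moreover have "(LBINT s:{0..t}. \<alpha> * h n s * exp (\<alpha> * An n s)) = (LBINT s:{0..t}. \<alpha> * h n s * G s)"
      by (intro set_lebesgue_integral_cong) (auto simp: G_def An_diff)
    ultimately show ?thesis using t by (simp add: G_def An_diff)
  qed
  have "(\<lambda>n. LBINT s:{0..t}. \<alpha> * h n s * exp (\<alpha> * An n s))
     \<longlonglongrightarrow> (LBINT s:{0..t}. \<alpha> * of_bool (f s \<ge> 0) * exp (\<alpha> * A s))"
    unfolding set_lebesgue_integral_def
  proof (rule integral_dominated_convergence[where w="\<lambda>s. indicator {0..t} s * (\<alpha> * exp (\<alpha> * t))"])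
    have [measurable]: "(\<lambda>s. An n s) \<in> borel_measurable borel" for n
      unfolding An_def set_lebesgue_integral_def
      by (rule lborel.borel_measurable_lebesgue_integral) (measurable; simp)
    have [measurable]: "(\<lambda>s. A s) \<in> borel_measurable borel"
      unfolding A_def set_lebesgue_integral_def
      by (rule lborel.borel_measurable_lebesgue_integral) (measurable; simp)
    show "(\<lambda>s. indicat_real {0..t} s *\<^sub>R (\<alpha> * of_bool (0 \<le> f s) * exp (\<alpha> * A s))) \<in> borel_measurable lborel"
      "\<And>n. (\<lambda>s. indicat_real {0..t} s *\<^sub>R (\<alpha> * h n s * exp (\<alpha> * An n s))) \<in> borel_measurable lborel"
      by measurable
    show "AE s in lborel. (\<lambda>n. indicat_real {0..t} s *\<^sub>R (\<alpha> * h n s * exp (\<alpha> * An n s)))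
       \<longlonglongrightarrow> indicat_real {0..t} s *\<^sub>R (\<alpha> * of_bool (0 \<le> f s) * exp (\<alpha> * A s))"
      by (intro AE_I2 tendsto_intros hlim Alim)
    show "AE s in lborel. norm (indicat_real {0..t} s *\<^sub>R (\<alpha> * h n s * exp (\<alpha> * An n s)))
       \<le> indicat_real {0..t} s * (\<alpha> * exp (\<alpha> * t))" for n
    proof (intro AE_I2)
      fix s
      have "\<alpha> * h n s * exp (\<alpha> * An n s) \<le> \<alpha> * 1 * exp (\<alpha> * t)" if "0 \<le> s"
        using \<alpha> h01[of n s] An_bound[OF that, of n] by (intro mult_mono mult_left_mono) (auto intro!: mult_left_mono)
      then show "norm (indicat_real {0..t} s *\<^sub>R (\<alpha> * h n s * exp (\<alpha> * An n s))) \<le> indicat_real {0..t} s * (\<alpha> * exp (\<alpha> * t))"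
        using \<alpha> h01[of n s] by (auto simp: indicator_def abs_mult)
    qed
    show "integrable lborel (\<lambda>s. indicat_real {0..t} s * (\<alpha> * exp (\<alpha> * t)))"
      by (intro integrable_mult_left Icc)
  qed
  moreover have "(\<lambda>n. exp (\<alpha> * An n 0) - 1) \<longlonglongrightarrow> exp (\<alpha> * A 0) - 1"
    by (intro tendsto_intros Alim)
  ultimately show ?thesis
    unfolding FTC using LIMSEQ_unique by blast
qed

section \<open>Uniqueness from moments and from Laplace transforms\<close>

text \<open>The moments are bounded by 1, so the exponential series may be integrated term by term.
  This writes the characteristic function as a series in the moments.\<close>

lemma moments_unit_interval_unique:
  fixes N N' :: "real measure"
  assumes N: "real_distribution N" "AE z in N. \<bar>z\<bar> \<le> 1" and N': "real_distribution N'" "AE z in N'. \<bar>z\<bar> \<le> 1"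
    and eq: "\<And>k :: nat. (LINT z|N. z ^ k) = (LINT z|N'. z ^ k)"
  shows "N = N'"
proof -
  have char_eq: "char M \<theta> = (\<Sum>k. (\<i> * \<theta>) ^ k / fact k * (LINT z|M. z ^ k))"
    if "real_distribution M" and le1: "AE z in M. \<bar>z\<bar> \<le> 1" for M \<theta>
  proof -
    interpret M: real_distribution M by fact
    let ?f = "\<lambda>(k::nat) z. (\<i> * complex_of_real \<theta>) ^ k / fact k * complex_of_real (z ^ k)"
    have nle: "AE z in M. norm (?f k z) \<le> \<bar>\<theta>\<bar> ^ k / fact k" for k
      using le1
    proof eventually_elim
      case (elim z)
      then have "\<bar>z\<bar> ^ k \<le> 1" by (simp add: power_le_one)
      then show ?case
        using mult_left_le[of "\<bar>z\<bar> ^ k" "\<bar>\<theta>\<bar> ^ k"]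
        by (simp add: norm_mult norm_divide norm_power divide_right_mono)
    qed
    have int: "integrable M (?f k)" for k
      using nle by (rule M.integrable_const_bound) measurable
    have exp_sums: "(\<lambda>k. ?f k z) sums iexp (\<theta> * z)" for z
      using exp_converges[of "\<i> * complex_of_real (\<theta> * z)"]
      by (simp add: scaleR_conv_of_real power_mult_distrib field_simps)
    have bound: "(LINT z|M. norm (?f k z)) \<le> \<bar>\<theta>\<bar> ^ k / fact k" for k
    proof -
      have "(LINT z|M. norm (?f k z)) \<le> (LINT z|M. \<bar>\<theta>\<bar> ^ k / fact k)"
        using nle by (intro integral_mono_AE integrable_norm int) auto
      also have "\<dots> = \<bar>\<theta>\<bar> ^ k / fact k" using M.prob_space by (simp del: M.space_eq_univ)
      finally show ?thesis .
    qed
    have sm: "summable (\<lambda>k. LINT z|M. norm (?f k z))"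
    proof (rule summable_comparison_test'[where g="\<lambda>k. \<bar>\<theta>\<bar> ^ k / fact k" and N=0])
      show "summable (\<lambda>k. \<bar>\<theta>\<bar> ^ k / fact k)"
        using summable_exp[of "\<bar>\<theta>\<bar>"] by (simp add: divide_inverse mult.commute)
      show "norm (LINT z|M. norm (?f k z)) \<le> \<bar>\<theta>\<bar> ^ k / fact k" for k
      proof -
        have "0 \<le> (LINT z|M. norm (?f k z))" by (rule integral_nonneg_AE[OF AE_I2[OF norm_ge_zero]])
        then show ?thesis using bound[of k] by (simp only: real_norm_def abs_of_nonneg)
      qed
    qed
    have AEs: "AE z in M. summable (\<lambda>k. norm (?f k z))"
    proof (intro AE_I2)
      fix z
      have "summable (\<lambda>k. inverse (fact k) * \<bar>\<theta> * z\<bar> ^ k)" by (rule summable_exp)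
      then show "summable (\<lambda>k. norm (?f k z))"
        by (simp add: norm_mult norm_inverse norm_power abs_mult power_mult_distrib divide_inverse mult_ac)
    qed
    have "char M \<theta> = (CLINT z|M. (\<Sum>k. ?f k z))"
      unfolding char_def sums_unique[OF exp_sums, symmetric] ..
    also have "\<dots> = (\<Sum>k. CLINT z|M. ?f k z)"
      by (rule integral_suminf[OF int AEs sm])
    finally show ?thesis by (simp only: integral_mult_right_zero integral_complex_of_real)
  qed
  show ?thesis
    by (rule Levy_uniqueness[OF N(1) N'(1)])
      (simp add: fun_eq_iff char_eq[OF N] char_eq[OF N'] eq)
qed

text \<open>Weighting by exp (-a) makes the measures finite, and the substitution z = exp (-a) turns
  the values of the transform at the integers into moments on the unit interval. The measures
  themselves may be infinite, and countably many arguments of the transform suffice.\<close>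

lemma laplace_unique:
  fixes m m' :: "real measure"
  assumes sets [measurable_cong]: "sets m = sets borel" "sets m' = sets borel"
    and nonneg: "AE a in m. 0 \<le> a" "AE a in m'. 0 \<le> a"
    and eq: "\<And>k::nat. 1 \<le> k \<Longrightarrow> (\<integral>\<^sup>+a. ennreal (exp (- (real k * a))) \<partial>m) = (\<integral>\<^sup>+a. ennreal (exp (- (real k * a))) \<partial>m')"
    and fin: "(\<integral>\<^sup>+a. ennreal (exp (- a)) \<partial>m) \<noteq> \<infinity>"
  shows "m = m'"
proof -
  define c where "c = enn2real (\<integral>\<^sup>+a. ennreal (exp (- a)) \<partial>m)"
  have c: "(\<integral>\<^sup>+a. ennreal (exp (- a)) \<partial>m) = ennreal c" "(\<integral>\<^sup>+a. ennreal (exp (- a)) \<partial>m') = ennreal c"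
    using eq[of 1] fin by (simp_all add: c_def less_top)
  have c0: "0 \<le> c" by (simp add: c_def)
  show ?thesis
  proof (cases "c = 0")
    \<comment> \<open>exp (-a) is positive, so a vanishing transform forces the zero
      measure.\<close>
    case True
    have null: "emeasure M A = 0" if "sets M = sets borel" "(\<integral>\<^sup>+a. ennreal (exp (- a)) \<partial>M) = 0" "A \<in> sets M"
      for M :: "real measure" and A
    proof -
      have "(\<lambda>a. ennreal (exp (- a))) \<in> borel_measurable M"
        by (subst measurable_cong_sets[OF that(1) refl]) measurable
      then have "AE a in M. ennreal (exp (- a)) = 0"
        using that by (subst nn_integral_0_iff_AE[symmetric]) auto
      then have "AE a in M. False" by simp
      then obtain N where "space M \<subseteq> N" "emeasure M N = 0" "N \<in> sets M"
        by (auto elim!: AE_E)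
      then show ?thesis
        using emeasure_mono[of A N M] sets.sets_into_space[OF that(3)] by auto
    qed
    show ?thesis
      using True c by (intro measure_eqI) (auto simp: sets null)
  next
    case False
    with c0 have cpos: "0 < c" by simp
    \<comment> \<open>The k-th moment of the image of \<open>n M\<close> under exp (-a) is the
      transform of M at k + 1, divided by c.\<close>
    define n where "n M = density M (\<lambda>a. ennreal (exp (- a) / c))" for M :: "real measure"
    have nI: "prob_space (n M)" "AE a in n M. 0 \<le> a" "density (n M) (\<lambda>a. ennreal (c * exp a)) = M"
      "\<And>k. (LINT z|distr (n M) borel (\<lambda>a. exp (- a)). z ^ k) = enn2real (\<integral>\<^sup>+a. ennreal (exp (- (real (Suc k) * a))) \<partial>M) / c"
      if sM [measurable_cong]: "sets M = sets borel" and "(\<integral>\<^sup>+a. ennreal (exp (- a)) \<partial>M) = ennreal c" and "AE a in M. 0 \<le> a"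
      for M :: "real measure"
    proof -
      show "prob_space (n M)"
      proof (rule prob_spaceI)
        have "emeasure (n M) (space (n M)) = (\<integral>\<^sup>+a. ennreal (exp (- a)) / ennreal c \<partial>M)"
          using cpos unfolding n_def by (subst emeasure_density) (auto simp: divide_ennreal intro!: nn_integral_cong)
        also have "\<dots> = 1"
          using that cpos by (subst nn_integral_divide) (auto simp: divide_ennreal)
        finally show "emeasure (n M) (space (n M)) = 1" .
      qed
      show "AE a in n M. 0 \<le> a"
        unfolding n_def using that by (subst AE_density) (auto elim: eventually_mono)
      have "density (n M) (\<lambda>a. ennreal (c * exp a)) = density M (\<lambda>_. 1)"
        unfolding n_def using cpos
        by (subst density_density_eq) (auto intro!: density_cong simp: exp_minus simp flip: ennreal_mult)
      then show "density (n M) (\<lambda>a. ennreal (c * exp a)) = M" by (simp add: density_1)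
      fix k
      have "exp (- a) * exp (- a) ^ k = exp (- (real (Suc k) * a))" for a
        using exp_of_nat_mult[of "Suc k" "- a"] by simp
      then have "(LINT z|distr (n M) borel (\<lambda>a. exp (- a)). z ^ k) = (LINT a|M. exp (- (real (Suc k) * a)) / c)"
        unfolding n_def using cpos by (simp add: integral_distr integral_density)
      also have "\<dots> = enn2real (\<integral>\<^sup>+a. ennreal (exp (- (real (Suc k) * a))) \<partial>M) / c"
        by (simp add: integral_eq_nn_integral)
      finally show "(LINT z|distr (n M) borel (\<lambda>a. exp (- a)). z ^ k)
        = enn2real (\<integral>\<^sup>+a. ennreal (exp (- (real (Suc k) * a))) \<partial>M) / c" .
    qed
    note n1 = nI[OF sets(1) c(1) nonneg(1)] and n2 = nI[OF sets(2) c(2) nonneg(2)]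
    have sn [measurable_cong]: "sets (n m) = sets borel" "sets (n m') = sets borel" by (simp_all add: n_def sets)
    have "distr (n m) borel (\<lambda>a. exp (- a)) = distr (n m') borel (\<lambda>a. exp (- a))"
    proof (rule moments_unit_interval_unique)
      show "real_distribution (distr (n m) borel (\<lambda>a. exp (- a)))" "real_distribution (distr (n m') borel (\<lambda>a. exp (- a)))"
        using n1(1) n2(1) by (auto intro!: real_distribution.intro prob_space.prob_space_distr simp: real_distribution_axioms_def)
      show "AE z in distr (n m) borel (\<lambda>a. exp (- a)). \<bar>z\<bar> \<le> 1" "AE z in distr (n m') borel (\<lambda>a. exp (- a)). \<bar>z\<bar> \<le> 1"
        using n1(2) n2(2) by (auto simp: AE_distr_iff)
      show "(LINT z|distr (n m) borel (\<lambda>a. exp (- a)). z ^ k) = (LINT z|distr (n m') borel (\<lambda>a. exp (- a)). z ^ k)" for k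
        unfolding n1(4) n2(4) using eq[of "Suc k"] by simp
    qed
    \<comment> \<open>The substitution is undone by a = - ln z; afterwards the density c exp a
      restores the original measures.\<close>
    then have "distr (distr (n m) borel (\<lambda>a. exp (- a))) borel (\<lambda>z. - ln z) = distr (distr (n m') borel (\<lambda>a. exp (- a))) borel (\<lambda>z. - ln z)"
      by simp
    then have "n m = n m'"
      by (simp add: distr_distr comp_def distr_id2 sn)
    then show ?thesis using n1(3) n2(3) by metis
  qed
qed

section \<open>The Green function of Brownian motion killed at a constant rate\<close>

lemma std_normal_cdf_DERIV:
  "(cdf std_normal_distribution has_real_derivative std_normal_density z) (at z)"
proof -
  interpret N: real_distribution std_normal_distribution by (rule real_dist_normal_dist)
  \<comment> \<open>A base point to the left of z, so that the integral from c describes the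
    distribution function in a neighbourhood of z.\<close>
  define c where "c = z - 1"
  have cont: "continuous_on S std_normal_density" for S
    unfolding normal_density_def by (intro continuous_intros) auto
  have int: "integrable lborel std_normal_density" by simp
  have cdf: "cdf std_normal_distribution u = cdf std_normal_distribution c + integral {c..u} std_normal_density"
    if "c \<le> u" for u
  proof (cases "c = u")
    case False
    with that have "c < u" by simp
    have "cdf std_normal_distribution u - cdf std_normal_distribution c = measure std_normal_distribution {c<..u}"
      by (rule N.cdf_diff_eq[OF \<open>c < u\<close>])
    also have "\<dots> = measure std_normal_distribution {c..u}"
    proof (rule measure_eq_AE)
      show "AE x in std_normal_distribution. x \<in> {c<..u} \<longleftrightarrow> x \<in> {c..u}"
        using AE_lborel_singleton[of c] by (subst AE_density) (auto elim!: eventually_mono)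
    qed auto
    also have "\<dots> = (LINT x|std_normal_distribution. indicator {c..u} x)" by simp
    also have "\<dots> = (LBINT x:{c..u}. std_normal_density x)"
      unfolding set_lebesgue_integral_def by (subst integral_density) (auto simp: mult.commute)
    also have "\<dots> = integral {c..u} std_normal_density"
      using cont by (intro set_borel_integral_eq_integral(2) borel_integrable_atLeastAtMost')
    finally show ?thesis by simp
  qed simp
  have "((\<lambda>u. integral {c..u} std_normal_density) has_vector_derivative std_normal_density z) (at z within {c..z + 1})"
    by (rule integral_has_vector_derivative[OF cont]) (simp add: c_def)
  then have "((\<lambda>u. integral {c..u} std_normal_density) has_vector_derivative std_normal_density z) (at z)"
    by (subst (asm) at_within_interior) (auto simp: c_def)
  then have "((\<lambda>u. integral {c..u} std_normal_density) has_real_derivative std_normal_density z) (at z)"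
    by (simp add: has_real_derivative_iff_has_vector_derivative)
  then have "((\<lambda>u. cdf std_normal_distribution c + integral {c..u} std_normal_density) has_real_derivative std_normal_density z) (at z)"
    by (auto intro!: derivative_eq_intros)
  then show ?thesis
  proof (rule has_field_derivative_transform_within_open[where S="{c<..}"])
    show "cdf std_normal_distribution c + integral {c..u} std_normal_density = cdf std_normal_distribution u"
      if "u \<in> {c<..}" for u using that cdf[of u] by simp
  qed (auto simp: c_def)
qed

text \<open>The Green function of \<open>1/2 \<Delta> - a\<^sup>2/2\<close> on the line. The integrand has the
  antiderivative \<open>(e\<^sup>a\<^sup>x \<Phi>(a \<surd>t + x/\<surd>t) + e\<^sup>-\<^sup>a\<^sup>x \<Phi>(a \<surd>t - x/\<surd>t)) / a\<close>.\<close>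

lemma green_nn_integral:
  assumes a: "0 < a"
  shows "(\<integral>\<^sup>+t. ennreal (exp (- (a\<^sup>2 / 2 * t)) * normal_density 0 (sqrt t) x) * indicator {0<..} t \<partial>lborel)
    = ennreal (exp (- (a * \<bar>x\<bar>)) / a)"
proof -
  interpret N: real_distribution std_normal_distribution by (rule real_dist_normal_dist)
  let ?\<Phi> = "cdf std_normal_distribution"
  define y where "y = \<bar>x\<bar>"
  have y: "0 \<le> y" by (simp add: y_def)
  define f where "f t = exp (- (a\<^sup>2 / 2 * t)) * normal_density 0 (sqrt t) y" for t
  define F where "F t = (exp (a * y) * ?\<Phi> (a * sqrt t + y / sqrt t) + exp (- (a * y)) * ?\<Phi> (a * sqrt t - y / sqrt t)) / a" for t
  have top: "(?\<Phi> \<longlongrightarrow> 1) at_top" by (rule N.cdf_lim_at_top_prob)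
  have bot: "(?\<Phi> \<longlongrightarrow> 0) at_bot" by (rule N.cdf_lim_at_bot)
  have F': "(F has_real_derivative f t) (at t)" if t: "0 < t" for t
  proof -
    let ?p = "a * sqrt t + y / sqrt t" and ?m = "a * sqrt t - y / sqrt t"
    have sq: "sqrt t * sqrt t = t" "(sqrt t)\<^sup>2 = t" using t by simp_all
    have p2: "?p\<^sup>2 = a\<^sup>2 * t + y\<^sup>2 / t + 2 * a * y"
      using t by (simp add: power2_sum power_mult_distrib power_divide)
    have m2: "?m\<^sup>2 = a\<^sup>2 * t + y\<^sup>2 / t - 2 * a * y"
      using t by (simp add: power2_diff power_mult_distrib power_divide)
    \<comment> \<open>The factors exp (a y) and exp (-a y) cancel the mixed terms of the two
      squares. Both densities reduce to the same Gaussian factor, and the contributions of d to the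
      derivative cancel.\<close>
    have dp: "exp (a * y) * std_normal_density ?p = exp (- (a\<^sup>2 * t + y\<^sup>2 / t) / 2) / sqrt (2 * pi)"
      unfolding normal_density_def by (simp add: p2 exp_add[symmetric] add_divide_distrib diff_divide_distrib)
    have dm: "exp (- (a * y)) * std_normal_density ?m = exp (- (a\<^sup>2 * t + y\<^sup>2 / t) / 2) / sqrt (2 * pi)"
      unfolding normal_density_def by (simp add: m2 exp_add[symmetric] add_divide_distrib diff_divide_distrib)
    define d where "d = y * (inverse (sqrt t) / 2) / (sqrt t * sqrt t)"
    have D: "((\<lambda>t. a * sqrt t + y / sqrt t) has_real_derivative a * (inverse (sqrt t) / 2) - d) (at t)"
      "((\<lambda>t. a * sqrt t - y / sqrt t) has_real_derivative a * (inverse (sqrt t) / 2) + d) (at t)"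
      using t unfolding d_def by (auto intro!: derivative_eq_intros simp: field_simps)
    have "(F has_real_derivative (exp (a * y) * (std_normal_density ?p * (a * (inverse (sqrt t) / 2) - d))
        + exp (- (a * y)) * (std_normal_density ?m * (a * (inverse (sqrt t) / 2) + d))) / a) (at t)"
      unfolding F_def
      by (intro DERIV_cdivide DERIV_add DERIV_cmult DERIV_chain2[OF std_normal_cdf_DERIV] D)
    also have "(exp (a * y) * (std_normal_density ?p * (a * (inverse (sqrt t) / 2) - d))
        + exp (- (a * y)) * (std_normal_density ?m * (a * (inverse (sqrt t) / 2) + d))) / a
      = exp (- (a\<^sup>2 * t + y\<^sup>2 / t) / 2) / sqrt (2 * pi) * (inverse (sqrt t))"
      unfolding mult.assoc[symmetric] dp dm using a by (simp add: algebra_simps add_divide_distrib[symmetric])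
    also have "\<dots> = f t"
      unfolding f_def normal_density_def using t
      by (simp add: exp_add[symmetric] real_sqrt_mult field_simps)
    finally show ?thesis .
  qed
  have lim0: "(F \<longlongrightarrow> (if y = 0 then 2 * ?\<Phi> 0 else exp (a * y)) / a) (at_right 0)"
  \<comment> \<open>For y = 0 the arguments of the distribution function tend to 0 instead of
    diverging, so the starting value of F is different.\<close>
  proof (cases "y = 0")
    case True
    have "((\<lambda>t. a * sqrt t) \<longlongrightarrow> a * sqrt 0) (at_right 0)" by (intro tendsto_intros)
    then have "((\<lambda>t. ?\<Phi> (a * sqrt t)) \<longlongrightarrow> ?\<Phi> 0) (at_right 0)"
      using isCont_tendsto_compose[OF DERIV_isCont[OF std_normal_cdf_DERIV]] by simp
    then have "((\<lambda>t. (?\<Phi> (a * sqrt t) + ?\<Phi> (a * sqrt t)) / a) \<longlongrightarrow> (?\<Phi> 0 + ?\<Phi> 0) / a) (at_right 0)"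
      using a by (intro tendsto_intros) auto
    then show ?thesis using True by (simp add: F_def[abs_def])
  next
    case False
    with y have y: "0 < y" by simp
    have 1: "filterlim (\<lambda>t. a * sqrt t + y / sqrt t) at_top (at_right 0)"
      and 2: "filterlim (\<lambda>t. a * sqrt t - y / sqrt t) at_bot (at_right 0)"
      using a y by real_asymp+
    have "(F \<longlongrightarrow> (exp (a * y) * 1 + exp (- (a * y)) * 0) / a) (at_right 0)"
      unfolding F_def using a
      by (intro tendsto_intros filterlim_compose[OF top 1] filterlim_compose[OF bot 2]) auto
    then show ?thesis using False by simp
  qed
  have lim1: "(F \<longlongrightarrow> (exp (a * y) + exp (- (a * y))) / a) at_top"
  proof -
    have 1: "filterlim (\<lambda>t. a * sqrt t + y / sqrt t) at_top at_top"
      and 2: "filterlim (\<lambda>t. a * sqrt t - y / sqrt t) at_top at_top"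
      using a by real_asymp+
    have "(F \<longlongrightarrow> (exp (a * y) * 1 + exp (- (a * y)) * 1) / a) at_top"
      unfolding F_def using a
      by (intro tendsto_intros filterlim_compose[OF top 1] filterlim_compose[OF top 2]) auto
    then show ?thesis by simp
  qed
  \<comment> \<open>Symmetry of the normal law; it gives the starting value 1 / a of F in the case y
    = 0.\<close>
  have sym: "?\<Phi> 0 = 1 / 2"
  proof -
    have "distributed std_normal_distribution lborel (\<lambda>x. x) (\<lambda>x. ennreal (normal_density 0 1 x))"
      by (auto simp: distributed_def distr_id2)
    from N.normal_density_affine[OF this, of "- 1" 0]
    have d: "distr std_normal_distribution lborel uminus = std_normal_distribution"
      by (simp add: distributed_def)
    have "measure std_normal_distribution {..0} = measure (distr std_normal_distribution lborel uminus) {..0}"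
      by (simp only: d)
    also have "\<dots> = measure std_normal_distribution {0..}"
      by (subst measure_distr) (auto intro!: arg_cong2[where f=measure])
    also have "\<dots> = measure std_normal_distribution {0<..}"
    proof (rule measure_eq_AE)
      show "AE x in std_normal_distribution. x \<in> {0..} \<longleftrightarrow> x \<in> {0<..}"
        using AE_lborel_singleton[of "0::real"] by (subst AE_density) (auto elim!: eventually_mono)
    qed auto
    also have "{0<..} = - {..0::real}" by auto
    also have "measure std_normal_distribution (- {..0}) = 1 - measure std_normal_distribution {..0}"
      using N.prob_compl[of "{..0}"] by (simp add: Compl_eq_Diff_UNIV)
    finally show ?thesis by (simp add: cdf_def)
  qed
  have f0: "0 \<le> f t" for t by (simp add: f_def)
  have contf: "isCont f t" if "0 < t" for t
    unfolding f_def normal_density_def using that by (intro continuous_intros) auto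
  have F0: "((F \<circ> real_of_ereal) \<longlongrightarrow> (if y = 0 then 2 * ?\<Phi> 0 else exp (a * y)) / a) (at_right 0)"
    using lim0 by (simp add: zero_ereal_def ereal_tendsto_simps)
  have F1: "((F \<circ> real_of_ereal) \<longlongrightarrow> (exp (a * y) + exp (- (a * y))) / a) (at_left \<infinity>)"
    using lim1 by (simp add: ereal_tendsto_simps)
  have "0 < (\<infinity> :: ereal)"
    and "\<And>t. 0 < ereal t \<Longrightarrow> ereal t < \<infinity> \<Longrightarrow> DERIV F t :> f t"
    and "\<And>t. 0 < ereal t \<Longrightarrow> ereal t < \<infinity> \<Longrightarrow> isCont f t"
    and "AE t in lborel. 0 < ereal t \<longrightarrow> ereal t < \<infinity> \<longrightarrow> 0 \<le> f t"
    using F' contf f0 by auto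
  note FTC = interval_integral_FTC_nonneg[OF this F0 F1]
  from FTC have "set_integrable lborel {0<..} f" "(LBINT t:{0<..}. f t) = exp (- (a * y)) / a"
    by (auto simp: sym interval_integral_to_infinity_eq zero_ereal_def add_divide_distrib
        interval_lebesgue_integral_def einterval_def greaterThan_def split: if_splits)
  moreover have "(\<integral>\<^sup>+t. ennreal (f t) * indicator {0<..} t \<partial>lborel) = (\<integral>\<^sup>+t. ennreal (indicator {0<..} t *\<^sub>R f t) \<partial>lborel)"
    by (intro nn_integral_cong) (auto simp: indicator_def)
  ultimately have "(\<integral>\<^sup>+t. ennreal (f t) * indicator {0<..} t \<partial>lborel) = ennreal (exp (- (a * y)) / a)"
    unfolding set_integrable_def set_lebesgue_integral_def using f0
    by (subst (asm) nn_integral_eq_integral) auto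
  moreover have "normal_density 0 s y = normal_density 0 s x" for s
    by (simp add: normal_density_def y_def)
  ultimately show ?thesis by (simp add: f_def y_def)
qed

lemma time_below_real:
  assumes [measurable]: "f \<in> borel_measurable borel" and T: "0 \<le> T"
  shows "(LBINT r:{s..s + T}. of_bool (f r \<ge> 0) :: real) = T - time_below T (\<lambda>r. f (s + r))"
    and "0 \<le> time_below T f" and "time_below T f \<le> T"
proof -
  have Icc: "integrable lborel (indicator {0..T} :: real \<Rightarrow> real)"
    by (rule integrable_real_indicator) (auto simp: emeasure_lborel_Icc_eq)
  have int: "integrable lborel (\<lambda>r. indicator {0..T} r *\<^sub>R (of_bool (P r) :: real))"
    if [measurable]: "Measurable.pred borel P" for P
  proof (rule Bochner_Integration.integrable_bound[OF Icc])
    show "AE r in lborel. norm (indicator {0..T} r *\<^sub>R (of_bool (P r) :: real)) \<le> norm (indicat_real {0..T} r)"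
      by (auto simp: indicator_def)
  qed measurable
  have eq: "(LBINT r:{0..T}. of_bool (g r \<ge> 0) :: real) = T - time_below T g"
    if [measurable]: "g \<in> borel_measurable borel" for g
  proof -
    have "(LBINT r:{0..T}. of_bool (g r \<ge> 0) :: real) + time_below T g
       = (\<integral>r. indicator {0..T} r *\<^sub>R of_bool (g r \<ge> 0) + indicator {0..T} r *\<^sub>R of_bool (g r < 0) \<partial>lborel)"
      unfolding time_below_def set_lebesgue_integral_def
      by (rule Bochner_Integration.integral_add[symmetric]) (intro int, measurable)+
    also have "\<dots> = (\<integral>r. indicator {0..T} r \<partial>lborel)"
      by (intro Bochner_Integration.integral_cong) auto
    finally show ?thesis using T by simp
  qed
  have "(LBINT r:{s..s + T}. of_bool (f r \<ge> 0) :: real) = (LBINT r:{0..T}. of_bool (f (s + r) \<ge> 0))"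
    unfolding set_lebesgue_integral_def
    by (subst lborel_integral_real_affine[of 1 _ s]) (auto intro!: Bochner_Integration.integral_cong simp: indicator_def)
  then show "(LBINT r:{s..s + T}. of_bool (f r \<ge> 0) :: real) = T - time_below T (\<lambda>r. f (s + r))"
    by (simp add: eq)
  show "0 \<le> time_below T f"
    unfolding time_below_def set_lebesgue_integral_def by (intro integral_nonneg_AE) auto
  have "0 \<le> (LBINT r:{0..T}. of_bool (f r \<ge> 0) :: real)"
    unfolding set_lebesgue_integral_def by (intro integral_nonneg_AE) auto
  then show "time_below T f \<le> T" using eq[of f] by simp
qed

lemma exp_occupation_nn_integral:
  fixes f :: "real \<Rightarrow> real"
  assumes t: "0 \<le> t" and a: "0 \<le> a" and f: "continuous_on {0..t} f" and [measurable]: "f \<in> borel_measurable borel"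
  shows "ennreal (exp (a * (t - time_below t f))) = 1 + (\<integral>\<^sup>+s. ennreal (a * of_bool (f s \<ge> 0) *
    exp (a * ((t - s) - time_below (t - s) (\<lambda>r. f (s + r))))) * indicator {0<..<t} s \<partial>lborel)"
proof -
  define A where "A s = (LBINT r:{s..t}. of_bool (f r \<ge> 0) :: real)" for s
  have A: "A s = (t - s) - time_below (t - s) (\<lambda>r. f (s + r))" if "s \<le> t" for s
    using time_below_real(1)[of f "t - s" s] that by (simp add: A_def)
  have [measurable]: "A \<in> borel_measurable borel"
    unfolding A_def set_lebesgue_integral_def
    by (rule lborel.borel_measurable_lebesgue_integral) (measurable; simp)
  have Ale: "A s \<le> t" if "0 \<le> s" "s \<le> t" for s
    using A[OF that(2)] time_below_real(2)[of "\<lambda>r. f (s + r)" "t - s"] that by simp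
  let ?g = "\<lambda>s. indicator {0..t} s *\<^sub>R (a * of_bool (f s \<ge> 0) * exp (a * A s))"
  have int: "integrable lborel ?g"
  proof (rule Bochner_Integration.integrable_bound)
    show "integrable lborel (\<lambda>s. indicator {0..t} s * (a * exp (a * t)))"
      by (intro integrable_mult_left integrable_real_indicator) (auto simp: emeasure_lborel_Icc_eq)
    show "AE s in lborel. norm (?g s) \<le> norm (indicator {0..t} s * (a * exp (a * t)))"
      using a Ale by (intro AE_I2) (auto simp: indicator_def abs_mult intro!: mult_left_mono)
  qed measurable
  have "exp (a * A 0) = 1 + (\<integral>s. ?g s \<partial>lborel)"
    using exp_occupation[OF t a f] unfolding A_def set_lebesgue_integral_def by simp
  then have "ennreal (exp (a * A 0)) = 1 + ennreal (\<integral>s. ?g s \<partial>lborel)"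
    using a by (subst ennreal_1[symmetric], subst ennreal_plus[symmetric]) (auto intro!: integral_nonneg_AE)
  also have "ennreal (\<integral>s. ?g s \<partial>lborel) = (\<integral>\<^sup>+s. ennreal (?g s) \<partial>lborel)"
    using a by (intro nn_integral_eq_integral[symmetric] int) auto
  also have "\<dots> = (\<integral>\<^sup>+s. ennreal (a * of_bool (f s \<ge> 0) *
    exp (a * ((t - s) - time_below (t - s) (\<lambda>r. f (s + r))))) * indicator {0<..<t} s \<partial>lborel)"
    \<comment> \<open>Dropping the two endpoints, a null set, keeps both s and t - s
      positive.\<close>
    using AE_lborel_singleton[of 0] AE_lborel_singleton[of t]
    by (intro nn_integral_cong_AE, eventually_elim) (auto simp: indicator_def A)
  finally show ?thesis using A[of 0] t by simp
qed

section \<open>The Duhamel equation: comparison and explicit solution\<close>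

text \<open>After n iterations of the equation U exceeds V by at most q^n B. The one-sided form
  avoids differences in \<open>ennreal\<close>; exchanging U and V gives uniqueness among bounded
  solutions.\<close>

lemma resolvent_le:
  fixes U V :: "real \<Rightarrow> ennreal"
  assumes [measurable]: "U \<in> borel_measurable borel" "V \<in> borel_measurable borel"
      "(\<lambda>(y, x). k y x) \<in> borel_measurable (borel \<Otimes>\<^sub>M borel)"
    and U: "\<And>y. 0 \<le> y \<Longrightarrow> U y = g y + (\<integral>\<^sup>+x. k y x * U x * indicator {0..} x \<partial>lborel)"
    and V: "\<And>y. 0 \<le> y \<Longrightarrow> V y = g y + (\<integral>\<^sup>+x. k y x * V x * indicator {0..} x \<partial>lborel)"
    and k: "\<And>y. (\<integral>\<^sup>+x. k y x \<partial>lborel) \<le> ennreal q" and q: "0 \<le> q" "q < 1"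
    and B: "\<And>y. 0 \<le> y \<Longrightarrow> U y \<le> ennreal B" "0 \<le> B" and y: "0 \<le> y"
  shows "U y \<le> V y"
proof -
  have step: "U y \<le> V y + ennreal (q ^ n * B)" if "0 \<le> y" for n y
    using that
  proof (induction n arbitrary: y)
    case 0
    then show ?case using B(1)[of y] by (simp add: add_increasing)
  next
    case (Suc n)
    have [measurable]: "k y \<in> borel_measurable borel"
      using measurable_compose[OF measurable_Pair1', OF _ assms(3), of y] by simp
    have "U y = g y + (\<integral>\<^sup>+x. k y x * U x * indicator {0..} x \<partial>lborel)" using U Suc by simp
    also have "\<dots> \<le> g y + (\<integral>\<^sup>+x. k y x * V x * indicator {0..} x + k y x * ennreal (q ^ n * B) \<partial>lborel)"
    proof (intro add_left_mono nn_integral_mono)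
      fix x
      show "k y x * U x * indicator {0..} x \<le> k y x * V x * indicator {0..} x + k y x * ennreal (q ^ n * B)"
        using Suc.IH[of x] mult_left_mono[of "U x" "V x + ennreal (q ^ n * B)" "k y x"]
        by (auto simp: indicator_def distrib_left)
    qed
    also have "\<dots> = V y + (\<integral>\<^sup>+x. k y x \<partial>lborel) * ennreal (q ^ n * B)"
      using V Suc by (subst nn_integral_add) (auto simp: nn_integral_multc add.assoc)
    also have "\<dots> \<le> V y + ennreal q * ennreal (q ^ n * B)"
      by (intro add_left_mono mult_right_mono k) auto
    also have "ennreal q * ennreal (q ^ n * B) = ennreal (q ^ Suc n * B)"
      using q B by (simp add: ennreal_mult[symmetric] mult.assoc)
    finally show ?case .
  qed
  show ?thesis
  proof (rule ennreal_le_epsilon)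
    fix e :: real assume "0 < e"
    have "(\<lambda>n. q ^ n * B) \<longlonglongrightarrow> 0 * B"
      using q by (intro tendsto_intros LIMSEQ_realpow_zero) auto
    then obtain n where "q ^ n * B < e"
      using order_tendstoD(2)[of _ "0 * B" sequentially e] \<open>0 < e\<close> by (auto simp: eventually_sequentially)
    then show "U y \<le> V y + ennreal e"
      using order_trans[OF step[OF y, of n] add_left_mono[OF ennreal_leI[of "q ^ n * B" e]]] by simp
  qed
qed

lemma exp_nn_integral_atLeast:
  assumes "0 < c" "0 \<le> K"
  shows "(\<integral>\<^sup>+x. ennreal (K * exp (- (c * x))) * indicator {z..} x \<partial>lborel) = ennreal (K * exp (- (c * z)) / c)"
proof -
  have "(\<integral>\<^sup>+x. ennreal (K * exp (- (c * x))) * indicator {z..} x \<partial>lborel) = ennreal (0 - (- (K * exp (- (c * z)) / c)))"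
  proof (rule nn_integral_FTC_atLeast)
    show "((\<lambda>x. - (K * exp (- (c * x)) / c)) \<longlongrightarrow> 0) at_top"
      using assms by real_asymp
    show "DERIV (\<lambda>x. - (K * exp (- (c * x)) / c)) x :> K * exp (- (c * x))" for x
      using assms by (auto intro!: derivative_eq_intros)
  qed (use assms in auto)
  then show ?thesis by simp
qed

text \<open>Splitting at y gives two exponential tails of mass 1 / a^2 each. Multiplied by \<alpha>
  = (a^2 - m^2) / 2 the bound becomes 1 - m^2 / a^2, which is the contraction constant.\<close>

lemma green_total:
  assumes a: "0 < a"
  shows "(\<integral>\<^sup>+x. ennreal (exp (- (a * \<bar>y - x\<bar>)) / a) \<partial>lborel) \<le> ennreal (2 / a\<^sup>2)"
proof -
  let ?E = "\<lambda>x. ennreal (1 / a * exp (- (a * x))) * indicator {0..} x"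
  have "(\<integral>\<^sup>+x. ennreal (exp (- (a * \<bar>y - x\<bar>)) / a) \<partial>lborel) \<le> (\<integral>\<^sup>+x. ?E (x - y) + ?E (y - x) \<partial>lborel)"
    by (intro nn_integral_mono) (auto simp: indicator_def abs_if)
  also have "\<dots> = (\<integral>\<^sup>+x. ?E (x - y) \<partial>lborel) + (\<integral>\<^sup>+x. ?E (y - x) \<partial>lborel)"
    by (rule nn_integral_add) auto
  also have "(\<integral>\<^sup>+x. ?E (x - y) \<partial>lborel) = (\<integral>\<^sup>+x. ?E x \<partial>lborel)"
    using nn_integral_real_affine[of ?E 1 "- y"] by simp
  also have "(\<integral>\<^sup>+x. ?E (y - x) \<partial>lborel) = (\<integral>\<^sup>+x. ?E x \<partial>lborel)"
    using nn_integral_real_affine[of ?E "- 1" y] by simp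
  also have "(\<integral>\<^sup>+x. ?E x \<partial>lborel) = ennreal (1 / a\<^sup>2)"
    using exp_nn_integral_atLeast[OF a, of "1 / a" 0] a by (simp add: power2_eq_square)
  finally show ?thesis by (simp flip: ennreal_plus)
qed

text \<open>\<open>C e\<^sup>-\<^sup>m\<^sup>x\<close> on the right and \<open>C e\<^sup>a\<^sup>x\<close> on the left solve \<open>u'' = m\<^sup>2 u\<close> resp. \<open>u'' = a\<^sup>2 u\<close>
  and have a derivative jump of -2 at the origin when \<open>C = 2 / (m + a)\<close>.\<close>

lemma resolvent_solution:
  assumes m: "0 < m" and am: "m < a"
  defines "\<alpha> \<equiv> (a\<^sup>2 - m\<^sup>2) / 2" and "C \<equiv> 2 / (m + a)"
  shows "ennreal (exp (- (a * \<bar>y\<bar>)) / a) +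
    (\<integral>\<^sup>+x. ennreal \<alpha> * ennreal (exp (- (a * \<bar>y - x\<bar>)) / a) * ennreal (C * exp (- (m * x))) * indicator {0..} x \<partial>lborel)
    = ennreal (C * (if 0 \<le> y then exp (- (m * y)) else exp (a * y)))"
proof -
  have pos: "0 < a" "0 < C" "0 < \<alpha>"
    using assms by (auto simp: power_strict_mono)
  have C: "C * (m + a) = 2"
  proof -
    have "m + a \<noteq> 0" using m am by linarith
    then show ?thesis unfolding C_def by (metis nonzero_mult_div_cancel_right times_divide_eq_left)
  qed
  have \<alpha>: "\<alpha> = (a - m) * (a + m) / 2" by (simp add: \<alpha>_def power2_eq_square algebra_simps)
  \<comment> \<open>Integrating the exponentials produces denominators a + m and a - m, and these
    are factors of 2 \<alpha>.\<close>
  have \<alpha>_div: "\<alpha> / (a + m) = (a - m) / 2" "\<alpha> / (a - m) = (a + m) / 2"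
  proof -
    have "\<alpha> = (a - m) / 2 * (a + m)" "\<alpha> = (a + m) / 2 * (a - m)" by (simp_all add: \<alpha>)
    moreover have "a + m \<noteq> 0" "a - m \<noteq> 0" using m am by auto
    ultimately show "\<alpha> / (a + m) = (a - m) / 2" "\<alpha> / (a - m) = (a + m) / 2"
      by (metis nonzero_mult_div_cancel_right)+
  qed
  have tail: "(\<integral>\<^sup>+x. ennreal (\<alpha> / a * C * exp (a * y) * exp (- ((a + m) * x))) * indicator {z..} x \<partial>lborel)
     = ennreal (\<alpha> / a * C * exp (a * y) * exp (- ((a + m) * z)) / (a + m))" for z
    using pos m by (intro exp_nn_integral_atLeast) auto
  let ?f = "\<lambda>x. ennreal \<alpha> * ennreal (exp (- (a * \<bar>y - x\<bar>)) / a) * ennreal (C * exp (- (m * x)))"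
  have f1: "?f x = ennreal (\<alpha> / a * C * exp (a * y) * exp (- ((a + m) * x)))" if "y \<le> x" for x
  proof -
    have "exp (- (a * \<bar>y - x\<bar>)) * exp (- (m * x)) = exp (a * y) * exp (- ((a + m) * x))"
      using that by (simp add: exp_add[symmetric] algebra_simps)
    then show ?thesis using pos by (simp add: ennreal_mult[symmetric] mult_ac)
  qed
  have f2: "?f x = ennreal (\<alpha> / a * C * exp (- (a * y)) * exp ((a - m) * x))" if "x \<le> y" for x
  proof -
    have "exp (- (a * \<bar>y - x\<bar>)) * exp (- (m * x)) = exp (- (a * y)) * exp ((a - m) * x)"
      using that by (simp add: exp_add[symmetric] algebra_simps)
    then show ?thesis using pos by (simp add: ennreal_mult[symmetric] mult_ac)
  qed
  show ?thesis
  proof (cases "0 \<le> y")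
    \<comment> \<open>All x \<ge> 0 lie to the right of y, so only the exponential tail
      occurs.\<close>
    case False
    have "(\<integral>\<^sup>+x. ?f x * indicator {0..} x \<partial>lborel) = (\<integral>\<^sup>+x. ennreal (\<alpha> / a * C * exp (a * y) * exp (- ((a + m) * x))) * indicator {0..} x \<partial>lborel)"
    proof (intro nn_integral_cong)
      fix x
      show "?f x * indicator {0..} x = ennreal (\<alpha> / a * C * exp (a * y) * exp (- ((a + m) * x))) * indicator {0..} x"
        using f1[of x] False by (cases "0 \<le> x") (simp_all only: indicator_simps mult_zero_right atLeast_iff, auto)
    qed
    also have "\<dots> = ennreal (\<alpha> / a * C * exp (a * y) / (a + m))" unfolding tail by simp
    finally have "ennreal (exp (- (a * \<bar>y\<bar>)) / a) + (\<integral>\<^sup>+x. ?f x * indicator {0..} x \<partial>lborel)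
      = ennreal (exp (a * y) / a + \<alpha> / a * C * exp (a * y) / (a + m))"
      using False pos m by (simp add: ennreal_plus[symmetric] del: ennreal_plus)
    also have "exp (a * y) / a + \<alpha> / a * C * exp (a * y) / (a + m) = C * exp (a * y)"
    proof -
      note \<alpha>_div(1)
      moreover have "1 + C * ((a - m) / 2) = C * a"
      proof -
        have "C * ((a - m) / 2) = (C * a - C * m) / 2" by (simp add: right_diff_distrib)
        moreover have "C * m + C * a = 2" using C by (simp only: distrib_left)
        moreover have "1 + u = v" if "u = (v - w) / 2" "w + v = 2" for u v w :: real using that by simp
        ultimately show ?thesis by blast
      qed
      moreover have "exp (a * y) / a + \<alpha> / a * C * exp (a * y) / (a + m) = exp (a * y) / a * (1 + C * (\<alpha> / (a + m)))"
        by (simp add: distrib_left)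
      ultimately have "exp (a * y) / a + \<alpha> / a * C * exp (a * y) / (a + m) = exp (a * y) / a * (C * a)" by (simp only:)
      also have "\<dots> = C * exp (a * y)" using pos by simp
      finally show ?thesis .
    qed
    finally show ?thesis using False by simp
  next
    \<comment> \<open>The kernel changes its form at x = y. The two pieces overlap in this point
      only, which is a null set.\<close>
    case True
    have "(\<integral>\<^sup>+x. ?f x * indicator {0..} x \<partial>lborel) =
       (\<integral>\<^sup>+x. ennreal (\<alpha> / a * C * exp (- (a * y)) * exp ((a - m) * x)) * indicator {0..y} x
         + ennreal (\<alpha> / a * C * exp (a * y) * exp (- ((a + m) * x))) * indicator {y..} x \<partial>lborel)"
    proof (intro nn_integral_cong_AE)
      let ?g = "\<lambda>x. ennreal (\<alpha> / a * C * exp (- (a * y)) * exp ((a - m) * x))"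
      let ?h = "\<lambda>x. ennreal (\<alpha> / a * C * exp (a * y) * exp (- ((a + m) * x)))"
      have f1': "?f x = ?h x" if "y \<le> x" for x by (rule f1[OF that])
      have f2': "?f x = ?g x" if "x \<le> y" for x by (rule f2[OF that])
      have split: "u * indicator {0..} x = v * indicator {0..y} x + w * indicator {y..} x"
        if "x \<noteq> y" "x \<le> y \<Longrightarrow> u = v" "y \<le> x \<Longrightarrow> u = w" for u v w :: ennreal and x
        using that True by (auto simp: indicator_def)
      show "AE x in lborel. ?f x * indicator {0..} x = ?g x * indicator {0..y} x + ?h x * indicator {y..} x"
        using AE_lborel_singleton[of y]
      proof eventually_elim
        case (elim x)
        then show ?case using f1' f2' by (intro split)
      qed
    qed
    also have "\<dots> = (\<integral>\<^sup>+x. ennreal (\<alpha> / a * C * exp (- (a * y)) * exp ((a - m) * x)) * indicator {0..y} x \<partial>lborel)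
       + (\<integral>\<^sup>+x. ennreal (\<alpha> / a * C * exp (a * y) * exp (- ((a + m) * x))) * indicator {y..} x \<partial>lborel)"
      by (rule nn_integral_add) auto
    also have "(\<integral>\<^sup>+x. ennreal (\<alpha> / a * C * exp (- (a * y)) * exp ((a - m) * x)) * indicator {0..y} x \<partial>lborel)
      = ennreal (\<alpha> / a * C * exp (- (a * y)) * exp ((a - m) * y) / (a - m) - \<alpha> / a * C * exp (- (a * y)) * exp ((a - m) * 0) / (a - m))"
    proof (rule nn_integral_FTC_Icc[OF _ _ _ True,
          where F="\<lambda>x. \<alpha> / a * C * exp (- (a * y)) * exp ((a - m) * x) / (a - m)"])
      have "a - m \<noteq> 0" using am by simp
      then show "DERIV (\<lambda>x. \<alpha> / a * C * exp (- (a * y)) * exp ((a - m) * x) / (a - m)) x :>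
         \<alpha> / a * C * exp (- (a * y)) * exp ((a - m) * x)" for x
        using pos by (auto intro!: derivative_eq_intros)
    qed (use pos in auto)
    also note tail
    also have "ennreal (\<alpha> / a * C * exp (- (a * y)) * exp ((a - m) * y) / (a - m) - \<alpha> / a * C * exp (- (a * y)) * exp ((a - m) * 0) / (a - m))
      + ennreal (\<alpha> / a * C * exp (a * y) * exp (- ((a + m) * y)) / (a + m)) =
      ennreal (\<alpha> / a * C * ((exp (- (m * y)) - exp (- (a * y))) / (a - m) + exp (- (m * y)) / (a + m)))"
    proof -
      have e: "exp (- (a * y)) * exp ((a - m) * y) = exp (- (m * y))" "exp (a * y) * exp (- ((a + m) * y)) = exp (- (m * y))"
        by (simp_all add: exp_add[symmetric] algebra_simps)
      have le: "exp (- (a * y)) \<le> exp (- (m * y))" using am True by (auto intro: mult_right_mono)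
      have "\<alpha> / a * C * exp (- (a * y)) * exp ((a - m) * y) / (a - m) - \<alpha> / a * C * exp (- (a * y)) * exp ((a - m) * 0) / (a - m)
        = \<alpha> / a * C * ((exp (- (m * y)) - exp (- (a * y))) / (a - m))"
        unfolding mult.assoc[of _ "exp (- (a * y))" "exp ((a - m) * y)"] e by (simp add: algebra_simps diff_divide_distrib)
      moreover have "\<alpha> / a * C * exp (a * y) * exp (- ((a + m) * y)) / (a + m) = \<alpha> / a * C * (exp (- (m * y)) / (a + m))"
        unfolding mult.assoc[of _ "exp (a * y)"] e by simp
      ultimately show ?thesis
        using pos m am le by (simp add: ennreal_plus[symmetric] distrib_left del: ennreal_plus)
    qed
    finally have I: "(\<integral>\<^sup>+x. ?f x * indicator {0..} x \<partial>lborel)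
      = ennreal (\<alpha> / a * C * ((exp (- (m * y)) - exp (- (a * y))) / (a - m) + exp (- (m * y)) / (a + m)))" .
    have le: "exp (- (a * y)) \<le> exp (- (m * y))" using am True by (auto intro: mult_right_mono)
    have "0 \<le> \<alpha> / a * C * ((exp (- (m * y)) - exp (- (a * y))) / (a - m) + exp (- (m * y)) / (a + m))"
      using pos m am le by (intro mult_nonneg_nonneg add_nonneg_nonneg divide_nonneg_nonneg) auto
    then have "ennreal (exp (- (a * \<bar>y\<bar>)) / a) + (\<integral>\<^sup>+x. ?f x * indicator {0..} x \<partial>lborel)
      = ennreal (exp (- (a * y)) / a + \<alpha> / a * C * ((exp (- (m * y)) - exp (- (a * y))) / (a - m) + exp (- (m * y)) / (a + m)))"
      unfolding I using True pos by (subst ennreal_plus) auto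
    also have "exp (- (a * y)) / a + \<alpha> / a * C * ((exp (- (m * y)) - exp (- (a * y))) / (a - m) + exp (- (m * y)) / (a + m))
       = C * exp (- (m * y))"
    proof -
      have "\<alpha> * ((exp (- (m * y)) - exp (- (a * y))) / (a - m) + exp (- (m * y)) / (a + m))
         = ((a + m) * (exp (- (m * y)) - exp (- (a * y))) + (a - m) * exp (- (m * y))) / 2"
      proof -
        note \<alpha>_div
        then show ?thesis
          by (metis (no_types, opaque_lifting) add_divide_distrib distrib_left times_divide_eq_left times_divide_eq_right)
      qed
      also have "\<dots> = a * exp (- (m * y)) - (a + m) / 2 * exp (- (a * y))" by (simp add: field_simps)
      finally have 1: "\<alpha> * ((exp (- (m * y)) - exp (- (a * y))) / (a - m) + exp (- (m * y)) / (a + m))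
        = a * exp (- (m * y)) - (a + m) / 2 * exp (- (a * y))" .
      have "exp (- (a * y)) / a + \<alpha> / a * C * ((exp (- (m * y)) - exp (- (a * y))) / (a - m) + exp (- (m * y)) / (a + m))
        = exp (- (a * y)) / a + C / a * (\<alpha> * ((exp (- (m * y)) - exp (- (a * y))) / (a - m) + exp (- (m * y)) / (a + m)))"
        by (simp only: times_divide_eq_left times_divide_eq_right mult_ac)
      also have "\<dots> = exp (- (a * y)) / a + C * exp (- (m * y)) - (C * (m + a)) / (2 * a) * exp (- (a * y))"
        unfolding 1 using pos by (simp add: field_simps)
      also have "\<dots> = C * exp (- (m * y))" unfolding C using pos by simp
      finally show ?thesis .
    qed
    finally show ?thesis using True by simp
  qed
qed

section \<open>The resolvent of the occupation time\<close>

text \<open>Both sides are the joint density, for a path from y, of being at x at time s and at 0 at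
  time s + T; the proof completes the square. It makes the Duhamel equation for bridges a
  convolution in time.\<close>

lemma normal_density_bridge:
  assumes s: "0 < s" and T: "0 < T"
  shows "normal_density 0 (sqrt (s + T)) y * normal_density (y * T / (s + T)) (sqrt (s * T / (s + T))) x
    = normal_density 0 (sqrt s) (y - x) * normal_density 0 (sqrt T) x"
proof -
  define t where "t = s + T"
  have t: "0 < t" using s T by (simp add: t_def)
  have v: "0 < s * T / t" using s T t by simp
  have "y\<^sup>2 / (2 * t) + (x - y * T / t)\<^sup>2 / (2 * (s * T / t)) = (y - x)\<^sup>2 / (2 * s) + x\<^sup>2 / (2 * T)"
  proof -
    have "(x - y * T / t)\<^sup>2 / (2 * (s * T / t)) = (x * t - y * T)\<^sup>2 / (2 * s * T * t)"
      using s T t by (simp add: field_simps power2_eq_square)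
    also have "\<dots> = ((y - x)\<^sup>2 * T * t + x\<^sup>2 * s * t - y\<^sup>2 * s * T) / (2 * s * T * t)"
      by (simp add: t_def power2_eq_square algebra_simps)
    also have "\<dots> = (y - x)\<^sup>2 / (2 * s) + x\<^sup>2 / (2 * T) - y\<^sup>2 / (2 * t)"
      using s T t by (simp add: diff_divide_distrib add_divide_distrib)
    finally show ?thesis by simp
  qed
  then have e: "exp (- (y\<^sup>2 / (2 * t))) * exp (- ((x - y * T / t)\<^sup>2 / (2 * (s * T / t))))
      = exp (- ((y - x)\<^sup>2 / (2 * s))) * exp (- (x\<^sup>2 / (2 * T)))"
    by (simp flip: exp_add)
  have r: "sqrt (2 * pi * t) * sqrt (2 * pi * (s * T / t)) = sqrt (2 * pi * s) * sqrt (2 * pi * T)"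
    unfolding real_sqrt_mult[symmetric] using t by (simp add: field_simps)
  have "normal_density 0 (sqrt t) y * normal_density (y * T / t) (sqrt (s * T / t)) x
    = exp (- (y\<^sup>2 / (2 * t))) * exp (- ((x - y * T / t)\<^sup>2 / (2 * (s * T / t)))) / (sqrt (2 * pi * t) * sqrt (2 * pi * (s * T / t)))"
    using t v by (simp add: normal_density_def)
  also have "\<dots> = normal_density 0 (sqrt s) (y - x) * normal_density 0 (sqrt T) x"
    unfolding e r using s T by (simp add: normal_density_def)
  finally show ?thesis by (simp add: t_def)
qed

text \<open>The transition density of Brownian motion killed at rate a^2 / 2. It is 0 for t \<le> 0,
  so that time integrals and convolutions can run over the whole line.\<close>

definition killed_heat :: "real \<Rightarrow> real \<Rightarrow> real \<Rightarrow> ennreal" where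
  "killed_heat a t x = ennreal (exp (- (a\<^sup>2 / 2 * t)) * normal_density 0 (sqrt t) x) * indicator {0<..} t"

lemma measurable_killed_heat [measurable (raw)]:
  assumes [measurable]: "t \<in> borel_measurable N" "x \<in> borel_measurable N"
  shows "(\<lambda>z. killed_heat a (t z) (x z)) \<in> borel_measurable N"
  unfolding killed_heat_def normal_density_def by measurable

lemma nn_integral_killed_heat:
  "0 < a \<Longrightarrow> (\<integral>\<^sup>+t. killed_heat a t x \<partial>lborel) = ennreal (exp (- (a * \<bar>x\<bar>)) / a)"
  unfolding killed_heat_def by (rule green_nn_integral)

lemma killed_heat_bridge:
  assumes "0 < s" "s < t"
  shows "killed_heat a t y * ennreal (normal_density (y * (t - s) / t) (sqrt (s * (t - s) / t)) x)
    = killed_heat a s (y - x) * killed_heat a (t - s) x"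
proof -
  have "- (a\<^sup>2 / 2 * t) = - (a\<^sup>2 / 2 * s) + - (a\<^sup>2 / 2 * (t - s))"
    by (simp add: right_diff_distrib)
  then have "exp (- (a\<^sup>2 / 2 * t)) = exp (- (a\<^sup>2 / 2 * s)) * exp (- (a\<^sup>2 / 2 * (t - s)))"
    by (simp only: exp_add)
  moreover have "normal_density 0 (sqrt t) y * normal_density (y * (t - s) / t) (sqrt (s * (t - s) / t)) x
    = normal_density 0 (sqrt s) (y - x) * normal_density 0 (sqrt (t - s)) x"
    using normal_density_bridge[of s "t - s" y x] assms by simp
  ultimately show ?thesis
    using assms by (simp add: killed_heat_def ennreal_mult[symmetric] mult_ac)
qed

context wiener_measure
begin

lemma measurable_time_below_bridge_shift:
  assumes [measurable]: "h \<in> borel_measurable N" "t \<in> borel_measurable N" "y \<in> borel_measurable N" "s \<in> borel_measurable N"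
    "g \<in> N \<rightarrow>\<^sub>M wiener"
  shows "(\<lambda>x. time_below (h x) (\<lambda>r. bridge_path (t x) (y x) (g x) (s x + r))) \<in> borel_measurable N"
  by (rule borel_measurable_time_below) measurable

lemma measurable_time_below_bridge [measurable (raw)]:
  assumes "t \<in> borel_measurable N" "y \<in> borel_measurable N" "g \<in> N \<rightarrow>\<^sub>M wiener"
  shows "(\<lambda>x. time_below (t x) (bridge_path (t x) (y x) (g x))) \<in> borel_measurable N"
  using measurable_time_below_bridge_shift[OF assms(1,1,2) _ assms(3), of "\<lambda>_. 0"] by simp

definition exp_above :: "real \<Rightarrow> real \<Rightarrow> real \<Rightarrow> ennreal" where
  "exp_above \<alpha> t y = (\<integral>\<^sup>+w. ennreal (exp (\<alpha> * (t - time_below t (bridge_path t y w)))) \<partial>wiener)"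

lemma measurable_exp_above [measurable (raw)]:
  assumes [measurable]: "t \<in> borel_measurable N" "y \<in> borel_measurable N"
  shows "(\<lambda>x. exp_above \<alpha> (t x) (y x)) \<in> borel_measurable N"
  unfolding exp_above_def by (rule borel_measurable_nn_integral) measurable

lemma measurable_bridge_path_fun: "w \<in> space wiener \<Longrightarrow> bridge_path t y w \<in> borel_measurable borel"
  by (rule measurable_bridge_path) (auto intro: measurable_const)

lemma exp_above_le:
  assumes "0 \<le> t" "0 \<le> \<alpha>"
  shows "exp_above \<alpha> t y \<le> ennreal (exp (\<alpha> * t))"
proof -
  have "exp_above \<alpha> t y \<le> (\<integral>\<^sup>+w. ennreal (exp (\<alpha> * t)) \<partial>wiener)"
    unfolding exp_above_def
    using assms time_below_real(2)[OF measurable_bridge_path_fun]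
    by (intro nn_integral_mono) (auto intro!: mult_left_mono)
  then show ?thesis by (simp add: emeasure_space_1)
qed

lemma wiener_0: "AE w in wiener. w 0 = 0"
  using brownian by (simp add: brownian_motion_def)

text \<open>\<open>exp_occupation_nn_integral\<close> averaged over the bridge. After the integrals
  are exchanged, the Markov property at time s replaces the rest of the path by a bridge of length t
  - s from x.\<close>

lemma exp_above_duhamel:
  assumes t: "0 < t" and \<alpha>: "0 \<le> \<alpha>"
  shows "exp_above \<alpha> t y = 1 + (\<integral>\<^sup>+s. ennreal \<alpha> * (\<integral>\<^sup>+x. ennreal (normal_density (y * (t - s) / t) (sqrt (s * (t - s) / t)) x) *
    (exp_above \<alpha> (t - s) x * indicator {0..} x) \<partial>lborel) * indicator {0<..<t} s \<partial>lborel)"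
proof -
  \<comment> \<open>The factor with \<open>v 0 \<ge> 0\<close> is the indicator at time s, as seen
    by the path shifted by s.\<close>
  define F where "F T v = ennreal (of_bool (v 0 \<ge> 0) * exp (\<alpha> * (T - time_below T v)))" for T and v :: "real \<Rightarrow> real"
  have mF: "F T \<in> borel_measurable (path_space {0..T})" if "0 < T" for T
  proof -
    have [measurable]: "(\<lambda>v. v 0) \<in> borel_measurable (path_space {0..T})"
      using that by (intro measurable_path_space_eval) auto
    show ?thesis unfolding F_def by measurable
  qed
  have F_restrict: "F T (\<lambda>r\<in>{0..T}. v r) = F T v" if "0 < T" for T v
    using that unfolding F_def by (intro arg_cong[where f=ennreal] arg_cong2[where f="(*)"] arg_cong[where f=exp]
      arg_cong[where f="\<lambda>z. \<alpha> * (T - z)"] time_below_cong) auto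
  have [measurable]: "(\<lambda>x. time_below (t - snd x) (\<lambda>r. bridge_path t y (fst x) (snd x + r))) \<in> borel_measurable (wiener \<Otimes>\<^sub>M borel)"
    by (rule measurable_time_below_bridge_shift) measurable
  have [measurable]: "(\<lambda>(w, s). F (t - s) (\<lambda>r. bridge_path t y w (s + r))) \<in> borel_measurable (wiener \<Otimes>\<^sub>M borel)"
    unfolding F_def case_prod_beta' by measurable
  have "exp_above \<alpha> t y = (\<integral>\<^sup>+w. 1 + (\<integral>\<^sup>+s. ennreal \<alpha> * F (t - s) (\<lambda>r. bridge_path t y w (s + r)) * indicator {0<..<t} s \<partial>lborel) \<partial>wiener)"
    unfolding exp_above_def
  proof (intro nn_integral_cong)
    fix w assume w: "w \<in> space wiener"
    have "ennreal (exp (\<alpha> * (t - time_below t (bridge_path t y w)))) = 1 + (\<integral>\<^sup>+s. ennreal (\<alpha> * of_bool (bridge_path t y w s \<ge> 0) *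
      exp (\<alpha> * ((t - s) - time_below (t - s) (\<lambda>r. bridge_path t y w (s + r))))) * indicator {0<..<t} s \<partial>lborel)"
      using t \<alpha> w by (intro exp_occupation_nn_integral continuous_bridge_path measurable_bridge_path_fun) auto
    also have "(\<integral>\<^sup>+s. ennreal (\<alpha> * of_bool (bridge_path t y w s \<ge> 0) *
      exp (\<alpha> * ((t - s) - time_below (t - s) (\<lambda>r. bridge_path t y w (s + r))))) * indicator {0<..<t} s \<partial>lborel)
      = (\<integral>\<^sup>+s. ennreal \<alpha> * F (t - s) (\<lambda>r. bridge_path t y w (s + r)) * indicator {0<..<t} s \<partial>lborel)"
      using \<alpha> by (intro nn_integral_cong) (simp add: F_def ennreal_mult[symmetric] mult.assoc)
    finally show "ennreal (exp (\<alpha> * (t - time_below t (bridge_path t y w)))) =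
      1 + (\<integral>\<^sup>+s. ennreal \<alpha> * F (t - s) (\<lambda>r. bridge_path t y w (s + r)) * indicator {0<..<t} s \<partial>lborel)" .
  qed
  also have "\<dots> = 1 + (\<integral>\<^sup>+w. \<integral>\<^sup>+s. ennreal \<alpha> * F (t - s) (\<lambda>r. bridge_path t y w (s + r)) * indicator {0<..<t} s \<partial>lborel \<partial>wiener)"
    by (subst nn_integral_add) (auto simp: emeasure_space_1)
  also have "(\<integral>\<^sup>+w. \<integral>\<^sup>+s. ennreal \<alpha> * F (t - s) (\<lambda>r. bridge_path t y w (s + r)) * indicator {0<..<t} s \<partial>lborel \<partial>wiener)
    = (\<integral>\<^sup>+s. \<integral>\<^sup>+w. ennreal \<alpha> * F (t - s) (\<lambda>r. bridge_path t y w (s + r)) * indicator {0<..<t} s \<partial>wiener \<partial>lborel)"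
  proof -
    interpret pair_sigma_finite wiener lborel ..
    show ?thesis by (rule Fubini'[symmetric]) measurable
  qed
  also have "\<dots> = (\<integral>\<^sup>+s. ennreal \<alpha> * (\<integral>\<^sup>+x. ennreal (normal_density (y * (t - s) / t) (sqrt (s * (t - s) / t)) x) *
    (exp_above \<alpha> (t - s) x * indicator {0..} x) \<partial>lborel) * indicator {0<..<t} s \<partial>lborel)"
  proof (intro nn_integral_cong)
    fix s
    show "(\<integral>\<^sup>+w. ennreal \<alpha> * F (t - s) (\<lambda>r. bridge_path t y w (s + r)) * indicator {0<..<t} s \<partial>wiener)
      = ennreal \<alpha> * (\<integral>\<^sup>+x. ennreal (normal_density (y * (t - s) / t) (sqrt (s * (t - s) / t)) x) *
      (exp_above \<alpha> (t - s) x * indicator {0..} x) \<partial>lborel) * indicator {0<..<t} s"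
    proof (cases "s \<in> {0<..<t}")
      case True
      then have s: "0 < s" and T: "0 < t - s" by auto
      have [measurable]: "(\<lambda>w. time_below (t - s) (\<lambda>r. bridge_path t y w (s + r))) \<in> borel_measurable wiener"
        by (rule measurable_time_below_bridge_shift) measurable
      have [measurable]: "(\<lambda>w. F (t - s) (\<lambda>r. bridge_path t y w (s + r))) \<in> borel_measurable wiener"
        unfolding F_def by measurable
      \<comment> \<open>A bridge path starts at \<open>w 0 + x\<close>, which is x almost surely, so
        the indicator at its start becomes one of x.\<close>
      have inner: "(\<integral>\<^sup>+w. F (t - s) (\<lambda>r\<in>{0..t - s}. bridge_path (t - s) x w r) \<partial>wiener)
        = exp_above \<alpha> (t - s) x * indicator {0..} x" for x
      proof -
        have "(\<integral>\<^sup>+w. F (t - s) (\<lambda>r\<in>{0..t - s}. bridge_path (t - s) x w r) \<partial>wiener)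
          = (\<integral>\<^sup>+w. ennreal (exp (\<alpha> * ((t - s) - time_below (t - s) (bridge_path (t - s) x w)))) * indicator {0..} x \<partial>wiener)"
          unfolding F_restrict[OF T]
          using wiener_0 by (intro nn_integral_cong_AE, eventually_elim) (auto simp: F_def bridge_path_def)
        also have "\<dots> = exp_above \<alpha> (t - s) x * indicator {0..} x"
          unfolding exp_above_def by (rule nn_integral_multc) measurable
        finally show ?thesis .
      qed
      have "(\<integral>\<^sup>+w. F (t - s) (\<lambda>r. bridge_path t y w (s + r)) \<partial>wiener)
        = (\<integral>\<^sup>+w. F (t - s) (\<lambda>r\<in>{0..t - s}. bridge_path (s + (t - s)) y w (s + r)) \<partial>wiener)"
        by (simp add: F_restrict[OF T])
      also have "\<dots> = (\<integral>\<^sup>+x. ennreal (normal_density (y * (t - s) / t) (sqrt (s * (t - s) / t)) x) *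
         (\<integral>\<^sup>+w. F (t - s) (\<lambda>r\<in>{0..t - s}. bridge_path (t - s) x w r) \<partial>wiener) \<partial>lborel)"
        unfolding bridge_shift_nn_integral[OF s T mF[OF T]] by simp
      also have "\<dots> = (\<integral>\<^sup>+x. ennreal (normal_density (y * (t - s) / t) (sqrt (s * (t - s) / t)) x) *
         (exp_above \<alpha> (t - s) x * indicator {0..} x) \<partial>lborel)"
        unfolding inner ..
      finally show ?thesis using True by (simp add: nn_integral_cmult)
    qed simp
  qed
  finally show ?thesis .
qed

text \<open>The Green function between y and 0 of Brownian motion killed at rate a^2 / 2 on the
  negative half-line and at rate a^2 / 2 - \<alpha> elsewhere.\<close>

definition resolvent :: "real \<Rightarrow> real \<Rightarrow> real \<Rightarrow> ennreal" where
  "resolvent a \<alpha> y = (\<integral>\<^sup>+t. killed_heat a t y * exp_above \<alpha> t y \<partial>lborel)"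

lemma measurable_resolvent [measurable]: "resolvent a \<alpha> \<in> borel_measurable borel"
  unfolding resolvent_def by (rule lborel.borel_measurable_nn_integral) measurable

text \<open>The time integral of a convolution is the product of the time integrals. With T = t - s,
  the first heat kernel integrates to the Green function, and the second one together with
  \<open>exp_above\<close> to the resolvent at x.\<close>

lemma resolvent_eq:
  assumes a: "0 < a" and \<alpha>: "0 \<le> \<alpha>"
  shows "resolvent a \<alpha> y = ennreal (exp (- (a * \<bar>y\<bar>)) / a) +
    (\<integral>\<^sup>+x. ennreal \<alpha> * ennreal (exp (- (a * \<bar>y - x\<bar>)) / a) * resolvent a \<alpha> x * indicator {0..} x \<partial>lborel)"
proof -
  define H where "H s T x = ennreal \<alpha> * killed_heat a s (y - x) * (killed_heat a T x * exp_above \<alpha> T x) * indicator {0..} x" for s T x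
  have [measurable]: "(\<lambda>z. H (f z) (g z) (h z)) \<in> borel_measurable N"
    if [measurable]: "f \<in> borel_measurable N" "g \<in> borel_measurable N" "h \<in> borel_measurable N" for f g h and N :: "'z measure"
    unfolding H_def by measurable
  have pt: "killed_heat a t y * exp_above \<alpha> t y = killed_heat a t y + (\<integral>\<^sup>+s. \<integral>\<^sup>+x. H s (t - s) x \<partial>lborel \<partial>lborel)" for t
  proof (cases "0 < t")
    case True
    have "killed_heat a t y * (\<integral>\<^sup>+s. ennreal \<alpha> * (\<integral>\<^sup>+x. ennreal (normal_density (y * (t - s) / t) (sqrt (s * (t - s) / t)) x) *
        (exp_above \<alpha> (t - s) x * indicator {0..} x) \<partial>lborel) * indicator {0<..<t} s \<partial>lborel)
      = (\<integral>\<^sup>+s. killed_heat a t y * (ennreal \<alpha> * (\<integral>\<^sup>+x. ennreal (normal_density (y * (t - s) / t) (sqrt (s * (t - s) / t)) x) *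
        (exp_above \<alpha> (t - s) x * indicator {0..} x) \<partial>lborel) * indicator {0<..<t} s) \<partial>lborel)"
      unfolding normal_density_def
      by (intro nn_integral_cmult[symmetric] borel_measurable_times_ennreal lborel.borel_measurable_nn_integral) measurable
    also have "\<dots> = (\<integral>\<^sup>+s. \<integral>\<^sup>+x. H s (t - s) x \<partial>lborel \<partial>lborel)"
    proof (intro nn_integral_cong)
      fix s
      show "killed_heat a t y * (ennreal \<alpha> * (\<integral>\<^sup>+x. ennreal (normal_density (y * (t - s) / t) (sqrt (s * (t - s) / t)) x) *
        (exp_above \<alpha> (t - s) x * indicator {0..} x) \<partial>lborel) * indicator {0<..<t} s) = (\<integral>\<^sup>+x. H s (t - s) x \<partial>lborel)"
      proof (cases "s \<in> {0<..<t}")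
        case True
        then have st: "0 < s" "s < t" by auto
        have "H s (t - s) x = (killed_heat a t y * ennreal \<alpha>) * (ennreal (normal_density (y * (t - s) / t) (sqrt (s * (t - s) / t)) x) *
          (exp_above \<alpha> (t - s) x * indicator {0..} x))" for x
          using killed_heat_bridge[OF st, of a y x] unfolding H_def by (simp add: mult_ac)
        then show ?thesis
          using True by (simp add: nn_integral_cmult mult.assoc)
      next
        case False
        then have "H s (t - s) x = 0" for x by (auto simp: H_def killed_heat_def)
        then show ?thesis using False by simp
      qed
    qed
    finally show ?thesis
      unfolding exp_above_duhamel[OF True \<alpha>] by (simp add: distrib_left)
  next
    case False
    then have "H s (t - s) x = 0" for s x by (auto simp: H_def killed_heat_def indicator_def)
    then show ?thesis using False by (simp add: killed_heat_def)
  qed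
  have "resolvent a \<alpha> y = (\<integral>\<^sup>+t. killed_heat a t y \<partial>lborel) + (\<integral>\<^sup>+t. \<integral>\<^sup>+s. \<integral>\<^sup>+x. H s (t - s) x \<partial>lborel \<partial>lborel \<partial>lborel)"
    unfolding resolvent_def pt
    by (intro nn_integral_add) measurable
  also have "(\<integral>\<^sup>+t. \<integral>\<^sup>+s. \<integral>\<^sup>+x. H s (t - s) x \<partial>lborel \<partial>lborel \<partial>lborel) = (\<integral>\<^sup>+s. \<integral>\<^sup>+t. \<integral>\<^sup>+x. H s (t - s) x \<partial>lborel \<partial>lborel \<partial>lborel)"
    by (rule lborel_pair.Fubini') measurable
  also have "\<dots> = (\<integral>\<^sup>+s. \<integral>\<^sup>+T. \<integral>\<^sup>+x. H s T x \<partial>lborel \<partial>lborel \<partial>lborel)"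
  proof (rule nn_integral_cong)
    fix s
    show "(\<integral>\<^sup>+t. \<integral>\<^sup>+x. H s (t - s) x \<partial>lborel \<partial>lborel) = (\<integral>\<^sup>+T. \<integral>\<^sup>+x. H s T x \<partial>lborel \<partial>lborel)"
      using nn_integral_real_affine[of "\<lambda>T. \<integral>\<^sup>+x. H s T x \<partial>lborel" 1 "- s"] by simp
  qed
  also have "\<dots> = (\<integral>\<^sup>+s. \<integral>\<^sup>+x. \<integral>\<^sup>+T. H s T x \<partial>lborel \<partial>lborel \<partial>lborel)"
    by (rule nn_integral_cong, rule lborel_pair.Fubini') measurable
  also have "\<dots> = (\<integral>\<^sup>+x. \<integral>\<^sup>+s. \<integral>\<^sup>+T. H s T x \<partial>lborel \<partial>lborel \<partial>lborel)"
    by (rule lborel_pair.Fubini') measurable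
  also have "\<dots> = (\<integral>\<^sup>+x. ennreal \<alpha> * ennreal (exp (- (a * \<bar>y - x\<bar>)) / a) * resolvent a \<alpha> x * indicator {0..} x \<partial>lborel)"
  proof (intro nn_integral_cong)
    fix x
    have "(\<integral>\<^sup>+s. \<integral>\<^sup>+T. H s T x \<partial>lborel \<partial>lborel) = (\<integral>\<^sup>+s. ennreal \<alpha> * killed_heat a s (y - x) * (resolvent a \<alpha> x * indicator {0..} x) \<partial>lborel)"
    proof (rule nn_integral_cong)
      fix s
      show "(\<integral>\<^sup>+T. H s T x \<partial>lborel) = ennreal \<alpha> * killed_heat a s (y - x) * (resolvent a \<alpha> x * indicator {0..} x)"
        by (cases "0 \<le> x") (simp_all add: H_def resolvent_def nn_integral_cmult mult.assoc)
    qed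
    also have "\<dots> = ennreal \<alpha> * (\<integral>\<^sup>+s. killed_heat a s (y - x) \<partial>lborel) * (resolvent a \<alpha> x * indicator {0..} x)"
      by (simp add: nn_integral_cmult nn_integral_multc)
    finally show "(\<integral>\<^sup>+s. \<integral>\<^sup>+T. H s T x \<partial>lborel \<partial>lborel) = ennreal \<alpha> * ennreal (exp (- (a * \<bar>y - x\<bar>)) / a) * resolvent a \<alpha> x * indicator {0..} x"
      unfolding nn_integral_killed_heat[OF a] by (simp add: mult.assoc)
  qed
  finally show ?thesis unfolding nn_integral_killed_heat[OF a] .
qed

text \<open>The resolvent and the explicit function are both bounded solutions on the half-line, so
  \<open>resolvent_le\<close> applies in both directions. The bound 1 / m holds because
  \<open>exp_above\<close> lowers the killing rate from a^2 / 2 to m^2 / 2 at most.\<close>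

lemma resolvent_explicit:
  assumes m: "0 < m" and am: "m < a"
  shows "resolvent a ((a\<^sup>2 - m\<^sup>2) / 2) y = ennreal (2 / (m + a) * (if 0 \<le> y then exp (- (m * y)) else exp (a * y)))"
proof -
  define \<alpha> where "\<alpha> = (a\<^sup>2 - m\<^sup>2) / 2"
  have a: "0 < a" and \<alpha>: "0 < \<alpha>" using m am by (auto simp: \<alpha>_def power_strict_mono)
  define W where "W y = ennreal (2 / (m + a) * (if 0 \<le> y then exp (- (m * y)) else exp (a * y)))" for y
  define k where "k y x = ennreal \<alpha> * ennreal (exp (- (a * \<bar>y - x\<bar>)) / a)" for y x
  have [measurable]: "W \<in> borel_measurable borel" unfolding W_def by measurable
  have mk: "(\<lambda>(y, x). k y x) \<in> borel_measurable (borel \<Otimes>\<^sub>M borel)" unfolding k_def by measurable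
  have U: "resolvent a \<alpha> y = ennreal (exp (- (a * \<bar>y\<bar>)) / a) + (\<integral>\<^sup>+x. k y x * resolvent a \<alpha> x * indicator {0..} x \<partial>lborel)" for y
    unfolding k_def using a \<alpha> by (intro resolvent_eq) auto
  have V: "W y = ennreal (exp (- (a * \<bar>y\<bar>)) / a) + (\<integral>\<^sup>+x. k y x * W x * indicator {0..} x \<partial>lborel)" for y
  proof -
    have "(\<integral>\<^sup>+x. k y x * W x * indicator {0..} x \<partial>lborel) =
      (\<integral>\<^sup>+x. ennreal \<alpha> * ennreal (exp (- (a * \<bar>y - x\<bar>)) / a) * ennreal (2 / (m + a) * exp (- (m * x))) * indicator {0..} x \<partial>lborel)"
      by (intro nn_integral_cong) (auto simp: k_def W_def indicator_def)
    then show ?thesis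
      unfolding W_def[of y] resolvent_solution[OF m am, of y, symmetric] \<alpha>_def by simp
  qed
  have kb: "(\<integral>\<^sup>+x. k y x \<partial>lborel) \<le> ennreal (\<alpha> * (2 / a\<^sup>2))" for y
  proof -
    have "(\<integral>\<^sup>+x. k y x \<partial>lborel) = ennreal \<alpha> * (\<integral>\<^sup>+x. ennreal (exp (- (a * \<bar>y - x\<bar>)) / a) \<partial>lborel)"
      unfolding k_def by (rule nn_integral_cmult) measurable
    also have "\<dots> \<le> ennreal \<alpha> * ennreal (2 / a\<^sup>2)"
      by (intro mult_left_mono green_total a) simp
    finally show ?thesis using \<alpha> by (simp flip: ennreal_mult)
  qed
  have q: "0 \<le> \<alpha> * (2 / a\<^sup>2)" "\<alpha> * (2 / a\<^sup>2) < 1" using \<alpha> a m am by (auto simp: \<alpha>_def field_simps)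
  have bU: "resolvent a \<alpha> y \<le> ennreal (1 / m)" for y
  proof -
    have "resolvent a \<alpha> y \<le> (\<integral>\<^sup>+t. killed_heat m t y \<partial>lborel)"
      unfolding resolvent_def
    proof (intro nn_integral_mono)
      fix t
      show "killed_heat a t y * exp_above \<alpha> t y \<le> killed_heat m t y"
      proof (cases "0 < t")
        case True
        have "killed_heat a t y * exp_above \<alpha> t y \<le> killed_heat a t y * ennreal (exp (\<alpha> * t))"
          using True \<alpha> by (intro mult_left_mono exp_above_le) auto
        also have "\<dots> = killed_heat m t y"
        proof -
          have "exp (- (a\<^sup>2 / 2 * t)) * exp (\<alpha> * t) = exp (- (m\<^sup>2 / 2 * t))"
            by (simp add: exp_add[symmetric] \<alpha>_def field_simps)
          then show ?thesis using True by (simp add: killed_heat_def ennreal_mult[symmetric] mult_ac)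
        qed
        finally show ?thesis .
      qed (simp add: killed_heat_def)
    qed
    also have "\<dots> \<le> ennreal (1 / m)"
      unfolding nn_integral_killed_heat[OF m] using m by (intro ennreal_leI divide_right_mono) auto
    finally show ?thesis .
  qed
  have bW: "W y \<le> ennreal (2 / (m + a))" if "0 \<le> y" for y
    using that m am unfolding W_def by (auto intro!: ennreal_leI divide_right_mono)
  have eq: "resolvent a \<alpha> y = W y" if "0 \<le> y" for y
  proof (rule antisym)
    show "resolvent a \<alpha> y \<le> W y"
      by (rule resolvent_le[OF _ _ mk U V kb q bU _ that]) (use m in auto)
    show "W y \<le> resolvent a \<alpha> y"
      by (rule resolvent_le[OF _ _ mk V U kb q bW _ that]) (use m am in auto)
  qed
  \<comment> \<open>This extends the result to negative y: the right-hand side involves the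
    resolvent only at x \<ge> 0, where it is already known.\<close>
  have "resolvent a \<alpha> y = ennreal (exp (- (a * \<bar>y\<bar>)) / a) + (\<integral>\<^sup>+x. k y x * resolvent a \<alpha> x * indicator {0..} x \<partial>lborel)"
    by (rule U)
  also have "(\<integral>\<^sup>+x. k y x * resolvent a \<alpha> x * indicator {0..} x \<partial>lborel) = (\<integral>\<^sup>+x. k y x * W x * indicator {0..} x \<partial>lborel)"
    by (intro nn_integral_cong) (auto simp: indicator_def eq)
  finally show ?thesis using V[of y] by (simp add: W_def \<alpha>_def)
qed

end

section \<open>The law of the occupation time\<close>

lemma time_below_nonneg: "0 \<le> time_below t f"
  unfolding time_below_def set_lebesgue_integral_def by (intro integral_nonneg_AE) auto

lemma killed_heat_0: "killed_heat 0 t x = ennreal (normal_density 0 (sqrt t) x) * indicator {0<..} t"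
  by (simp add: killed_heat_def)

lemma killed_heat_mult:
  "killed_heat 0 t x * ennreal (exp (- (c * t))) = killed_heat (sqrt (2 * c)) t x" if "0 \<le> c"
  using that by (simp add: killed_heat_def ennreal_mult[symmetric] mult_ac indicator_def)

context wiener_measure
begin

definition occupation_laplace :: "real \<Rightarrow> real \<Rightarrow> real \<Rightarrow> ennreal" where
  "occupation_laplace \<alpha> t y = (\<integral>\<^sup>+w. ennreal (exp (- (\<alpha> * time_below t (bridge_path t y w)))) \<partial>wiener)"

lemma measurable_occupation_laplace [measurable (raw)]:
  assumes [measurable]: "t \<in> borel_measurable N" "y \<in> borel_measurable N"
  shows "(\<lambda>x. occupation_laplace \<alpha> (t x) (y x)) \<in> borel_measurable N"
  unfolding occupation_laplace_def by (rule borel_measurable_nn_integral) measurable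

lemma exp_above_eq: "exp_above \<alpha> t y = ennreal (exp (\<alpha> * t)) * occupation_laplace \<alpha> t y"
  unfolding exp_above_def occupation_laplace_def
  by (subst nn_integral_cmult[symmetric])
    (auto intro!: nn_integral_cong simp: right_diff_distrib exp_diff exp_minus field_simps simp flip: ennreal_mult)

text \<open>Rate a^2 / 2 everywhere, relieved by \<alpha> at and above 0, is the same as rate m^2 /
  2 everywhere, increased by \<alpha> below 0, provided a^2 = m^2 + 2 \<alpha>.\<close>

lemma double_laplace:
  assumes m: "0 < m" and \<alpha>: "0 < \<alpha>"
  shows "(\<integral>\<^sup>+t. killed_heat m t y * occupation_laplace \<alpha> t y \<partial>lborel)
    = ennreal (2 / (m + sqrt (m\<^sup>2 + 2 * \<alpha>)) * (if 0 \<le> y then exp (- (m * y)) else exp (sqrt (m\<^sup>2 + 2 * \<alpha>) * y)))"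
proof -
  define a where "a = sqrt (m\<^sup>2 + 2 * \<alpha>)"
  have a2: "a\<^sup>2 = m\<^sup>2 + 2 * \<alpha>" using \<alpha> by (simp add: a_def)
  have am: "m < a" unfolding a_def using m \<alpha> by (intro real_less_rsqrt) simp
  have \<alpha>': "(a\<^sup>2 - m\<^sup>2) / 2 = \<alpha>" using a2 by simp
  have "killed_heat a t y * ennreal (exp (\<alpha> * t)) = killed_heat m t y" for t
  proof -
    have "- (a\<^sup>2 / 2 * t) + \<alpha> * t = - (m\<^sup>2 / 2 * t)" unfolding a2 by (simp add: field_simps)
    then have "exp (- (a\<^sup>2 / 2 * t)) * exp (\<alpha> * t) = exp (- (m\<^sup>2 / 2 * t))" by (simp only: exp_add[symmetric])
    then show ?thesis by (simp add: killed_heat_def ennreal_mult[symmetric] mult_ac indicator_def)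
  qed
  then have "(\<integral>\<^sup>+t. killed_heat m t y * occupation_laplace \<alpha> t y \<partial>lborel) = resolvent a \<alpha> y"
    unfolding resolvent_def exp_above_eq by (simp add: mult.assoc[symmetric])
  then show ?thesis
    using resolvent_explicit[OF m am, of y, unfolded \<alpha>'] by (simp only: a_def[symmetric])
qed

text \<open>Without killing the heat kernel has an infinite time integral, so m = 0 is reached only
  as a limit. The killed kernels increase as m decreases, and monotone convergence applies.\<close>

lemma heat_laplace:
  assumes \<alpha>: "0 < \<alpha>"
  shows "(\<integral>\<^sup>+t. killed_heat 0 t y * occupation_laplace \<alpha> t y \<partial>lborel)
    = ennreal (2 / sqrt (2 * \<alpha>) * exp (sqrt (2 * \<alpha>) * min y 0))"
proof (rule LIMSEQ_unique)
  define m where "m n = 1 / real (Suc n)" for n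
  have m0: "m \<longlonglongrightarrow> 0" unfolding m_def using LIMSEQ_inverse_real_of_nat by (simp add: inverse_eq_divide)
  have mpos: "0 < m n" for n by (simp add: m_def)
  have mdec: "m (Suc n) \<le> m n" for n by (simp add: m_def frac_le)
  let ?f = "\<lambda>n t. killed_heat (m n) t y * occupation_laplace \<alpha> t y"
  show "(\<lambda>n. \<integral>\<^sup>+t. ?f n t \<partial>lborel) \<longlonglongrightarrow> (\<integral>\<^sup>+t. killed_heat 0 t y * occupation_laplace \<alpha> t y \<partial>lborel)"
  proof (rule nn_integral_LIMSEQ)
    show "incseq ?f"
    proof (intro incseq_SucI le_funI mult_right_mono)
      fix n t
      have "(m (Suc n))\<^sup>2 \<le> (m n)\<^sup>2" using mdec[of n] mpos[of "Suc n"] by (intro power_mono) auto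
      then show "killed_heat (m n) t y \<le> killed_heat (m (Suc n)) t y"
        unfolding killed_heat_def
        by (auto simp: indicator_def intro!: ennreal_leI mult_right_mono)
    qed auto
    show "(\<lambda>n. ?f n t) \<longlonglongrightarrow> killed_heat 0 t y * occupation_laplace \<alpha> t y" for t
    proof -
      have "occupation_laplace \<alpha> t y \<le> (\<integral>\<^sup>+w. 1 \<partial>wiener)"
        unfolding occupation_laplace_def using \<alpha> time_below_nonneg by (intro nn_integral_mono) auto
      then have fin: "occupation_laplace \<alpha> t y < \<infinity>" by (simp add: emeasure_space_1 order_le_less_trans)
      have "(\<lambda>n. exp (- ((m n)\<^sup>2 / 2 * t)) * normal_density 0 (sqrt t) y) \<longlonglongrightarrow> exp (- (0\<^sup>2 / 2 * t)) * normal_density 0 (sqrt t) y"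
        by (intro tendsto_intros m0) auto
      then have "(\<lambda>n. killed_heat (m n) t y) \<longlonglongrightarrow> killed_heat 0 t y"
        unfolding killed_heat_def by (cases "0 < t") (auto intro: tendsto_ennrealI)
      then show ?thesis
        using fin by (intro tendsto_mult_ennreal tendsto_const) (auto simp: killed_heat_def indicator_def)
    qed
  qed measurable
  have "(\<lambda>n. ennreal (2 / (m n + sqrt ((m n)\<^sup>2 + 2 * \<alpha>)) * (if 0 \<le> y then exp (- (m n * y)) else exp (sqrt ((m n)\<^sup>2 + 2 * \<alpha>) * y))))
     \<longlonglongrightarrow> ennreal (2 / (0 + sqrt (0\<^sup>2 + 2 * \<alpha>)) * (if 0 \<le> y then exp (- (0 * y)) else exp (sqrt (0\<^sup>2 + 2 * \<alpha>) * y)))"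
    using \<alpha> by (cases "0 \<le> y") (auto intro!: tendsto_ennrealI tendsto_eq_intros m0)
  then show "(\<lambda>n. \<integral>\<^sup>+t. ?f n t \<partial>lborel) \<longlonglongrightarrow> ennreal (2 / sqrt (2 * \<alpha>) * exp (sqrt (2 * \<alpha>) * min y 0))"
    unfolding double_laplace[OF mpos \<alpha>] by (cases "0 \<le> y") (simp_all add: min_absorb1 min_absorb2)
qed

text \<open>An \<open>ennreal\<close> counterpart of \<open>bridge_q\<close> on the fixed space
  \<open>wiener\<close>, where its measurability in t follows from Fubini.\<close>

definition bridge_cdf :: "real \<Rightarrow> real \<Rightarrow> real \<Rightarrow> ennreal" where
  "bridge_cdf y t u = emeasure wiener {w \<in> space wiener. time_below t (bridge_path t y w) \<le> u}"

text \<open>Up to the factor \<open>\<surd>(2\<pi>)\<close>, the measure on the left of \<open>heat_occupation\<close> is the law of the time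
  below 0 under the Green measure of paths from \<open>y\<close> to 0; its Laplace transform is \<open>heat_laplace\<close>.\<close>

lemma heat_occupation:
  "distr (density (lborel \<Otimes>\<^sub>M wiener) (\<lambda>z. killed_heat 0 (fst z) y)) borel
     (\<lambda>z. time_below (fst z) (bridge_path (fst z) y (snd z)))
   = density lborel (\<lambda>a. 2 * killed_heat 0 a (min y 0))" (is "?L = ?R")
proof (rule laplace_unique)
  interpret LW: pair_sigma_finite lborel wiener ..
  have L: "(\<integral>\<^sup>+a. ennreal (exp (- (c * a))) \<partial>?L) = ennreal (2 / sqrt (2 * c) * exp (sqrt (2 * c) * min y 0))"
    if "0 < c" for c
  proof -
    have "(\<integral>\<^sup>+a. ennreal (exp (- (c * a))) \<partial>?L) = (\<integral>\<^sup>+z. killed_heat 0 (fst z) y *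
        ennreal (exp (- (c * time_below (fst z) (bridge_path (fst z) y (snd z))))) \<partial>(lborel \<Otimes>\<^sub>M wiener))"
      by (subst nn_integral_distr, measurable, subst nn_integral_density) measurable
    also have "\<dots> = (\<integral>\<^sup>+t. \<integral>\<^sup>+w. killed_heat 0 t y * ennreal (exp (- (c * time_below t (bridge_path t y w)))) \<partial>wiener \<partial>lborel)"
      by (subst nn_integral_fst[symmetric], measurable)
    also have "\<dots> = (\<integral>\<^sup>+t. killed_heat 0 t y * occupation_laplace c t y \<partial>lborel)"
      unfolding occupation_laplace_def by (intro nn_integral_cong nn_integral_cmult) measurable
    finally show ?thesis unfolding heat_laplace[OF that] .
  qed
  \<comment> \<open>With killing parameter sqrt (2 c) this is twice the Green function at
    \<open>min y 0\<close>, a point that is never positive.\<close>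
  have R: "(\<integral>\<^sup>+a. ennreal (exp (- (c * a))) \<partial>?R) = ennreal (2 / sqrt (2 * c) * exp (sqrt (2 * c) * min y 0))"
    if "0 < c" for c
  proof -
    have "(\<integral>\<^sup>+a. ennreal (exp (- (c * a))) \<partial>?R) = (\<integral>\<^sup>+a. 2 * (killed_heat 0 a (min y 0) * ennreal (exp (- (c * a)))) \<partial>lborel)"
      by (subst nn_integral_density) (auto simp: mult.assoc)
    also have "\<dots> = 2 * (\<integral>\<^sup>+a. killed_heat (sqrt (2 * c)) a (min y 0) \<partial>lborel)"
      using that by (simp add: killed_heat_mult nn_integral_cmult)
    also have "\<dots> = ennreal (2 / sqrt (2 * c) * exp (sqrt (2 * c) * min y 0))"
      using that by (simp add: nn_integral_killed_heat min_def ennreal_mult'[symmetric] flip: ennreal_numeral)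
    finally show ?thesis .
  qed
  show "(\<integral>\<^sup>+a. ennreal (exp (- (real k * a))) \<partial>?L) = (\<integral>\<^sup>+a. ennreal (exp (- (real k * a))) \<partial>?R)" if "1 \<le> k" for k :: nat
    using that by (simp only: L R of_nat_0_less_iff)
  show "(\<integral>\<^sup>+a. ennreal (exp (- a)) \<partial>?L) \<noteq> \<infinity>"
    using L[of 1] by simp
  show "AE a in ?L. 0 \<le> a"
    by (subst AE_distr_iff) (auto simp: time_below_nonneg)
  show "AE a in ?R. 0 \<le> a"
    by (subst AE_density, measurable) (auto simp: killed_heat_0 indicator_def)
qed auto

text \<open>\<open>heat_occupation\<close> evaluated on the half-line up to u. The values claimed in
  the theorem come from this formula.\<close>

lemma nn_integral_bridge_cdf:
  "(\<integral>\<^sup>+t. killed_heat 0 t y * bridge_cdf y t u \<partial>lborel) = (\<integral>\<^sup>+a. 2 * killed_heat 0 a (min y 0) * indicator {..u} a \<partial>lborel)"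
proof -
  interpret LW: pair_sigma_finite lborel wiener ..
  have "(\<integral>\<^sup>+a. indicator {..u} a \<partial>distr (density (lborel \<Otimes>\<^sub>M wiener) (\<lambda>z. killed_heat 0 (fst z) y)) borel
     (\<lambda>z. time_below (fst z) (bridge_path (fst z) y (snd z)))) = (\<integral>\<^sup>+z. killed_heat 0 (fst z) y *
      indicator {..u} (time_below (fst z) (bridge_path (fst z) y (snd z))) \<partial>(lborel \<Otimes>\<^sub>M wiener))"
    by (subst nn_integral_distr, measurable, subst nn_integral_density) measurable
  also have "\<dots> = (\<integral>\<^sup>+t. \<integral>\<^sup>+w. killed_heat 0 t y * indicator {..u} (time_below t (bridge_path t y w)) \<partial>wiener \<partial>lborel)"
    by (subst nn_integral_fst[symmetric], measurable)
  also have "\<dots> = (\<integral>\<^sup>+t. killed_heat 0 t y * bridge_cdf y t u \<partial>lborel)"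
  proof (intro nn_integral_cong)
    fix t
    have "(\<integral>\<^sup>+w. killed_heat 0 t y * indicator {..u} (time_below t (bridge_path t y w)) \<partial>wiener)
      = killed_heat 0 t y * (\<integral>\<^sup>+w. indicator {..u} (time_below t (bridge_path t y w)) \<partial>wiener)"
      by (rule nn_integral_cmult) measurable
    also have "(\<integral>\<^sup>+w. indicator {..u} (time_below t (bridge_path t y w)) \<partial>wiener)
      = (\<integral>\<^sup>+w. indicator {w \<in> space wiener. time_below t (bridge_path t y w) \<le> u} w \<partial>wiener)"
      by (intro nn_integral_cong) (auto simp: indicator_def)
    also have "\<dots> = bridge_cdf y t u"
      unfolding bridge_cdf_def by (rule nn_integral_indicator) measurable
    finally show "(\<integral>\<^sup>+w. killed_heat 0 t y * indicator {..u} (time_below t (bridge_path t y w)) \<partial>wiener)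
      = killed_heat 0 t y * bridge_cdf y t u" .
  qed
  finally show ?thesis
    unfolding heat_occupation by (subst (asm) nn_integral_density) auto
qed

section \<open>The starting point 0: the occupation time is uniform\<close>

text \<open>The double transform of the uniform law on [0, t], to be matched with
  \<open>double_laplace\<close> for y = 0, m = sqrt (2 j) and \<alpha> = k. Integrating over time
  first leaves 1 / sqrt (2 (j + k v)), which has an elementary antiderivative in v.\<close>

lemma uniform_laplace:
  assumes j: "0 < j" and k: "0 < k"
  shows "(\<integral>\<^sup>+t. killed_heat (sqrt (2 * j)) t 0 * (\<integral>\<^sup>+v. ennreal (exp (- (k * (t * v)))) * indicator {0..1} v \<partial>lborel) \<partial>lborel)
    = ennreal (2 / (sqrt (2 * j) + sqrt (2 * j + 2 * k)))"
proof -
  have "(\<integral>\<^sup>+t. killed_heat (sqrt (2 * j)) t 0 * (\<integral>\<^sup>+v. ennreal (exp (- (k * (t * v)))) * indicator {0..1} v \<partial>lborel) \<partial>lborel)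
    = (\<integral>\<^sup>+t. \<integral>\<^sup>+v. killed_heat (sqrt (2 * j)) t 0 * (ennreal (exp (- (k * (t * v)))) * indicator {0..1} v) \<partial>lborel \<partial>lborel)"
    by (intro nn_integral_cong nn_integral_cmult[symmetric]) measurable
  also have "\<dots> = (\<integral>\<^sup>+v. \<integral>\<^sup>+t. killed_heat (sqrt (2 * j)) t 0 * (ennreal (exp (- (k * (t * v)))) * indicator {0..1} v) \<partial>lborel \<partial>lborel)"
    by (rule lborel_pair.Fubini') measurable
  also have "\<dots> = (\<integral>\<^sup>+v. ennreal (1 / sqrt (2 * (j + k * v))) * indicator {0..1} v \<partial>lborel)"
  proof (rule nn_integral_cong)
    fix v :: real
    show "(\<integral>\<^sup>+t. killed_heat (sqrt (2 * j)) t 0 * (ennreal (exp (- (k * (t * v)))) * indicator {0..1} v) \<partial>lborel)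
      = ennreal (1 / sqrt (2 * (j + k * v))) * indicator {0..1} v"
    proof (cases "v \<in> {0..1}")
      case True
      then have jv: "0 < j + k * v" using j k by (simp add: add_pos_nonneg)
      have "killed_heat (sqrt (2 * j)) t 0 * ennreal (exp (- (k * (t * v)))) = killed_heat (sqrt (2 * (j + k * v))) t 0" for t
      proof -
        have "exp (- (j * t)) * exp (- (k * (t * v))) = exp (- ((j + k * v) * t))"
          by (simp add: exp_add[symmetric] algebra_simps)
        then show ?thesis
          using j jv by (simp add: killed_heat_def ennreal_mult[symmetric] indicator_def mult_ac)
      qed
      then show ?thesis
        using True jv by (simp add: nn_integral_killed_heat)
    qed simp
  qed
  also have "\<dots> = ennreal (sqrt (2 * (j + k * 1)) / k - sqrt (2 * (j + k * 0)) / k)"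
  proof (rule nn_integral_FTC_Icc[where F="\<lambda>v. sqrt (2 * (j + k * v)) / k"])
    fix v :: real assume "v \<in> {0..1}"
    then have jv: "0 < j + k * v" using j k by (simp add: add_pos_nonneg)
    then show "DERIV (\<lambda>v. sqrt (2 * (j + k * v)) / k) v :> 1 / sqrt (2 * (j + k * v))"
      using k by (auto intro!: derivative_eq_intros simp: divide_simps)
    show "0 \<le> 1 / sqrt (2 * (j + k * v))" using jv by simp
  qed auto
  also have "sqrt (2 * (j + k * 1)) / k - sqrt (2 * (j + k * 0)) / k = 2 / (sqrt (2 * j) + sqrt (2 * j + 2 * k))"
  proof -
    define p where "p = sqrt (2 * j + 2 * k)"
    define q where "q = sqrt (2 * j)"
    have pq: "p\<^sup>2 = 2 * j + 2 * k" "q\<^sup>2 = 2 * j" "0 < p" "0 < q" using j k by (auto simp: p_def q_def)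
    have "(p - q) * (q + p) = 2 * k" using pq by (simp add: power2_eq_square algebra_simps)
    then have "(p - q) / k = 2 / (q + p)" using pq k by (simp add: divide_simps)
    then show ?thesis by (simp add: p_def q_def diff_divide_distrib distrib_left)
  qed
  finally show ?thesis .
qed

text \<open>The double transform is inverted one variable at a time. For each natural k, uniqueness
  in t gives equality for almost all t; there are countably many exceptional sets, and outside them
  uniqueness in the occupation variable identifies the uniform law on [0, t]. The result is only
  integrated over t, so almost every t is enough.\<close>

lemma AE_bridge_cdf_0: "AE t in lborel. 0 < t \<longrightarrow> bridge_cdf 0 t 1 = ennreal (min 1 (1 / t))"
proof -
  let ?U = "\<lambda>k t. \<integral>\<^sup>+v. ennreal (exp (- (k * (t * v)))) * indicator {0..1} v \<partial>lborel"
  have "AE t in lborel. killed_heat 0 t 0 * occupation_laplace k t 0 = killed_heat 0 t 0 * ?U k t" if k: "0 < k" for k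
  proof (rule sigma_finite_measure.density_unique[OF sigma_finite_lborel])
    have eq: "(\<integral>\<^sup>+a. ennreal (exp (- (real j * a))) \<partial>density lborel (\<lambda>t. killed_heat 0 t 0 * f t))
       = (\<integral>\<^sup>+t. killed_heat (sqrt (2 * real j)) t 0 * f t \<partial>lborel)" if [measurable]: "f \<in> borel_measurable borel" for f and j :: nat
    proof -
      have "killed_heat 0 t 0 * f t * ennreal (exp (- (real j * t))) = killed_heat (sqrt (2 * real j)) t 0 * f t" for t
        unfolding killed_heat_mult[OF of_nat_0_le_iff, symmetric] by (simp only: mult_ac)
      then show ?thesis by (subst nn_integral_density) simp_all
    qed
    have e1: "(\<integral>\<^sup>+a. ennreal (exp (- (real j * a))) \<partial>density lborel (\<lambda>t. killed_heat 0 t 0 * occupation_laplace k t 0))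
      = ennreal (2 / (sqrt (2 * real j) + sqrt (2 * real j + 2 * k)))" if "1 \<le> j" for j :: nat
      using that k double_laplace[of "sqrt (2 * real j)" k 0] by (subst eq) auto
    have e2: "(\<integral>\<^sup>+a. ennreal (exp (- (real j * a))) \<partial>density lborel (\<lambda>t. killed_heat 0 t 0 * ?U k t))
      = ennreal (2 / (sqrt (2 * real j) + sqrt (2 * real j + 2 * k)))" if "1 \<le> j" for j :: nat
      using that k uniform_laplace[of "real j" k] by (subst eq) (auto intro!: lborel.borel_measurable_nn_integral)
    show "density lborel (\<lambda>t. killed_heat 0 t 0 * occupation_laplace k t 0) = density lborel (\<lambda>t. killed_heat 0 t 0 * ?U k t)"
    proof (rule laplace_unique)
      show "(\<integral>\<^sup>+a. ennreal (exp (- a)) \<partial>density lborel (\<lambda>t. killed_heat 0 t 0 * occupation_laplace k t 0)) \<noteq> \<infinity>"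
        using e1[of 1] by simp
      show "AE a in density lborel (\<lambda>t. killed_heat 0 t 0 * occupation_laplace k t 0). 0 \<le> a"
        by (subst AE_density, measurable) (auto simp: killed_heat_0 indicator_def)
      show "AE a in density lborel (\<lambda>t. killed_heat 0 t 0 * ?U k t). 0 \<le> a"
        by (subst AE_density, measurable) (auto simp: killed_heat_0 indicator_def)
    qed (simp_all only: e1 e2 sets_density sets_lborel)
  qed measurable
  then have "AE t in lborel. \<forall>k::nat. killed_heat 0 t 0 * occupation_laplace (real (Suc k)) t 0 = killed_heat 0 t 0 * ?U (real (Suc k)) t"
    by (subst AE_all_countable) auto
  then show ?thesis
  proof eventually_elim
    case (elim t)
    show ?case
    proof
      assume t: "0 < t"
      have kh: "killed_heat 0 t 0 \<noteq> 0" "killed_heat 0 t 0 \<noteq> \<infinity>"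
        using t by (auto simp: killed_heat_0 normal_density_def)
      have eq: "occupation_laplace (real k) t 0 = ?U (real k) t" if "1 \<le> k" for k :: nat
      proof -
        have "k = Suc (k - 1)" using that by simp
        then have "killed_heat 0 t 0 * occupation_laplace (real k) t 0 = killed_heat 0 t 0 * ?U (real k) t"
          using elim by metis
        then show ?thesis using kh by (simp add: ennreal_mult_cancel_left)
      qed
      define m where "m = distr wiener borel (\<lambda>w. time_below t (bridge_path t 0 w))"
      \<comment> \<open>The uniform law on [0, t], as an image of the one on [0, 1].\<close>
      define m' where "m' = distr (density lborel (indicator {0..1::real} :: real \<Rightarrow> ennreal)) borel (\<lambda>v. t * v)"
      have L1: "(\<integral>\<^sup>+a. ennreal (exp (- (c * a))) \<partial>m) = occupation_laplace c t 0" for c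
        unfolding m_def occupation_laplace_def by (subst nn_integral_distr) measurable
      have L2: "(\<integral>\<^sup>+a. ennreal (exp (- (c * a))) \<partial>m') = ?U c t" for c
        unfolding m'_def by (subst nn_integral_distr, measurable, subst nn_integral_density) (auto simp: mult.commute)
      have "m = m'"
      proof (rule laplace_unique)
        have "(\<integral>\<^sup>+a. ennreal (exp (- a)) \<partial>m) \<le> (\<integral>\<^sup>+w. 1 \<partial>wiener)"
          unfolding m_def using time_below_nonneg
          by (subst nn_integral_distr, measurable) (intro nn_integral_mono, auto)
        also have "\<dots> = 1" by (simp add: emeasure_space_1)
        finally show "(\<integral>\<^sup>+a. ennreal (exp (- a)) \<partial>m) \<noteq> \<infinity>" by (auto simp: top_unique)
        show "AE a in m. 0 \<le> a"
          unfolding m_def by (subst AE_distr_iff) (auto simp: time_below_nonneg)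
        show "AE a in m'. 0 \<le> a"
          unfolding m'_def using t by (subst AE_distr_iff, measurable, subst AE_density) (auto simp: indicator_def zero_le_mult_iff)
        show "(\<integral>\<^sup>+a. ennreal (exp (- (real k * a))) \<partial>m) = (\<integral>\<^sup>+a. ennreal (exp (- (real k * a))) \<partial>m')" if "1 \<le> k" for k :: nat
          unfolding L1 L2 by (rule eq[OF that])
      qed (simp_all add: m_def m'_def)
      have "bridge_cdf 0 t 1 = emeasure m {..1}"
        unfolding m_def bridge_cdf_def by (subst emeasure_distr) (auto intro!: arg_cong2[where f=emeasure])
      also have "\<dots> = emeasure m' {..1}" by (simp only: \<open>m = m'\<close>)
      also have "\<dots> = (\<integral>\<^sup>+a. indicator {..1} a \<partial>m')"
        by (simp add: m'_def)
      also have "\<dots> = (\<integral>\<^sup>+v. indicator {0..1} v * indicator {..1} (t * v) \<partial>lborel)"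
        unfolding m'_def by (subst nn_integral_distr, measurable, subst nn_integral_density) measurable
      also have "\<dots> = (\<integral>\<^sup>+v. indicator {0..min 1 (1 / t)} v \<partial>lborel)"
        using t by (intro nn_integral_cong) (auto simp: indicator_def field_simps)
      also have "\<dots> = ennreal (min 1 (1 / t))" using t by simp
      finally show "bridge_cdf 0 t 1 = ennreal (min 1 (1 / t))" .
    qed
  qed
qed

end

section \<open>Conditioned bridges and the law of g\<close>

lemma measurable_time_below_stretch:
  "(\<lambda>z. time_below (fst z) (stretch y (fst z) (snd z))) \<in> borel_measurable (borel \<Otimes>\<^sub>M path_space {0..1})"
proof -
  have eval: "(\<lambda>(s, w). w (max 0 (min 1 s))) \<in> borel_measurable (borel \<Otimes>\<^sub>M path_space {0..1})"
    by (intro measurable_path_space_eval_pair continuous_intros) auto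
  have [measurable]: "(\<lambda>z. snd (fst z) (max 0 (min 1 (snd z / fst (fst z))))) \<in> borel_measurable ((borel \<Otimes>\<^sub>M path_space {0..1}) \<Otimes>\<^sub>M borel)"
    using measurable_compose[OF measurable_Pair[where f="\<lambda>z. snd z / fst (fst z)" and g="\<lambda>z. snd (fst z)"] eval]
    by simp
  have "(\<lambda>z. time_below (fst z) (stretch y (fst z) (\<lambda>r. snd z (max 0 (min 1 r))))) \<in> borel_measurable (borel \<Otimes>\<^sub>M path_space {0..1})"
    unfolding stretch_def by (rule borel_measurable_time_below) measurable
  also have "(\<lambda>z. time_below (fst z) (stretch y (fst z) (\<lambda>r. snd z (max 0 (min 1 r)))))
    = (\<lambda>z. time_below (fst z) (stretch y (fst z) (snd z)))"
  proof (intro ext time_below_cong)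
    fix z :: "real \<times> (real \<Rightarrow> real)" and s assume "0 \<le> s" "s \<le> fst z"
    then have "0 \<le> s / fst z" "s / fst z \<le> 1" by (auto simp: divide_le_eq_1)
    then show "stretch y (fst z) (\<lambda>r. snd z (max 0 (min 1 r))) s = stretch y (fst z) (snd z) s"
      by (simp add: stretch_def)
  qed
  finally show ?thesis .
qed

text \<open>\<open>has_conditional_law\<close> speaks of rectangles, but the occupation event
  couples g with the path. The joint law is therefore identified with a density on the product of
  the law of g and \<beta>, using that rectangles generate the product sigma-algebra and are stable
  under intersection.\<close>

lemma conditional_law_uniform:
  fixes g :: "'a \<Rightarrow> real" and \<beta> :: "(real \<Rightarrow> real) measure"
  assumes M: "prob_space M" and [measurable]: "g \<in> borel_measurable M" and b: "continuous_process M I b"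
    and \<beta>: "prob_space \<beta>" and s\<beta>: "sets \<beta> = sets (path_space I)"
    and E: "E \<in> sets (borel \<Otimes>\<^sub>M path_space I)"
    and cl: "has_conditional_law M I b g (\<lambda>x. uniform_measure \<beta> (Pair x -` E))"
    and B: "B \<in> sets (borel \<Otimes>\<^sub>M path_space I)"
  shows "emeasure M {\<omega>\<in>space M. (g \<omega>, sample_path I b \<omega>) \<in> B} =
    (\<integral>\<^sup>+x. emeasure \<beta> (Pair x -` E \<inter> Pair x -` B) / emeasure \<beta> (Pair x -` E) \<partial>distr M borel g)"
proof -
  interpret M: prob_space M by fact
  interpret \<beta>: prob_space \<beta> by fact
  define \<gamma> where "\<gamma> = distr M borel g"
  interpret \<gamma>: prob_space \<gamma> unfolding \<gamma>_def by (rule M.prob_space_distr) simp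
  interpret P: pair_prob_space \<gamma> \<beta> ..
  have sp: "sets (\<gamma> \<Otimes>\<^sub>M \<beta>) = sets (borel \<Otimes>\<^sub>M path_space I)"
    by (intro sets_pair_measure_cong) (simp_all add: \<gamma>_def s\<beta>)
  have [measurable]: "sample_path I b \<in> M \<rightarrow>\<^sub>M path_space I" by (rule measurable_sample_path[OF b])
  have E' [measurable]: "E \<in> sets (\<gamma> \<Otimes>\<^sub>M \<beta>)" using E sp by simp
  have sl: "Pair (x :: real) -` C \<in> sets \<beta>" if "C \<in> sets (borel \<Otimes>\<^sub>M path_space I)" for x C
  proof -
    have "C \<in> sets (\<gamma> \<Otimes>\<^sub>M \<beta>)" using that sp by simp
    then show ?thesis by (rule sets_Pair1)
  qed
  have [measurable]: "(\<lambda>x. emeasure \<beta> (Pair x -` E)) \<in> borel_measurable \<gamma>"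
    by (rule \<beta>.measurable_emeasure_Pair) fact
  \<comment> \<open>Conditioning \<beta> on every fibre of E amounts to this density on the product.
    For a null fibre the quotient below is 0 / 0, which is 0 in \<open>ennreal\<close>.\<close>
  define \<nu> where "\<nu> = density (\<gamma> \<Otimes>\<^sub>M \<beta>) (\<lambda>z. indicator E z / emeasure \<beta> (Pair (fst z) -` E))"
  have s\<nu>: "sets \<nu> = sets (borel \<Otimes>\<^sub>M path_space I)" by (simp add: \<nu>_def sp)
  have \<nu>: "emeasure \<nu> C = (\<integral>\<^sup>+x. emeasure \<beta> (Pair x -` E \<inter> Pair x -` C) / emeasure \<beta> (Pair x -` E) \<partial>\<gamma>)"
    if C: "C \<in> sets (borel \<Otimes>\<^sub>M path_space I)" for C
  proof -
    have [measurable]: "C \<in> sets (\<gamma> \<Otimes>\<^sub>M \<beta>)" using C sp by simp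
    have "emeasure \<nu> C = (\<integral>\<^sup>+z. indicator E z / emeasure \<beta> (Pair (fst z) -` E) * indicator C z \<partial>(\<gamma> \<Otimes>\<^sub>M \<beta>))"
      unfolding \<nu>_def by (rule emeasure_density) measurable
    also have "\<dots> = (\<integral>\<^sup>+x. \<integral>\<^sup>+v. indicator E (x, v) / emeasure \<beta> (Pair x -` E) * indicator C (x, v) \<partial>\<beta> \<partial>\<gamma>)"
      by (subst \<beta>.nn_integral_fst[symmetric]) simp_all
    also have "\<dots> = (\<integral>\<^sup>+x. emeasure \<beta> (Pair x -` E \<inter> Pair x -` C) / emeasure \<beta> (Pair x -` E) \<partial>\<gamma>)"
    proof (intro nn_integral_cong)
      fix x
      have "(\<integral>\<^sup>+v. indicator E (x, v) / emeasure \<beta> (Pair x -` E) * indicator C (x, v) \<partial>\<beta>)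
        = (\<integral>\<^sup>+v. indicator (Pair x -` E \<inter> Pair x -` C) v / emeasure \<beta> (Pair x -` E) \<partial>\<beta>)"
        by (intro nn_integral_cong) (auto simp: indicator_def)
      also have "\<dots> = (\<integral>\<^sup>+v. indicator (Pair x -` E \<inter> Pair x -` C) v \<partial>\<beta>) / emeasure \<beta> (Pair x -` E)"
        using sl[OF E] sl[OF C] by (intro nn_integral_divide borel_measurable_indicator sets.Int)
      finally show "(\<integral>\<^sup>+v. indicator E (x, v) / emeasure \<beta> (Pair x -` E) * indicator C (x, v) \<partial>\<beta>)
        = emeasure \<beta> (Pair x -` E \<inter> Pair x -` C) / emeasure \<beta> (Pair x -` E)"
        using sets.Int[OF sl[OF E] sl[OF C], of x x] by simp
    qed
    finally show ?thesis .
  qed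
  define \<mu> where "\<mu> = distr M (borel \<Otimes>\<^sub>M path_space I) (\<lambda>\<omega>. (g \<omega>, sample_path I b \<omega>))"
  interpret \<mu>: prob_space \<mu> unfolding \<mu>_def by (rule M.prob_space_distr) simp
  have \<mu>: "emeasure \<mu> C = emeasure M {\<omega>\<in>space M. (g \<omega>, sample_path I b \<omega>) \<in> C}"
    if "C \<in> sets (borel \<Otimes>\<^sub>M path_space I)" for C
    using that unfolding \<mu>_def by (subst emeasure_distr) (auto intro!: arg_cong2[where f=emeasure])
  have "\<mu> = \<nu>"
  proof (rule measure_eqI_generator_eq[OF Int_stable_pair_measure_generator[of borel "path_space I"]])
    let ?G = "{A \<times> C |A C. A \<in> sets borel \<and> C \<in> sets (path_space I)} :: (real \<times> (real \<Rightarrow> real)) set set"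
    let ?\<Omega> = "space borel \<times> space (path_space I)"
    show "?G \<subseteq> Pow ?\<Omega>" by (auto dest: sets.sets_into_space)
    show "sets \<mu> = sigma_sets ?\<Omega> ?G" "sets \<nu> = sigma_sets ?\<Omega> ?G"
      unfolding s\<nu> by (simp_all add: \<mu>_def sets_pair_measure)
    fix R assume "R \<in> ?G"
    then obtain A C where R: "R = A \<times> C" and A: "A \<in> sets borel" and C: "C \<in> sets (path_space I)" by auto
    have RS: "R \<in> sets (borel \<Otimes>\<^sub>M path_space I)" using A C R by simp
    have "emeasure \<mu> R = emeasure M {\<omega> \<in> space M. g \<omega> \<in> A \<and> sample_path I b \<omega> \<in> C}"
      by (subst \<mu>[OF RS]) (auto simp: R intro!: arg_cong2[where f=emeasure])
    also have "\<dots> = (\<integral>\<^sup>+x. emeasure (uniform_measure \<beta> (Pair x -` E)) C * indicator A x \<partial>\<gamma>)"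
      using cl A C unfolding has_conditional_law_def \<gamma>_def by blast
    also have "\<dots> = (\<integral>\<^sup>+x. emeasure \<beta> (Pair x -` E \<inter> Pair x -` R) / emeasure \<beta> (Pair x -` E) \<partial>\<gamma>)"
    proof (intro nn_integral_cong)
      fix x
      show "emeasure (uniform_measure \<beta> (Pair x -` E)) C * indicator A x =
        emeasure \<beta> (Pair x -` E \<inter> Pair x -` R) / emeasure \<beta> (Pair x -` E)"
        using sl[OF E, of x] C s\<beta> by (cases "x \<in> A") (auto simp: R emeasure_uniform_measure)
    qed
    also have "\<dots> = emeasure \<nu> R" by (rule \<nu>[OF RS, symmetric])
    finally show "emeasure \<mu> R = emeasure \<nu> R" .
  next
    show "range (\<lambda>_::nat. space borel \<times> space (path_space I)) \<subseteq> {A \<times> C |A C. A \<in> sets borel \<and> C \<in> sets (path_space I)}"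
      using sets.top[of borel] sets.top[of "path_space I"] by fast
    show "(\<Union>i::nat. space borel \<times> space (path_space I)) = space borel \<times> space (path_space I)" by simp
    show "emeasure \<mu> (space borel \<times> space (path_space I)) \<noteq> \<infinity>" by simp
  qed
  then show ?thesis using \<mu>[OF B] \<nu>[OF B] by (simp add: \<gamma>_def)
qed

context wiener_measure
begin

lemma continuous_process_bridge_path:
  assumes "0 < t"
  shows "continuous_process wiener {0..t} (\<lambda>s w. bridge_path t y w s)"
  using gauss_bridge_path[OF assms, of y] unfolding gauss_process_def by blast

lemma sets_bridge_law: "0 \<le> t \<Longrightarrow> sets (bridge_law t y 0) = sets (path_space {0..t})"
  by (simp add: bridge_law_def path_law_def)

lemma prob_space_bridge_law:
  assumes "0 < t"
  shows "prob_space (bridge_law t y 0)"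
proof -
  have "0 \<le> t" using assms by simp
  show ?thesis
    unfolding bridge_law_eq[OF \<open>0 \<le> t\<close>] path_law_def
    by (intro prob_space_distr measurable_sample_path continuous_process_bridge_path assms)
qed

lemma emeasure_bridge_law:
  assumes t: "0 < t" and A: "A \<in> sets (path_space {0..t})"
  shows "emeasure (bridge_law t y 0) A = emeasure wiener {w \<in> space wiener. (\<lambda>s\<in>{0..t}. bridge_path t y w s) \<in> A}"
proof -
  have "0 \<le> t" using assms by simp
  show ?thesis
    unfolding bridge_law_eq[OF \<open>0 \<le> t\<close>] path_law_def
    by (subst emeasure_distr[OF measurable_sample_path[OF continuous_process_bridge_path[OF t]] A])
      (auto simp: sample_path_def intro!: arg_cong2[where f=emeasure])
qed

lemma space_bridge_law: "0 \<le> t \<Longrightarrow> space (bridge_law t y 0) = space (path_space {0..t})"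
  using sets_eq_imp_space_eq[OF sets_bridge_law] .

lemma bridge_law_time_below:
  assumes t: "0 < t"
  shows "emeasure (bridge_law t y 0) {w \<in> space (bridge_law t y 0). time_below t w \<le> u} = bridge_cdf y t u"
proof -
  have S: "{w \<in> space (path_space {0..t}). time_below t w \<le> u} \<in> sets (path_space {0..t})" by measurable
  have sp: "(\<lambda>s\<in>{0..t}. bridge_path t y w s) \<in> space (path_space {0..t})" if "w \<in> space wiener" for w
    using measurable_space[OF measurable_sample_path[OF continuous_process_bridge_path[OF t]] that, of y]
    by (simp add: sample_path_def)
  have tb: "time_below t (\<lambda>s\<in>{0..t}. bridge_path t y w s) = time_below t (bridge_path t y w)" for w
    by (rule time_below_cong) simp
  show ?thesis
    using t sp unfolding bridge_cdf_def
    by (simp add: space_bridge_law emeasure_bridge_law[OF t S] tb cong: conj_cong)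
qed

lemma bridge_q_eq: "0 < t \<Longrightarrow> bridge_q y t u = enn2real (bridge_cdf y t u)"
  unfolding bridge_q_def measure_def by (simp add: bridge_law_time_below)

text \<open>By the scaling in \<open>stretch_bridge_law\<close>. For u = 1 it is the probability by
  which \<open>conditioned_bridge_law\<close> divides, and the same factor sits in the density of
  g.\<close>

lemma stretch_time_below:
  assumes x: "0 < x"
  shows "emeasure (bridge_law 1 0 0) {v \<in> space (bridge_law 1 0 0). time_below x (stretch y x v) \<le> u} = bridge_cdf y x u"
proof -
  have "(\<lambda>v. time_below x (stretch y x v)) \<in> borel_measurable (path_space {0..1})"
  proof -
    have "(\<lambda>v. (x, v)) \<in> path_space {0..1} \<rightarrow>\<^sub>M borel \<Otimes>\<^sub>M path_space {0..1}" by measurable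
    from measurable_compose[OF this measurable_time_below_stretch, of y] show ?thesis by simp
  qed
  then have S1: "{v \<in> space (path_space {0..1}). time_below x (stretch y x v) \<le> u} \<in> sets (path_space {0..1})" by measurable
  have Sx: "{w \<in> space (path_space {0..x}). time_below x w \<le> u} \<in> sets (path_space {0..x})" by measurable
  have sp: "(\<lambda>s\<in>{0..1}. bridge_path 1 0 w s) \<in> space (path_space {0..1})" if "w \<in> space wiener" for w
    using measurable_space[OF measurable_sample_path[OF continuous_process_bridge_path[OF zero_less_one]] that, of 0]
    by (simp add: sample_path_def)
  have cp: "continuous_process wiener {0..x} (\<lambda>s w. stretch y x (bridge_path 1 0 w) s)"
    unfolding continuous_process_def
  proof (intro conjI ballI)
    fix s show "(\<lambda>w. stretch y x (bridge_path 1 0 w) s) \<in> borel_measurable wiener"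
      unfolding stretch_def by measurable
  next
    fix w assume "w \<in> space wiener"
    from continuous_bridge_path[OF zero_less_one this, of 0]
    have "continuous_on {0..x} (\<lambda>s. bridge_path 1 0 w (s / x))"
      by (rule continuous_on_compose2) (use x in \<open>auto intro!: continuous_intros\<close>)
    then show "continuous_on {0..x} (stretch y x (bridge_path 1 0 w))"
      unfolding stretch_def using x by (intro continuous_intros) auto
  qed
  have sx: "(\<lambda>s\<in>{0..x}. stretch y x (bridge_path 1 0 w) s) \<in> space (path_space {0..x})" if "w \<in> space wiener" for w
    using measurable_space[OF measurable_sample_path[OF cp] that] by (simp add: sample_path_def)
  have tb: "time_below x (stretch y x (\<lambda>s\<in>{0..1}. bridge_path 1 0 w s)) = time_below x (stretch y x (bridge_path 1 0 w))" for w
    using x by (intro time_below_cong) (simp add: stretch_def)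
  have tb': "time_below x (\<lambda>s\<in>{0..x}. stretch y x (bridge_path 1 0 w) s) = time_below x (stretch y x (bridge_path 1 0 w))" for w
    by (rule time_below_cong) simp
  have "emeasure (bridge_law 1 0 0) {v \<in> space (bridge_law 1 0 0). time_below x (stretch y x v) \<le> u}
    = emeasure wiener {w \<in> space wiener. time_below x (stretch y x (bridge_path 1 0 w)) \<le> u}"
    using sp by (simp add: space_bridge_law emeasure_bridge_law[OF zero_less_one S1] tb cong: conj_cong)
  also have "\<dots> = emeasure (path_law wiener {0..x} (\<lambda>s w. stretch y x (bridge_path 1 0 w) s)) {w \<in> space (path_space {0..x}). time_below x w \<le> u}"
    unfolding path_law_def using sx
    by (subst emeasure_distr[OF measurable_sample_path[OF cp] Sx])
      (auto simp: sample_path_def tb' intro!: arg_cong2[where f=emeasure])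
  also have "\<dots> = bridge_cdf y x u"
    using bridge_law_time_below[OF x, of y u] x by (simp add: stretch_bridge_law space_bridge_law)
  finally show ?thesis .
qed

lemma measurable_bridge_cdf [measurable]: "(\<lambda>t. bridge_cdf y t u) \<in> borel_measurable borel"
proof -
  have "bridge_cdf y t u = (\<integral>\<^sup>+w. indicator {..u} (time_below t (bridge_path t y w)) \<partial>wiener)" for t
  proof -
    have "bridge_cdf y t u = (\<integral>\<^sup>+w. indicator {w \<in> space wiener. time_below t (bridge_path t y w) \<le> u} w \<partial>wiener)"
      unfolding bridge_cdf_def by (rule nn_integral_indicator[symmetric]) measurable
    also have "\<dots> = (\<integral>\<^sup>+w. indicator {..u} (time_below t (bridge_path t y w)) \<partial>wiener)"
      by (intro nn_integral_cong) (auto simp: indicator_def)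
    finally show ?thesis .
  qed
  then show ?thesis by simp
qed

lemma bridge_cdf_le_1: "bridge_cdf y t u \<le> 1"
  unfolding bridge_cdf_def by (rule emeasure_le_1)

lemma bridge_cdf_mono: "u \<le> v \<Longrightarrow> bridge_cdf y t u \<le> bridge_cdf y t v"
  unfolding bridge_cdf_def by (intro emeasure_mono) (auto, measurable)

end

section \<open>The weight as a multiple of the heat kernel\<close>

lemma killed_heat_weight: "ennreal (sqrt (2 * pi)) * killed_heat 0 t y = ennreal (weight y t) * indicator {0<..} t"
  by (simp add: killed_heat_0 indicator_def ennreal_mult'[symmetric] weight_def normal_density_def real_sqrt_mult field_simps)

lemma weight_nonneg: "0 \<le> t \<Longrightarrow> 0 \<le> weight y t"
  by (simp add: weight_def)

lemma measurable_weight [measurable]: "weight y \<in> borel_measurable borel"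
  unfolding weight_def by measurable

text \<open>Up to time x, killing at rate 1 costs at most a factor exp x, and the killed kernel has
  a finite time integral.\<close>

lemma killed_heat_0_finite: "(\<integral>\<^sup>+t. killed_heat 0 t y * indicator {..x} t \<partial>lborel) < \<infinity>"
proof -
  have "(\<integral>\<^sup>+t. killed_heat 0 t y * indicator {..x} t \<partial>lborel) \<le> (\<integral>\<^sup>+t. ennreal (exp x) * killed_heat (sqrt 2) t y \<partial>lborel)"
  proof (intro nn_integral_mono)
    fix t
    show "killed_heat 0 t y * indicator {..x} t \<le> ennreal (exp x) * killed_heat (sqrt 2) t y"
    proof (cases "t \<le> x")
      case True
      then have "1 \<le> ennreal (exp x) * ennreal (exp (- t))"
        by (simp add: ennreal_mult[symmetric] exp_add[symmetric])
      then have "killed_heat 0 t y * 1 \<le> killed_heat 0 t y * (ennreal (exp x) * ennreal (exp (- t)))"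
        by (rule mult_left_mono) simp
      also have "\<dots> = ennreal (exp x) * killed_heat (sqrt 2) t y"
        using killed_heat_mult[of 1 t y] by (simp add: mult_ac)
      finally show ?thesis using True by simp
    qed simp
  qed
  also have "\<dots> < \<infinity>" by (simp add: nn_integral_cmult nn_integral_killed_heat ennreal_mult_less_top)
  finally show ?thesis .
qed

text \<open>The passage from the real integrals in \<open>g_cdf\<close> to \<open>ennreal\<close>.
  Finiteness matters here, since a non-integrable function would have Bochner integral 0.\<close>

lemma nn_integral_weight:
  assumes [measurable]: "q \<in> borel_measurable borel" and q: "\<And>t. 0 \<le> q t" "\<And>t. q t \<le> 1"
  shows "ennreal (LBINT t:{0..x}. q t * weight y t) =
    ennreal (sqrt (2 * pi)) * (\<integral>\<^sup>+t. killed_heat 0 t y * ennreal (q t) * indicator {..x} t \<partial>lborel)"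
proof -
  let ?I = "\<integral>\<^sup>+t. killed_heat 0 t y * ennreal (q t) * indicator {..x} t \<partial>lborel"
  have "?I \<le> (\<integral>\<^sup>+t. killed_heat 0 t y * indicator {..x} t \<partial>lborel)"
    using q by (intro nn_integral_mono mult_right_mono mult_left_le) (auto simp: ennreal_le_1)
  then have fin: "?I < \<infinity>" using killed_heat_0_finite[of y x] by (rule order_le_less_trans)
  have "ennreal (sqrt (2 * pi)) * ?I = (\<integral>\<^sup>+t. ennreal (sqrt (2 * pi)) * (killed_heat 0 t y * ennreal (q t) * indicator {..x} t) \<partial>lborel)"
    by (rule nn_integral_cmult[symmetric]) measurable
  also have "\<dots> = (\<integral>\<^sup>+t. ennreal (indicator {0..x} t *\<^sub>R (q t * weight y t)) \<partial>lborel)"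
    using AE_lborel_singleton[of "0::real"]
  proof (intro nn_integral_cong_AE, eventually_elim)
    case (elim t)
    have "ennreal (sqrt (2 * pi)) * (killed_heat 0 t y * ennreal (q t) * indicator {..x} t)
      = (ennreal (sqrt (2 * pi)) * killed_heat 0 t y) * ennreal (q t) * indicator {..x} t" by (simp add: mult_ac)
    also have "\<dots> = ennreal (indicator {0..x} t *\<^sub>R (q t * weight y t))"
      unfolding killed_heat_weight using elim q weight_nonneg[of t y]
      by (auto simp: indicator_def ennreal_mult[symmetric] mult.commute)
    finally show ?case .
  qed
  finally have eq: "ennreal (sqrt (2 * pi)) * ?I = (\<integral>\<^sup>+t. ennreal (indicator {0..x} t *\<^sub>R (q t * weight y t)) \<partial>lborel)" .
  have "(\<integral>\<^sup>+t. ennreal (indicator {0..x} t *\<^sub>R (q t * weight y t)) \<partial>lborel) < \<infinity>"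
    unfolding eq[symmetric] using fin by (simp add: ennreal_mult_less_top)
  moreover have "(LBINT t:{0..x}. q t * weight y t) = enn2real (\<integral>\<^sup>+t. ennreal (indicator {0..x} t *\<^sub>R (q t * weight y t)) \<partial>lborel)"
    unfolding set_lebesgue_integral_def
    by (rule integral_eq_nn_integral) (use q weight_nonneg in \<open>auto simp: indicator_def\<close>)
  ultimately show ?thesis unfolding eq by simp
qed

lemma integral_weight_0:
  assumes "0 \<le> u"
  shows "(LBINT t:{0..u}. weight 0 t) = 2 * sqrt u"
proof (cases "u = 0")
  case False
  with assms have u: "0 < u" by simp
  \<comment> \<open>The weight is singular at 0, so the fundamental theorem is applied on the open
    interval, with one-sided limits at its ends.\<close>
  define F where "F t = 2 * sqrt t" for t :: real
  have "ereal 0 < ereal u"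
    and "\<And>t. ereal 0 < ereal t \<Longrightarrow> ereal t < ereal u \<Longrightarrow> DERIV F t :> weight 0 t"
    and "\<And>t. ereal 0 < ereal t \<Longrightarrow> ereal t < ereal u \<Longrightarrow> isCont (weight 0) t"
    and "AE t in lborel. ereal 0 < ereal t \<longrightarrow> ereal t < ereal u \<longrightarrow> 0 \<le> weight 0 t"
    unfolding F_def weight_def
    using u by (auto intro!: derivative_eq_intros continuous_intros simp: divide_simps)
  moreover have "(F \<longlongrightarrow> F 0) (at_right 0)" "(F \<longlongrightarrow> F u) (at_left u)"
    unfolding F_def by (auto intro!: tendsto_eq_intros)
  then have "((F \<circ> real_of_ereal) \<longlongrightarrow> F 0) (at_right (ereal 0))" "((F \<circ> real_of_ereal) \<longlongrightarrow> F u) (at_left (ereal u))"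
    by (simp_all add: ereal_tendsto_simps)
  ultimately have "(LBINT t=ereal 0..ereal u. weight 0 t) = F u - F 0"
    by (rule interval_integral_FTC_nonneg(2))
  then show ?thesis
    using u by (simp add: interval_integral_Icc F_def)
next
  case True
  \<comment> \<open>At t = 0 the weight is 0, because 1 / 0 is 0.\<close>
  have "indicator {0..0} t *\<^sub>R weight 0 t = 0" for t by (simp add: indicator_def weight_def)
  then show ?thesis unfolding True set_lebesgue_integral_def by (simp only: integral_zero real_sqrt_zero mult_zero_right)
qed

section \<open>The process X\<close>

text \<open>Equality of laws transfers events in finitely many coordinates easily, so non-negativity
  is shown for one time at a time, then for the countably many grid times together, and finally for
  all times by continuity.\<close>

lemma bessel3_nonneg:
  assumes M: "prob_space M" and Z: "bessel3 M x Z"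
  shows "AE \<omega> in M. \<forall>t\<ge>0. 0 \<le> Z t \<omega>"
proof -
  have cZ: "continuous_process M {0..} Z" using Z by (simp add: bessel3_def)
  obtain N :: "(real \<Rightarrow> real ^ 3) measure" and v R where R: "brownian_motion3 N v R"
    and law: "path_law M {0..} Z = path_law N {0..} (\<lambda>t \<omega>. norm (R t \<omega>))"
    using Z unfolding bessel3_def by blast
  have comp: "continuous_process N {0..} (\<lambda>t \<omega>. R t \<omega> $ i - v $ i)" for i
    using R by (simp add: brownian_motion3_def brownian_motion_def)
  \<comment> \<open>Almost sure statements pass through an image measure only if the sample path map
    is measurable, here for the norm of the three-dimensional motion.\<close>
  have cR: "continuous_process N {0..} (\<lambda>t \<omega>. norm (R t \<omega>))"
    unfolding continuous_process_def
  proof (intro conjI ballI)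
    fix t :: real assume t: "t \<in> {0..}"
    have "(\<lambda>\<omega>. (R t \<omega> $ i - v $ i) + v $ i) \<in> borel_measurable N" for i
      using comp[of i] t unfolding continuous_process_def by (intro borel_measurable_add) auto
    then have [measurable]: "(\<lambda>\<omega>. R t \<omega> $ i) \<in> borel_measurable N" for i by simp
    show "(\<lambda>\<omega>. norm (R t \<omega>)) \<in> borel_measurable N"
      unfolding norm_vec_def L2_set_def by measurable
  next
    fix \<omega> assume "\<omega> \<in> space N"
    then have "continuous_on {0..} (\<lambda>t. R t \<omega> $ i - v $ i)" for i
      using comp[of i] by (simp add: continuous_process_def)
    from continuous_on_add[OF this continuous_on_const]
    have "continuous_on {0..} (\<lambda>t. (R t \<omega> $ i - v $ i) + v $ i)" for i .
    then have "continuous_on {0..} (\<lambda>t. R t \<omega> $ i)" for i by simp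
    then show "continuous_on {0..} (\<lambda>t. norm (R t \<omega>))"
      unfolding norm_vec_def L2_set_def
      by (intro continuous_on_real_sqrt continuous_on_sum continuous_on_power continuous_on_norm)
  qed
  have pt: "AE \<omega> in M. 0 \<le> Z t \<omega>" if t: "0 \<le> t" for t
  proof -
    have [measurable]: "(\<lambda>w. w t) \<in> borel_measurable (path_space {0..})"
      using t by (intro measurable_path_space_eval) simp
    have S: "{w \<in> space (path_space {0..}). 0 \<le> w t} \<in> sets (path_space {0..})" by measurable
    have "AE w in path_law N {0..} (\<lambda>t \<omega>. norm (R t \<omega>)). 0 \<le> w t"
      unfolding path_law_def using t
      by (subst AE_distr_iff[OF measurable_sample_path[OF cR] S]) (simp add: sample_path_def)
    then have "AE w in path_law M {0..} Z. 0 \<le> w t" by (simp only: law)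
    then show ?thesis
      unfolding path_law_def using t
      by (subst (asm) AE_distr_iff[OF measurable_sample_path[OF cZ] S]) (simp add: sample_path_def)
  qed
  have "AE \<omega> in M. \<forall>i::int. \<forall>n::nat. 0 \<le> i \<longrightarrow> 0 \<le> Z (real_of_int i / real (Suc n)) \<omega>"
    unfolding AE_all_countable using pt by (auto intro!: AE_impI)
  then show ?thesis
    using AE_space
  proof eventually_elim
    case (elim \<omega>)
    show ?case
    proof (intro allI impI)
      fix t :: real assume t: "0 \<le> t"
      have "continuous_on {0..} (\<lambda>t. Z t \<omega>)" using cZ elim(2) by (simp add: continuous_process_def)
      then have "(\<lambda>n. Z (real_of_int \<lfloor>real (Suc n) * t\<rfloor> / real (Suc n)) \<omega>) \<longlonglongrightarrow> Z t \<omega>"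
        by (rule continuous_on_tendsto_compose[OF _ floor_approx_tendsto]) (use t in auto)
      then show "0 \<le> Z t \<omega>"
        by (rule LIMSEQ_le_const) (use elim(1) t in auto)
    qed
  qed
qed

lemma measurable_process_eval:
  fixes r :: "real \<Rightarrow> real"
  assumes W: "continuous_process M I W" and r: "continuous_on UNIV r" "range r \<subseteq> I"
    and f: "f \<in> borel_measurable N" and h: "h \<in> N \<rightarrow>\<^sub>M M"
  shows "(\<lambda>x. W (r (f x)) (h x)) \<in> borel_measurable N"
proof -
  have "(\<lambda>x. (f x, sample_path I W (h x))) \<in> N \<rightarrow>\<^sub>M borel \<Otimes>\<^sub>M path_space I"
    using f measurable_compose[OF h measurable_sample_path[OF W]] by measurable
  from measurable_compose[OF this measurable_path_space_eval_pair[OF r]]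
  have "(\<lambda>x. sample_path I W (h x) (r (f x))) \<in> borel_measurable N" by simp
  moreover have "sample_path I W (h x) (r (f x)) = W (r (f x)) (h x)" for x
    using r(2) by (auto simp: sample_path_def)
  ultimately show ?thesis by simp
qed

lemma measurable_total_time_below:
  assumes [measurable]: "g \<in> borel_measurable M" and b: "continuous_process M {0..1} b"
    and Z: "continuous_process M {0..} Z" and Y: "0 < y \<Longrightarrow> continuous_process M {0..} Y"
  shows "total_time_below (X_process y g b Z Y) \<in> borel_measurable M"
proof -
  let ?c = "\<lambda>s :: real. max 0 (min 1 s)"
  \<comment> \<open>The times are clamped to the index sets of b, Z and Y, where joint measurability
    is available. For \<open>s \<ge> 0\<close> the values are those of
    \<open>X_process\<close>.\<close>
  define X where "X z = of_bool (g (fst z) > 0 \<and> snd z < g (fst z)) *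
      (sqrt (g (fst z)) * b (?c (snd z / g (fst z))) (fst z) + y - snd z / g (fst z) * y) +
    of_bool (g (fst z) > 0 \<and> snd z \<ge> g (fst z)) * Z (max 0 (snd z - g (fst z))) (fst z) +
    of_bool (g (fst z) = 0 \<and> y > 0) * Y (max 0 (snd z)) (fst z)" for z :: "'a \<times> real"
  have mb: "(\<lambda>z. b (?c (snd z / g (fst z))) (fst z)) \<in> borel_measurable (M \<Otimes>\<^sub>M lborel)"
    by (rule measurable_process_eval[OF b]) (auto intro!: continuous_intros)
  have mZ: "(\<lambda>z. Z (max 0 (snd z - g (fst z))) (fst z)) \<in> borel_measurable (M \<Otimes>\<^sub>M lborel)"
    by (rule measurable_process_eval[OF Z]) (auto intro!: continuous_intros)
  have mY: "(\<lambda>z. of_bool (g (fst z) = 0 \<and> y > 0) * Y (max 0 (snd z)) (fst z)) \<in> borel_measurable (M \<Otimes>\<^sub>M lborel)"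
  proof (cases "0 < y")
    case True
    have [measurable]: "(\<lambda>z. Y (max 0 (snd z)) (fst z)) \<in> borel_measurable (M \<Otimes>\<^sub>M lborel)"
      by (rule measurable_process_eval[OF Y[OF True]]) (auto intro!: continuous_intros)
    show ?thesis by measurable
  qed simp
  have i1: "(\<lambda>z. of_bool (g (fst z) > 0 \<and> snd z < g (fst z)) :: real) \<in> borel_measurable (M \<Otimes>\<^sub>M lborel)"
    and i2: "(\<lambda>z. of_bool (g (fst z) > 0 \<and> snd z \<ge> g (fst z)) :: real) \<in> borel_measurable (M \<Otimes>\<^sub>M lborel)"
    and i3: "(\<lambda>z. sqrt (g (fst z))) \<in> borel_measurable (M \<Otimes>\<^sub>M lborel)"
    and i4: "(\<lambda>z. snd z / g (fst z) * y) \<in> borel_measurable (M \<Otimes>\<^sub>M lborel)"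
    by measurable
  have [measurable]: "X \<in> borel_measurable (M \<Otimes>\<^sub>M lborel)"
    unfolding X_def
    by (intro borel_measurable_add[OF borel_measurable_add[OF borel_measurable_times borel_measurable_times] mY]
      borel_measurable_diff[OF borel_measurable_add[OF borel_measurable_times[OF i3 mb] borel_measurable_const] i4] i1 i2 mZ)
  have "(\<lambda>\<omega>. \<integral>\<^sup>+s. of_bool (X (\<omega>, s) < 0) * indicator {0..} s \<partial>lborel) \<in> borel_measurable M"
    by (rule lborel.borel_measurable_nn_integral) measurable
  also have "(\<lambda>\<omega>. \<integral>\<^sup>+s. of_bool (X (\<omega>, s) < 0) * indicator {0..} s \<partial>lborel) = total_time_below (X_process y g b Z Y)"
    unfolding total_time_below_def
  proof (intro ext nn_integral_cong)
    fix \<omega> s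
    have "X (\<omega>, s) = X_process y g b Z Y s \<omega>" if s: "0 \<le> s"
    proof -
      have "?c (s / g \<omega>) = s / g \<omega>" if "0 < g \<omega>" "s < g \<omega>"
      proof -
        have "0 \<le> s / g \<omega>" "s / g \<omega> \<le> 1" using that s by simp_all
        then show ?thesis by simp
      qed
      then show ?thesis using s by (auto simp: X_def X_process_def stretch_def max_absorb2)
    qed
    then show "of_bool (X (\<omega>, s) < 0) * indicator {0..} s = (of_bool (X_process y g b Z Y s \<omega> < 0) * indicator {0..} s :: ennreal)"
      by (cases "0 \<le> s") auto
  qed
  finally show ?thesis .
qed

text \<open>From g on, X is a non-negative Bessel path, and for g = 0 it is Y or constantly 0. What
  remains is the stretched path of b before g.\<close>

lemma total_time_below_eq:
  assumes g: "0 \<le> g \<omega>" and Z: "\<And>t. 0 \<le> t \<Longrightarrow> 0 \<le> Z t \<omega>" and Y: "\<And>t. 0 < y \<Longrightarrow> 0 \<le> t \<Longrightarrow> 0 \<le> Y t \<omega>"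
    and b: "continuous_on {0..1} (\<lambda>t. b t \<omega>)"
  shows "total_time_below (X_process y g b Z Y) \<omega> = ennreal (time_below (g \<omega>) (stretch y (g \<omega>) (sample_path {0..1} b \<omega>)))"
proof (cases "g \<omega> = 0")
  case True
  have "total_time_below (X_process y g b Z Y) \<omega> = (\<integral>\<^sup>+s. 0 \<partial>(lborel :: real measure))"
    unfolding total_time_below_def
    by (intro nn_integral_cong) (auto simp: X_process_def True indicator_def not_less Y)
  moreover have "time_below (g \<omega>) f = 0" for f
    using time_below_nonneg[of 0 f] AE_lborel_singleton[of "0::real"]
    unfolding True time_below_def set_lebesgue_integral_def
    by (intro integral_eq_zero_AE) (auto elim!: eventually_mono)
  ultimately show ?thesis by simp
next
  case False
  with g have g: "0 < g \<omega>" by simp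
  let ?f = "stretch y (g \<omega>) (\<lambda>r. b (max 0 (min 1 r)) \<omega>)"
  have "continuous_on UNIV (\<lambda>r. b (max 0 (min 1 r)) \<omega>)"
    by (rule continuous_on_compose2[OF b]) (auto intro!: continuous_intros)
  then have [measurable]: "(\<lambda>r. b (max 0 (min 1 r)) \<omega>) \<in> borel_measurable borel"
    by (rule borel_measurable_continuous_onI)
  have mf [measurable]: "?f \<in> borel_measurable borel"
    unfolding stretch_def by measurable
  have f_eq: "?f s = stretch y (g \<omega>) (sample_path {0..1} b \<omega>) s" "?f s = stretch y (g \<omega>) (\<lambda>r. b r \<omega>) s"
    if "0 \<le> s" "s \<le> g \<omega>" for s
  proof -
    have "0 \<le> s / g \<omega>" "s / g \<omega> \<le> 1" using that g by simp_all
    then show "?f s = stretch y (g \<omega>) (sample_path {0..1} b \<omega>) s" "?f s = stretch y (g \<omega>) (\<lambda>r. b r \<omega>) s"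
      by (simp_all add: stretch_def sample_path_def)
  qed
  have "total_time_below (X_process y g b Z Y) \<omega> = (\<integral>\<^sup>+s. ennreal (indicator {0..g \<omega>} s *\<^sub>R of_bool (?f s < 0)) \<partial>lborel)"
    unfolding total_time_below_def
    \<comment> \<open>X switches to Z at time g, whereas \<open>time_below\<close> uses the closed
      interval up to g; the single point is null.\<close>
    using AE_lborel_singleton[of "g \<omega>"]
  proof (intro nn_integral_cong_AE, eventually_elim)
    case (elim s)
    show ?case
      using elim g Z[of "s - g \<omega>"] f_eq(2)[of s]
      by (cases "0 \<le> s"; cases "s < g \<omega>") (auto simp: X_process_def indicator_def)
  qed
  also have "\<dots> = ennreal (time_below (g \<omega>) ?f)"
    unfolding time_below_def set_lebesgue_integral_def
  proof (rule nn_integral_eq_integral)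
    show "integrable lborel (\<lambda>s. indicator {0..g \<omega>} s *\<^sub>R (of_bool (?f s < 0) :: real))"
    proof (rule Bochner_Integration.integrable_bound)
      show "integrable lborel (indicator {0..g \<omega>} :: real \<Rightarrow> real)"
        by (rule integrable_real_indicator) (auto simp: emeasure_lborel_Icc_eq)
      show "AE s in lborel. norm (indicator {0..g \<omega>} s *\<^sub>R (of_bool (?f s < 0) :: real)) \<le> norm (indicat_real {0..g \<omega>} s)"
        by (auto simp: indicator_def)
    qed measurable
  qed auto
  also have "time_below (g \<omega>) ?f = time_below (g \<omega>) (stretch y (g \<omega>) (sample_path {0..1} b \<omega>))"
    by (rule time_below_cong) (rule f_eq(1))
  finally show ?thesis .
qed

section \<open>The law of g and its cancellation against the conditioning\<close>

text \<open>The mass of the atom of g at 0 before normalisation. Together with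
  \<open>g_normalizer\<close> it merges the three cases of \<open>g_cdf\<close>: max and min absorb
  the sign of y, and the constant 4 for y > 0 is twice the integral of \<open>weight 0\<close> over
  the unit interval.\<close>

definition atom_mass :: "real \<Rightarrow> real" where
  "atom_mass y = 2 * sqrt (2 * pi) * max y 0"

definition g_normalizer :: "real \<Rightarrow> real" where
  "g_normalizer y = atom_mass y + 2 * (LBINT t:{0..1}. weight (min y 0) t)"

lemma LBINT_weight: "ennreal (LBINT t:{0..x}. weight y t) =
    ennreal (sqrt (2 * pi)) * (\<integral>\<^sup>+t. killed_heat 0 t y * indicator {..x} t \<partial>lborel)"
  using nn_integral_weight[of "\<lambda>_. 1" x y] by simp

lemma LBINT_weight_nonneg: "0 \<le> (LBINT t:{0..x}. weight y t)"
  unfolding set_lebesgue_integral_def by (intro integral_nonneg_AE) (auto simp: indicator_def weight_nonneg)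

lemma g_normalizer_nonneg: "0 \<le> g_normalizer y"
  using LBINT_weight_nonneg by (simp add: g_normalizer_def atom_mass_def)

context wiener_measure
begin

lemma LBINT_bridge_q:
  "(LBINT t:{0..x}. bridge_q y t 1 * weight y t) = (LBINT t:{0..x}. enn2real (bridge_cdf y t 1) * weight y t)"
proof (rule set_lebesgue_integral_cong)
  show "\<forall>t. t \<in> {0..x} \<longrightarrow> bridge_q y t 1 * weight y t = enn2real (bridge_cdf y t 1) * weight y t"
  proof (intro allI impI)
    fix t assume t: "t \<in> {0..x}"
    show "bridge_q y t 1 * weight y t = enn2real (bridge_cdf y t 1) * weight y t"
      \<comment> \<open>\<open>bridge_q_eq\<close> requires t > 0; at t = 0 both sides vanish with
        the weight.\<close>
      using t by (cases "t = 0") (auto simp: bridge_q_eq weight_def)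
  qed
qed simp

lemma enn2real_bridge_cdf: "ennreal (enn2real (bridge_cdf y t u)) = bridge_cdf y t u"
  using bridge_cdf_le_1[of y t u] by (simp add: order_le_less_trans)

lemma LBINT_bridge_q_ennreal:
  "ennreal (LBINT t:{0..x}. bridge_q y t 1 * weight y t) =
    ennreal (sqrt (2 * pi)) * (\<integral>\<^sup>+t. killed_heat 0 t y * bridge_cdf y t 1 * indicator {..x} t \<partial>lborel)"
proof -
  have "enn2real (bridge_cdf y t 1) \<le> 1" for t
    using enn2real_mono[OF bridge_cdf_le_1[of y t 1]] by simp
  then show ?thesis
    unfolding LBINT_bridge_q using nn_integral_weight[of "\<lambda>t. enn2real (bridge_cdf y t 1)" x y]
    by (simp add: enn2real_bridge_cdf)
qed

text \<open>By the uniform law the integrand is, for almost all t, t^(-1/2) up to 1 and t^(-3/2)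
  beyond. Divided by 4 the result is the closed form of \<open>g_cdf\<close> at y = 0, so that this
  case obeys the same formula as the others.\<close>

lemma LBINT_bridge_q_0:
  assumes x: "0 \<le> x"
  shows "(LBINT t:{0..x}. bridge_q 0 t 1 * weight 0 t) = (if x \<le> 1 then 2 * sqrt x else 4 - 2 / sqrt x)"
proof -
  have n: "0 \<le> (LBINT t:{0..x}. bridge_q 0 t 1 * weight 0 t)"
    unfolding set_lebesgue_integral_def
    by (intro integral_nonneg_AE) (auto simp: indicator_def weight_nonneg bridge_q_def)
  have AE: "AE t in lborel. killed_heat 0 t 0 * bridge_cdf 0 t 1 = killed_heat 0 t 0 * ennreal (min 1 (1 / t))"
    using AE_bridge_cdf_0 by eventually_elim (auto simp: killed_heat_0 indicator_def)
  have one: "ennreal (sqrt (2 * pi)) * (\<integral>\<^sup>+t. killed_heat 0 t 0 * indicator {..u} t \<partial>lborel) = ennreal (2 * sqrt u)"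
    if "0 \<le> u" for u
    using LBINT_weight[of u 0] integral_weight_0[OF that] by simp
  have "ennreal (LBINT t:{0..x}. bridge_q 0 t 1 * weight 0 t) = ennreal (if x \<le> 1 then 2 * sqrt x else 4 - 2 / sqrt x)"
  proof (cases "x \<le> 1")
    case True
    have "(\<integral>\<^sup>+t. killed_heat 0 t 0 * bridge_cdf 0 t 1 * indicator {..x} t \<partial>lborel)
       = (\<integral>\<^sup>+t. killed_heat 0 t 0 * indicator {..x} t \<partial>lborel)"
    proof (rule nn_integral_cong_AE)
      show "AE t in lborel. killed_heat 0 t 0 * bridge_cdf 0 t 1 * indicator {..x} t = killed_heat 0 t 0 * indicator {..x} t"
        using AE
      proof eventually_elim
        case (elim t)
        have "killed_heat 0 t 0 * ennreal (min 1 (1 / t)) = killed_heat 0 t 0" if "t \<le> x"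
          using that True by (cases "0 < t") (simp_all add: killed_heat_0 min_absorb1 le_divide_eq)
        then show ?case unfolding elim by (auto simp: indicator_def)
      qed
    qed
    then show ?thesis using True one[OF x] by (simp add: LBINT_bridge_q_ennreal)
  next
    case False
    then have x1: "1 \<le> x" by simp
    have "ennreal (LBINT t:{0..x}. bridge_q 0 t 1 * weight 0 t)
      = ennreal (sqrt (2 * pi)) * (\<integral>\<^sup>+t. killed_heat 0 t 0 * indicator {..1} t
          + killed_heat 0 t 0 * ennreal (1 / t) * indicator {1..x} t \<partial>lborel)"
      unfolding LBINT_bridge_q_ennreal
    proof (intro arg_cong2[where f="(*)"] refl nn_integral_cong_AE)
      show "AE t in lborel. killed_heat 0 t 0 * bridge_cdf 0 t 1 * indicator {..x} t = killed_heat 0 t 0 * indicator {..1} t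
          + killed_heat 0 t 0 * ennreal (1 / t) * indicator {1..x} t"
        using AE AE_lborel_singleton[of "1::real"]
      proof eventually_elim
        case (elim t)
        have "killed_heat 0 t 0 * ennreal (min 1 (1 / t)) = killed_heat 0 t 0" if "t \<le> 1"
          using that by (cases "0 < t") (simp_all add: killed_heat_0 min_absorb1 le_divide_eq)
        moreover have "min 1 (1 / t) = 1 / t" if "1 \<le> t" using that by (simp add: min_absorb2)
        ultimately show ?case
          unfolding elim(1) using elim(2) x1 by (cases "t \<le> 1") (auto simp: indicator_def)
      qed
    qed
    also have "\<dots> = ennreal (sqrt (2 * pi)) * (\<integral>\<^sup>+t. killed_heat 0 t 0 * indicator {..1} t \<partial>lborel)
       + ennreal (sqrt (2 * pi)) * (\<integral>\<^sup>+t. killed_heat 0 t 0 * ennreal (1 / t) * indicator {1..x} t \<partial>lborel)"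
      by (subst nn_integral_add) (auto simp: distrib_left)
    also have "ennreal (sqrt (2 * pi)) * (\<integral>\<^sup>+t. killed_heat 0 t 0 * ennreal (1 / t) * indicator {1..x} t \<partial>lborel)
       = (\<integral>\<^sup>+t. ennreal (1 / sqrt t / t) * indicator {1..x} t \<partial>lborel)"
    proof (subst nn_integral_cmult[symmetric], measurable, rule nn_integral_cong)
      fix t :: real
      have "ennreal (sqrt (2 * pi)) * (killed_heat 0 t 0 * ennreal (1 / t) * indicator {1..x} t)
        = (ennreal (sqrt (2 * pi)) * killed_heat 0 t 0) * ennreal (1 / t) * indicator {1..x} t"
        by (simp add: mult.assoc)
      also have "\<dots> = ennreal (1 / sqrt t / t) * indicator {1..x} t"
        unfolding killed_heat_weight by (cases "1 \<le> t") (auto simp: weight_def ennreal_mult[symmetric] indicator_def)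
      finally show "ennreal (sqrt (2 * pi)) * (killed_heat 0 t 0 * ennreal (1 / t) * indicator {1..x} t)
        = ennreal (1 / sqrt t / t) * indicator {1..x} t" .
    qed
    also have "\<dots> = ennreal (- (2 / sqrt x) - - (2 / sqrt 1))"
    proof (rule nn_integral_FTC_Icc[where F="\<lambda>t. - (2 / sqrt t)"])
      fix t :: real assume "t \<in> {1..x}"
      then have t: "0 < t" by simp
      have "sqrt t * sqrt t = t" using t by simp
      then show "DERIV (\<lambda>t. - (2 / sqrt t)) t :> 1 / sqrt t / t"
        using t by (auto intro!: derivative_eq_intros simp: divide_simps)
      show "0 \<le> 1 / sqrt t / t" using t by simp
    qed (use x1 in auto)
    also note one[OF zero_le_one]
    also have "ennreal (2 * sqrt 1) + ennreal (- (2 / sqrt x) - - (2 / sqrt 1)) = ennreal (4 - 2 / sqrt x)"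
    proof -
      have "2 / sqrt x \<le> 2" using x1 by (simp add: divide_le_eq)
      then show ?thesis by (subst ennreal_plus[symmetric]) auto
    qed
    finally show ?thesis using False by simp
  qed
  moreover have "0 \<le> (if x \<le> 1 then 2 * sqrt x else 4 - 2 / sqrt x)"
  proof (cases "x \<le> 1")
    case False
    then have "2 / sqrt x \<le> 2" by (simp add: divide_le_eq)
    then show ?thesis using False by simp
  qed (use x in simp)
  ultimately show ?thesis using n by (simp only: ennreal_inj)
qed

lemma g_cdf_eq:
  assumes x: "0 \<le> x"
  shows "g_cdf y x = (atom_mass y + (LBINT t:{0..x}. bridge_q y t 1 * weight y t)) / g_normalizer y"
proof -
  consider "y < 0" | "y = 0" | "0 < y" by linarith
  then show ?thesis
  proof cases
    case 2
    have "(LBINT t:{0..1}. weight 0 t) = 2" using integral_weight_0[of 1] by simp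
    then show ?thesis
      using 2 x LBINT_bridge_q_0[OF x] by (simp add: g_cdf_def atom_mass_def g_normalizer_def diff_divide_distrib)
  next
    case 3
    have "(LBINT t:{0..1}. weight 0 t) = 2" using integral_weight_0[of 1] by simp
    then show ?thesis
      using 3 by (simp add: g_cdf_def atom_mass_def g_normalizer_def)
  qed (simp add: g_cdf_def atom_mass_def g_normalizer_def)
qed

text \<open>The distribution function is known from \<open>g_cdf_eq\<close>. Its value at 0 is the
  atom, since negative values are excluded, and the part on the positive half-line is compared with
  its density on the generating half-lines.\<close>

lemma g_law:
  fixes \<gamma> :: "real measure"
  assumes \<gamma>: "real_distribution \<gamma>" and cdf: "\<forall>x\<ge>0. measure \<gamma> {..x} = g_cdf y x"
    and nonneg: "AE x in \<gamma>. 0 \<le> x"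
  shows "0 < g_normalizer y"
    and "emeasure \<gamma> {0} = ennreal (atom_mass y / g_normalizer y)"
    and "density \<gamma> (indicator {0<..}) =
      density lborel (\<lambda>t. ennreal (sqrt (2 * pi) / g_normalizer y) * (killed_heat 0 t y * bridge_cdf y t 1))"
proof -
  interpret \<gamma>: real_distribution \<gamma> by fact
  let ?D = "g_normalizer y"
  show D: "0 < ?D"
  \<comment> \<open>With normaliser 0 the quotient in \<open>g_cdf_eq\<close> would be 0 for all x
    \<ge> 0, although a distribution function tends to 1.\<close>
  proof (rule ccontr)
    assume "\<not> 0 < ?D"
    then have "?D = 0" using g_normalizer_nonneg[of y] by simp
    then have "cdf \<gamma> x = 0" if "0 \<le> x" for x using cdf[rule_format, OF that] g_cdf_eq[OF that, of y] by (simp add: cdf_def)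
    then have "\<forall>\<^sub>F x in at_top. cdf \<gamma> x = 0" by (auto simp: eventually_at_top_linorder)
    then have "(cdf \<gamma> \<longlongrightarrow> 0) at_top" by (rule tendsto_eventually)
    with \<gamma>.cdf_lim_at_top_prob show False
      using tendsto_unique[of at_top "cdf \<gamma>" 0 1] by simp
  qed
  let ?J = "\<lambda>x. \<integral>\<^sup>+t. killed_heat 0 t y * bridge_cdf y t 1 * indicator {..x} t \<partial>lborel"
  let ?k = "\<lambda>t. ennreal (sqrt (2 * pi) / ?D) * (killed_heat 0 t y * bridge_cdf y t 1)"
  have a0: "0 \<le> atom_mass y" by (simp add: atom_mass_def)
  have em: "emeasure \<gamma> {..x} = ennreal (atom_mass y / ?D) + ennreal (sqrt (2 * pi) / ?D) * ?J x" if x: "0 \<le> x" for x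
  proof -
    have n: "0 \<le> (LBINT t:{0..x}. bridge_q y t 1 * weight y t)"
      unfolding set_lebesgue_integral_def
      by (intro integral_nonneg_AE) (auto simp: indicator_def weight_nonneg bridge_q_def)
    have "emeasure \<gamma> {..x} = ennreal (atom_mass y / ?D + (LBINT t:{0..x}. bridge_q y t 1 * weight y t) / ?D)"
      unfolding \<gamma>.emeasure_eq_measure cdf[rule_format, OF x] g_cdf_eq[OF x] by (simp add: add_divide_distrib)
    also have "\<dots> = ennreal (atom_mass y / ?D) + ennreal (1 / ?D) * ennreal (LBINT t:{0..x}. bridge_q y t 1 * weight y t)"
      using a0 n D by (simp add: ennreal_mult[symmetric])
    also have "ennreal (1 / ?D) * ennreal (LBINT t:{0..x}. bridge_q y t 1 * weight y t) = ennreal (sqrt (2 * pi) / ?D) * ?J x"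
      unfolding LBINT_bridge_q_ennreal mult.assoc[symmetric] using D by (simp add: ennreal_mult[symmetric])
    finally show ?thesis .
  qed
  have J0: "?J x = 0" if "x \<le> 0" for x
    using that by (subst nn_integral_0_iff_AE, measurable) (auto simp: killed_heat_0 indicator_def)
  have "emeasure \<gamma> {0} = emeasure \<gamma> {..0}"
    using nonneg by (intro emeasure_eq_AE) (auto elim: eventually_mono)
  also have e0: "emeasure \<gamma> {..0} = ennreal (atom_mass y / ?D)" by (simp add: em J0)
  finally show "emeasure \<gamma> {0} = ennreal (atom_mass y / ?D)" .
  show "density \<gamma> (indicator {0<..}) = density lborel ?k"
  proof (rule measure_eqI_generator_eq)
    show "Int_stable (range (\<lambda>x::real. {..x}))" by (auto simp: Int_stable_def)
    show "range (\<lambda>x::real. {..x}) \<subseteq> Pow UNIV" by simp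
    have "sets (borel :: real measure) = sigma_sets UNIV (range (\<lambda>x. {..x}))"
      unfolding borel_eq_atMost by simp
    then show "sets (density \<gamma> (indicator {0<..})) = sigma_sets UNIV (range (\<lambda>x::real. {..x}))"
      "sets (density lborel ?k) = sigma_sets UNIV (range (\<lambda>x::real. {..x}))" by simp_all
    have eq: "emeasure (density \<gamma> (indicator {0<..})) {..x} = ennreal (sqrt (2 * pi) / ?D) * ?J x" for x
    proof (cases "0 \<le> x")
      case True
      have "emeasure (density \<gamma> (indicator {0<..})) {..x} = (\<integral>\<^sup>+t. indicator {0<..} t * indicator {..x} t \<partial>\<gamma>)"
        by (rule emeasure_density) auto
      also have "\<dots> = (\<integral>\<^sup>+t. indicator ({..x} - {..0}) t \<partial>\<gamma>)"
        by (intro nn_integral_cong) (auto simp: indicator_def)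
      also have "\<dots> = emeasure \<gamma> ({..x} - {..0})" by (rule nn_integral_indicator) simp
      also have "\<dots> = emeasure \<gamma> {..x} - emeasure \<gamma> {..0}"
        using True by (intro emeasure_Diff) auto
      also have "\<dots> = ennreal (sqrt (2 * pi) / ?D) * ?J x"
        unfolding em[OF True] e0 by simp
      finally show ?thesis .
    next
      case False
      have "emeasure (density \<gamma> (indicator {0<..})) {..x} = (\<integral>\<^sup>+t. indicator {0<..} t * indicator {..x} t \<partial>\<gamma>)"
        by (rule emeasure_density) auto
      also have "\<dots> = (\<integral>\<^sup>+t. 0 \<partial>\<gamma>)"
        using False by (intro nn_integral_cong) (auto simp: indicator_def)
      finally show ?thesis using False by (simp add: J0)
    qed
    have eq': "emeasure (density lborel ?k) {..x} = ennreal (sqrt (2 * pi) / ?D) * ?J x" for x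
      by (subst emeasure_density) (auto simp: mult.assoc nn_integral_cmult)
    show "emeasure (density \<gamma> (indicator {0<..})) A = emeasure (density lborel ?k) A" if "A \<in> range (\<lambda>x::real. {..x})" for A
      using that eq eq' by auto
    show "range (\<lambda>n. {..real n}) \<subseteq> range (\<lambda>x::real. {..x})" by auto
    show "(\<Union>n. {..real n}) = UNIV" by (auto simp: real_arch_simple)
    show "emeasure (density \<gamma> (indicator {0<..})) {..real n} \<noteq> \<infinity>" for n
    proof -
      have "emeasure (density \<gamma> (indicator {0<..})) {..real n} = (\<integral>\<^sup>+t. indicator {0<..} t * indicator {..real n} t \<partial>\<gamma>)"
        by (rule emeasure_density) auto
      also have "\<dots> \<le> (\<integral>\<^sup>+t. 1 \<partial>\<gamma>)"
        by (intro nn_integral_mono) (auto simp: indicator_def)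
      also have "\<dots> = 1" using \<gamma>.emeasure_space_1 by simp
      finally show ?thesis by (auto simp: top_unique)
    qed
  qed
qed

text \<open>With \<open>E c\<close> the event of occupation time at most c, the conditional
  probability of \<open>E u\<close> given g = x is the quotient of the unconditioned probabilities
  of \<open>E u\<close> and \<open>E 1\<close>. The denominator cancels against the density of g,
  which leaves the integral in \<open>nn_integral_bridge_cdf\<close>.\<close>

lemma occupation_prob:
  fixes g :: "'a \<Rightarrow> real"
  assumes M: "prob_space M" and [measurable]: "g \<in> borel_measurable M" and g: "\<And>\<omega>. \<omega> \<in> space M \<Longrightarrow> 0 \<le> g \<omega>"
    and cdf: "\<And>x. 0 \<le> x \<Longrightarrow> measure M {\<omega>\<in>space M. g \<omega> \<le> x} = g_cdf y x"
    and b: "continuous_process M {0..1} b"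
    and cl: "has_conditional_law M {0..1} b g (conditioned_bridge_law y)"
    and u: "u \<in> {0..1}"
  shows "measure M {\<omega>\<in>space M. time_below (g \<omega>) (stretch y (g \<omega>) (sample_path {0..1} b \<omega>)) \<le> u}
    = (atom_mass y + 2 * (LBINT t:{0..u}. weight (min y 0) t)) / g_normalizer y"
proof -
  interpret M: prob_space M by fact
  let ?D = "g_normalizer y"
  define \<beta> where "\<beta> = bridge_law 1 0 0"
  interpret \<beta>: prob_space \<beta> unfolding \<beta>_def by (rule prob_space_bridge_law) simp
  have s\<beta>: "sets \<beta> = sets (path_space {0..1})" and sp\<beta>: "space \<beta> = space (path_space {0..1})"
    by (simp_all add: \<beta>_def sets_bridge_law space_bridge_law)
  define \<gamma> where "\<gamma> = distr M borel g"
  have s\<gamma> [measurable_cong]: "sets \<gamma> = sets borel" by (simp add: \<gamma>_def)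
  have rd: "real_distribution \<gamma>"
    unfolding \<gamma>_def by (auto intro!: real_distribution.intro M.prob_space_distr simp: real_distribution_axioms_def)
  have c\<gamma>: "\<forall>x\<ge>0. measure \<gamma> {..x} = g_cdf y x"
    unfolding \<gamma>_def by (auto simp: cdf[symmetric] measure_distr intro!: arg_cong2[where f=measure])
  have n\<gamma>: "AE x in \<gamma>. 0 \<le> x" unfolding \<gamma>_def by (subst AE_distr_iff) (auto simp: g)
  note law = g_law[OF rd c\<gamma> n\<gamma>]
  define E where "E c = {z \<in> space (borel \<Otimes>\<^sub>M path_space {0..1}). time_below (fst z) (stretch y (fst z) (snd z)) \<le> c}" for c
  note [measurable] = measurable_time_below_stretch[of y]
  have E: "E c \<in> sets (borel \<Otimes>\<^sub>M path_space {0..1})" for c unfolding E_def by measurable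
  have slice: "Pair x -` E c = {w \<in> space \<beta>. time_below x (stretch y x w) \<le> c}" for x c
    by (auto simp: E_def space_pair_measure sp\<beta>)
  have K: "conditioned_bridge_law y = (\<lambda>x. uniform_measure \<beta> (Pair x -` E 1))"
    by (simp add: conditioned_bridge_law_def slice fun_eq_iff \<beta>_def)
  let ?h = "\<lambda>x. emeasure \<beta> (Pair x -` E u) / emeasure \<beta> (Pair x -` E 1)"
  have [measurable]: "(\<lambda>x. emeasure \<beta> (Pair x -` E c)) \<in> borel_measurable borel" for c
  proof -
    have "sets ((borel :: real measure) \<Otimes>\<^sub>M \<beta>) = sets (borel \<Otimes>\<^sub>M path_space {0..1})"
      by (intro sets_pair_measure_cong refl s\<beta>)
    then show ?thesis using E[of c] by (intro \<beta>.measurable_emeasure_Pair) simp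
  qed
  have hpos: "?h x = bridge_cdf y x u / bridge_cdf y x 1" if "0 < x" for x
    unfolding slice \<beta>_def stretch_time_below[OF that] ..
  \<comment> \<open>Over x = 0 both events are the whole space, so the atom of g counts in
    full.\<close>
  have h0: "?h 0 = 1"
  proof -
    have "time_below 0 f = 0" for f
      using AE_lborel_singleton[of "0::real"] unfolding time_below_def set_lebesgue_integral_def
      by (intro integral_eq_zero_AE) (auto elim!: eventually_mono)
    then show ?thesis using u unfolding slice by (simp add: \<beta>.emeasure_space_1)
  qed
  have "{\<omega>\<in>space M. time_below (g \<omega>) (stretch y (g \<omega>) (sample_path {0..1} b \<omega>)) \<le> u}
    = {\<omega>\<in>space M. (g \<omega>, sample_path {0..1} b \<omega>) \<in> E u}"
    using measurable_space[OF measurable_sample_path[OF b]] by (auto simp: E_def space_pair_measure)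
  then have "emeasure M {\<omega>\<in>space M. time_below (g \<omega>) (stretch y (g \<omega>) (sample_path {0..1} b \<omega>)) \<le> u}
    = (\<integral>\<^sup>+x. emeasure \<beta> (Pair x -` E 1 \<inter> Pair x -` E u) / emeasure \<beta> (Pair x -` E 1) \<partial>\<gamma>)"
    using conditional_law_uniform[OF M _ b \<beta>.prob_space_axioms s\<beta> E cl[unfolded K] E] by (simp add: \<gamma>_def)
  \<comment> \<open>Since u \<le> 1, the event for u is contained in the conditioning event.\<close>
  also have "\<dots> = (\<integral>\<^sup>+x. ?h x \<partial>\<gamma>)"
    using u by (intro nn_integral_cong arg_cong2[where f="(/)"] arg_cong2[where f=emeasure]) (auto simp: E_def)
  also have "\<dots> = (\<integral>\<^sup>+x. ?h 0 * indicator {0} x + indicator {0<..} x * ?h x \<partial>\<gamma>)"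
    using n\<gamma> by (intro nn_integral_cong_AE, eventually_elim) (auto simp: indicator_def)
  also have "\<dots> = ?h 0 * emeasure \<gamma> {0} + (\<integral>\<^sup>+x. ?h x \<partial>density \<gamma> (indicator {0<..}))"
    by (subst nn_integral_add) (auto simp: nn_integral_density nn_integral_cmult_indicator)
  also have "(\<integral>\<^sup>+x. ?h x \<partial>density \<gamma> (indicator {0<..}))
    = (\<integral>\<^sup>+x. ennreal (sqrt (2 * pi) / ?D) * (killed_heat 0 x y * bridge_cdf y x 1) * ?h x \<partial>lborel)"
    by (subst law(3), rule nn_integral_density) measurable
  also have "\<dots> = (\<integral>\<^sup>+x. ennreal (sqrt (2 * pi) / ?D) * (killed_heat 0 x y * bridge_cdf y x u) \<partial>lborel)"
  proof (rule nn_integral_cong)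
    fix x
    show "ennreal (sqrt (2 * pi) / ?D) * (killed_heat 0 x y * bridge_cdf y x 1) * ?h x
      = ennreal (sqrt (2 * pi) / ?D) * (killed_heat 0 x y * bridge_cdf y x u)"
    proof (cases "0 < x")
      case True
      have le: "bridge_cdf y x u \<le> bridge_cdf y x 1" using u by (intro bridge_cdf_mono) simp
      have "bridge_cdf y x 1 * (bridge_cdf y x u / bridge_cdf y x 1) = bridge_cdf y x u"
      \<comment> \<open>If the denominator is 0, so is the smaller numerator, and both sides
        vanish.\<close>
      proof (cases "bridge_cdf y x 1 = 0")
        case False
        then show ?thesis
          using bridge_cdf_le_1[of y x 1]
          by (auto simp: ennreal_times_divide mult.commute[of "bridge_cdf y x 1"] top_unique intro!: ennreal_mult_divide_eq)
      qed (use le in simp)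
      then show ?thesis unfolding hpos[OF True] by (simp add: mult.assoc)
    qed (simp add: killed_heat_0)
  qed
  also have "\<dots> = ennreal (sqrt (2 * pi) / ?D) * (\<integral>\<^sup>+x. killed_heat 0 x y * bridge_cdf y x u \<partial>lborel)"
    by (rule nn_integral_cmult) measurable
  also have "\<dots> = ennreal (2 / ?D) * (ennreal (sqrt (2 * pi)) * (\<integral>\<^sup>+t. killed_heat 0 t (min y 0) * indicator {..u} t \<partial>lborel))"
  proof -
    have "ennreal (sqrt (2 * pi) / ?D) * 2 = ennreal (2 / ?D) * ennreal (sqrt (2 * pi))"
      using law(1) by (simp add: ennreal_mult[symmetric] flip: ennreal_numeral)
    moreover have "(\<integral>\<^sup>+t. 2 * killed_heat 0 t (min y 0) * indicator {..u} t \<partial>lborel) = 2 * (\<integral>\<^sup>+t. killed_heat 0 t (min y 0) * indicator {..u} t \<partial>lborel)"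
      by (simp add: nn_integral_cmult mult.assoc)
    ultimately show ?thesis unfolding nn_integral_bridge_cdf by (simp only: mult.assoc[symmetric])
  qed
  also have "\<dots> = ennreal (2 / ?D) * ennreal (LBINT t:{0..u}. weight (min y 0) t)"
    unfolding LBINT_weight ..
  finally have "emeasure M {\<omega>\<in>space M. time_below (g \<omega>) (stretch y (g \<omega>) (sample_path {0..1} b \<omega>)) \<le> u}
    = ennreal ((atom_mass y + 2 * (LBINT t:{0..u}. weight (min y 0) t)) / ?D)"
    unfolding h0 law(2) using law(1) LBINT_weight_nonneg[of u "min y 0"]
    by (simp add: atom_mass_def add_divide_distrib ennreal_mult[symmetric] ennreal_plus[symmetric] del: ennreal_plus)
  then show ?thesis
    unfolding measure_def using law(1) LBINT_weight_nonneg[of u "min y 0"] by (simp add: atom_mass_def)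
qed

end

theorem theorem2:
  fixes M :: "'a measure" and y :: real and g :: "'a \<Rightarrow> real"
    and b Z Y :: "real \<Rightarrow> 'a \<Rightarrow> real" and u :: real
  assumes "prob_space M"
    and "g \<in> borel_measurable M" and "\<And>\<omega>. \<omega> \<in> space M \<Longrightarrow> g \<omega> \<ge> 0"
    and "\<And>x. x \<ge> 0 \<Longrightarrow> measure M {\<omega>\<in>space M. g \<omega> \<le> x} = g_cdf y x"
    and "continuous_process M {0..1} b"
    and "has_conditional_law M {0..1} b g (conditioned_bridge_law y)"
    and "bessel3 M 0 Z"
    and "indep_rv M
           (borel \<Otimes>\<^sub>M path_space {0..1}) (\<lambda>\<omega>. (g \<omega>, sample_path {0..1} b \<omega>))
           (path_space {0..}) (sample_path {0..} Z)"
    and "y > 0 \<Longrightarrow> bessel3 M y Y"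
    and "y > 0 \<Longrightarrow> indep_rv M
           (borel \<Otimes>\<^sub>M path_space {0..1} \<Otimes>\<^sub>M path_space {0..})
           (\<lambda>\<omega>. (g \<omega>, sample_path {0..1} b \<omega>, sample_path {0..} Z \<omega>))
           (path_space {0..}) (sample_path {0..} Y)"
    and "u \<in> {0..1}"
  shows "(y \<le> 0 \<longrightarrow>
            measure M {\<omega>\<in>space M. total_time_below (X_process y g b Z Y) \<omega> \<le> ennreal u} =
            (LBINT t:{0..u}. weight y t) / (LBINT t:{0..1}. weight y t)) \<and>
         (y \<ge> 0 \<longrightarrow>
            measure M {\<omega>\<in>space M. total_time_below (X_process y g b Z Y) \<omega> \<le> ennreal u} =
            (sqrt (2 * pi) * y + 2 * sqrt u) / (sqrt (2 * pi) * y + 2))"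
proof -
  interpret M: prob_space M by fact
  note [measurable] = assms(2)
  \<comment> \<open>\<open>wiener\<close> is a definite description; the Brownian motion behind \<open>Z\<close> shows that it denotes.\<close>
  obtain N :: "(real \<Rightarrow> real ^ 3) measure" and v R where "brownian_motion3 N v R"
    using \<open>bessel3 M 0 Z\<close> unfolding bessel3_def by blast
  then have bm: "brownian_motion N (\<lambda>t \<omega>. R t \<omega> $ 1 - v $ 1)" by (simp add: brownian_motion3_def)
  interpret wiener_measure
    by unfold_locales (rule brownian_motion_wiener[OF bm])+
  have cZ: "continuous_process M {0..} Z" and cY: "0 < y \<Longrightarrow> continuous_process M {0..} Y"
    using assms(7,9) by (simp_all add: bessel3_def)
  have Z: "AE \<omega> in M. \<forall>t\<ge>0. 0 \<le> Z t \<omega>" by (rule bessel3_nonneg) fact+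
  have Y: "AE \<omega> in M. 0 < y \<longrightarrow> (\<forall>t\<ge>0. 0 \<le> Y t \<omega>)"
    using bessel3_nonneg[OF assms(1) assms(9)] by (cases "0 < y") auto
  let ?\<tau> = "\<lambda>\<omega>. time_below (g \<omega>) (stretch y (g \<omega>) (sample_path {0..1} b \<omega>))"
  have [measurable]: "total_time_below (X_process y g b Z Y) \<in> borel_measurable M"
    by (rule measurable_total_time_below[OF assms(2,5) cZ cY])
  have "(\<lambda>\<omega>. (g \<omega>, sample_path {0..1} b \<omega>)) \<in> M \<rightarrow>\<^sub>M borel \<Otimes>\<^sub>M path_space {0..1}"
    using measurable_sample_path[OF assms(5)] by measurable
  from measurable_compose[OF this measurable_time_below_stretch, of y]
  have [measurable]: "?\<tau> \<in> borel_measurable M" by simp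
  have "measure M {\<omega>\<in>space M. total_time_below (X_process y g b Z Y) \<omega> \<le> ennreal u} = measure M {\<omega>\<in>space M. ?\<tau> \<omega> \<le> u}"
  proof (rule measure_eq_AE)
    show "AE \<omega> in M. \<omega> \<in> {\<omega>\<in>space M. total_time_below (X_process y g b Z Y) \<omega> \<le> ennreal u} \<longleftrightarrow> \<omega> \<in> {\<omega>\<in>space M. ?\<tau> \<omega> \<le> u}"
      using Z Y AE_space
    proof eventually_elim
      case (elim \<omega>)
      have "total_time_below (X_process y g b Z Y) \<omega> = ennreal (?\<tau> \<omega>)"
        using elim assms(3,5) by (intro total_time_below_eq) (auto simp: continuous_process_def)
      then show ?case using assms(11) time_below_nonneg by simp
    qed
  qed measurable
  also have "\<dots> = (atom_mass y + 2 * (LBINT t:{0..u}. weight (min y 0) t)) / g_normalizer y"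
    by (rule occupation_prob) fact+
  finally have eq: "measure M {\<omega>\<in>space M. total_time_below (X_process y g b Z Y) \<omega> \<le> ennreal u}
    = (atom_mass y + 2 * (LBINT t:{0..u}. weight (min y 0) t)) / g_normalizer y" .
  have "(atom_mass y + 2 * (LBINT t:{0..u}. weight (min y 0) t)) / g_normalizer y
    = (LBINT t:{0..u}. weight y t) / (LBINT t:{0..1}. weight y t)" if "y \<le> 0"
    using that by (simp add: g_normalizer_def atom_mass_def min_absorb1)
  moreover have "(atom_mass y + 2 * (LBINT t:{0..u}. weight (min y 0) t)) / g_normalizer y
    = (sqrt (2 * pi) * y + 2 * sqrt u) / (sqrt (2 * pi) * y + 2)" if "0 \<le> y"
  proof -
    \<comment> \<open>For y \<ge> 0 the weight is taken at 0, where it integrates to 2 sqrt u; a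
      common factor 2 remains to be cancelled.\<close>
    have "(atom_mass y + 2 * (LBINT t:{0..u}. weight (min y 0) t)) / g_normalizer y
      = (2 * (sqrt (2 * pi) * y + 2 * sqrt u)) / (2 * (sqrt (2 * pi) * y + 2))"
      using that assms(11) integral_weight_0[of u] integral_weight_0[of 1]
      by (simp add: g_normalizer_def atom_mass_def min_absorb2 distrib_left mult.assoc)
    then show ?thesis by (simp only: mult_divide_mult_cancel_left_if) simp
  qed
  ultimately show ?thesis unfolding eq by blast
qed


end
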